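(* The set $\mathcal{B}=\{q^{-\frac12ab}X_m^aX_{m+1}^b\mid m\in\mathbb{Z},(a,b)\in\mathbb{Z}_{\ge0}^2\}\cup\{F_n(X_\delta)\mid n\ge1\}$ is the canonical basis of $\mathcal{A}_q(1,4)$: it is a $\mathbb{Z}[q^{\pm\frac12}]$-basis of $\mathcal{A}_q(1,4)$ and every positive element of $\mathcal{A}_q(1,4)$ is an $\mathbb{N}[q^{\pm\frac12}]$-linear combination of elements of $\mathcal{B}$.
   Context: Let $\mathcal{T}$ be the quantum torus over $\mathbb{Z}[q^{\pm\frac12}]$ generated by $X_1^{\pm1},X_2^{\pm1}$ with $X_1X_2=qX_2X_1$, with skew field of fractions $\mathcal{F}$. Define $X_k\in\mathcal{F}$ ($k\in\mathbb{Z}$) by $X_{k-1}X_{k+1}=q^{\frac12}X_k+1$ for $k$ odd and $X_{k-1}X_{k+1}=q^2X_k^4+1$ for $k$ even; $\mathcal{A}_q(1,4)$ is the $\mathbb{Z}[q^{\pm\frac12}]$-subalgebra of $\mathcal{F}$ generated by all $X_k$. Put $X^{(a,b)}=q^{-\frac12ab}X_1^aX_2^b$ and $X_\delta=X^{(-1,-2)}+X^{(-1,2)}+X^{(1,-2)}+(q^{-\frac12}+q^{\frac12})X^{(0,-2)}$. Chebyshev polynomials: $F_0=1,F_1=x,F_2=x^2-2$, $F_{n+1}=F_nx-F_{n-1}$ for $n\ge2$. An element $Y\in\mathcal{A}_q(1,4)$ is positive if for every $m\in\mathbb{Z}$ the coefficients of its Laurent expansion in the cluster variables $X_m,X_{m+1}$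 belong to $\mathbb{N}[q^{\pm\frac12}]$. A $\mathbb{Z}[q^{\pm\frac12}]$-basis $\mathcal{C}$ is called the canonical basis if every positive element is an $\mathbb{N}[q^{\pm\frac12}]$-linear combination of elements of $\mathcal{C}$. *)

theory Defs
  imports Main HOL.Modules "HOL-Library.Poly_Mapping"
begin

text \<open>Laurent polynomials in t = q^(1/2) with integer coefficients, as finitely supported
  functions int =>0 int with convolution product.  tq k is the monomial t^k = q^(k/2).\<close>

type_synonym lpoly = "int \<Rightarrow>\<^sub>0 int"

definition tq :: "int \<Rightarrow> lpoly" where
  "tq k = Poly_Mapping.single k 1"

definition lpoly_nonneg :: "lpoly \<Rightarrow> bool" where
  "lpoly_nonneg p \<longleftrightarrow> (\<forall>k. 0 \<le> Poly_Mapping.lookup p k)"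

text \<open>Elements of the quantum torus are finitely supported functions Z^2 => Z[q^(+-1/2)];
  the point (a,b) stands for the normalized monomial X^(a,b) = q^(-ab/2) X1^a X2^b.
  Multiplication: X^e X^f = q^(Lambda(e,f)/2) X^(e+f), Lambda(e,f) = e1 f2 - e2 f1,
  which encodes X1 X2 = q X2 X1.\<close>

type_synonym qtorus = "(int \<times> int) \<Rightarrow>\<^sub>0 lpoly"

definition lam :: "int \<times> int \<Rightarrow> int \<times> int \<Rightarrow> int" where
  "lam e f = fst e * snd f - snd e * fst f"

definition qmon :: "int \<times> int \<Rightarrow> qtorus" where
  "qmon e = Poly_Mapping.single e 1"

definition tmult :: "qtorus \<Rightarrow> qtorus \<Rightarrow> qtorus" (infixl \<open>\<star>\<close> 70) where
  "x \<star> y = (\<Sum>e\<in>Poly_Mapping.keys x. \<Sum>f\<in>Poly_Mapping.keys y.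
              Poly_Mapping.single (fst e + fst f, snd e + snd f) (Poly_Mapping.lookup x e * Poly_Mapping.lookup y f * tq (lam e f)))"

definition tone :: qtorus where
  "tone = qmon (0, 0)"

definition tsmul :: "lpoly \<Rightarrow> qtorus \<Rightarrow> qtorus" where
  "tsmul c x = Poly_Mapping.single (0, 0) c \<star> x"

definition tpow :: "qtorus \<Rightarrow> nat \<Rightarrow> qtorus" where
  "tpow x n = ((\<lambda>y. y \<star> x) ^^ n) tone"

definition clrec :: "(int \<Rightarrow> qtorus) \<Rightarrow> bool" where
  "clrec s \<longleftrightarrow> s 1 = qmon (1, 0) \<and> s 2 = qmon (0, 1) \<and>
     (\<forall>k::int. odd k \<longrightarrow> s (k - 1) \<star> s (k + 1) = tsmul (tq 1) (s k) + tone) \<and>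
     (\<forall>k::int. even k \<longrightarrow> s (k - 1) \<star> s (k + 1) = tsmul (tq 4) (tpow (s k) 4) + tone)"

text \<open>The cluster variables X_k (they lie in the quantum torus by the quantum Laurent
  phenomenon, and are unique there since the torus is a domain).\<close>
definition Xc :: "int \<Rightarrow> qtorus" where
  "Xc = (THE s. clrec s)"

inductive_set Aq :: "qtorus set" where
  gen: "Xc k \<in> Aq"
| one: "tone \<in> Aq"
| add: "x \<in> Aq \<Longrightarrow> y \<in> Aq \<Longrightarrow> x + y \<in> Aq"
| mult: "x \<in> Aq \<Longrightarrow> y \<in> Aq \<Longrightarrow> x \<star> y \<in> Aq"
| smul: "x \<in> Aq \<Longrightarrow> tsmul c x \<in> Aq"

definition Xdelta :: qtorus where
  "Xdelta = qmon (-1, -2) + qmon (-1, 2) + qmon (1, -2) + tsmul (tq (-1) + tq 1) (qmon (0, -2))"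

fun cheb :: "nat \<Rightarrow> qtorus \<Rightarrow> qtorus" where
  "cheb 0 x = tone"
| "cheb (Suc 0) x = x"
| "cheb (Suc (Suc 0)) x = x \<star> x - tsmul 2 tone"
| "cheb (Suc (Suc (Suc n))) x = cheb (Suc (Suc n)) x \<star> x - cheb (Suc n) x"

definition Bset :: "qtorus set" where
  "Bset = {tsmul (tq (- (int a * int b))) (tpow (Xc m) a \<star> tpow (Xc (m + 1)) b) | m a b. True}
        \<union> {cheb n Xdelta | n. n \<ge> 1}"

text \<open>Y has Laurent expansion Y = sum c_(a,b) X_m^a X_(m+1)^b (a,b in Z) in the cluster
  (X_m, X_(m+1)), an identity in the skew field of fractions.  Clearing denominators
  (multiply by X_m^N on the left and X_(m+1)^N on the right), this is equivalent to an
  identity inside the quantum torus, which embeds in its skew field of fractions.\<close>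
definition laurent_exp :: "int \<Rightarrow> ((int \<times> int) \<Rightarrow>\<^sub>0 lpoly) \<Rightarrow> qtorus \<Rightarrow> bool" where
  "laurent_exp m c Y \<longleftrightarrow> (\<exists>N::nat.
      (\<forall>(a, b)\<in>Poly_Mapping.keys c. - int N \<le> a \<and> - int N \<le> b) \<and>
      tpow (Xc m) N \<star> Y \<star> tpow (Xc (m + 1)) N =
        (\<Sum>(a, b)\<in>Poly_Mapping.keys c. tsmul (Poly_Mapping.lookup c (a, b))
            (tpow (Xc m) (nat (a + int N)) \<star> tpow (Xc (m + 1)) (nat (b + int N)))))"

definition positive :: "qtorus \<Rightarrow> bool" where
  "positive Y \<longleftrightarrow> Y \<in> Aq \<and>
     (\<forall>m::int. \<exists>c. laurent_exp m c Y \<and> (\<forall>e. lpoly_nonneg (Poly_Mapping.lookup c e)))"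

end

theory Submission
  imports Defs "HOL-Library.Product_Plus" "HOL-Library.Product_Lexorder"
begin

text \<open>
  Write \<open>t\<close> for \<open>q^(1/2)\<close>. The element \<open>X_delta\<close> makes the cluster variables of even index a linear
  recurrent sequence, \<open>X_delta X_m = t^(-1) X_(m+2) + t X_(m-2)\<close>, and \<open>t X_m\<close> with \<open>m\<close> odd is
  \<open>X_(m-1) X_(m+1) - 1\<close>; all exchange relations, and with them the Laurent phenomenon, follow from this.

  Every element of the set \<open>B\<close> is pointed: its support has a least exponent vector for the componentwise
  order, with coefficient a power of \<open>t\<close>. Every vector of \<open>Z^2\<close> occurs exactly once in this way, whence
  linear independence. The standard monomials in \<open>X_0, X_1, X_2, X_3\<close> span the algebra and are pointed
  in the same way, and the transition to \<open>B\<close> is triangular.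

  For positivity, the coefficient of a cluster monomial of the cluster \<open>(X_m, X_(m+1))\<close> is the coefficient
  of that monomial in the expansion in this cluster: any other element of \<open>B\<close> has no term with the same
  exponents, because a degree with positive weights, computed by the tropical exchange relations, is negative
  on it. The coefficient of \<open>F_n(X_delta)\<close> is that of the exponent \<open>(-n, 2n)\<close>
  in the expansion in a cluster far to the right of all cluster monomials that occur. The expansions in
  the other clusters are reduced to the initial one by the shifts \<open>X_k \<mapsto> X_(k+2)\<close> and
  the reflections \<open>X_k \<mapsto> X_(m-k)\<close>, \<open>t \<mapsto> t^(-1)\<close>.
\<close>

section \<open>The quantum torus as a ring\<close>

text \<open>The skew field of fractions is never formed. Most cluster variables are not units of the
  torus, so substituting another cluster for \<open>X_1, X_2\<close> makes sense only for
  nonnegative exponents. An expansion is therefore a relation between two torus elements with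
  denominators cleared on the right, and it is carried along the exchange relations by cancellation
  in a domain.

  The vectors attached to \<open>X_k\<close> approach the direction \<open>(-1, -2)\<close> from its
  two sides as \<open>k\<close> goes to plus or minus infinity. Cluster monomials miss exactly the
  ray in this direction, and \<open>F_n(X_delta)\<close>, pointed at \<open>(-n, -2n)\<close>, fills
  the gap. On either side of the ray the index \<open>m\<close> and the exponents are recovered from
  the vector by division with remainder.

  A coefficient is extracted at an exponent that occurs in a single basis element, with coefficient
  1. For \<open>F_n(X_delta)\<close> this succeeds in a far cluster because \<open>X_delta\<close>
  has the same expansion in all clusters reached by even shifts, while the expansions of cluster
  monomials change.\<close>

lemma poly_mapping_single_induct [case_names single plus]:
  fixes f :: "'a \<Rightarrow>\<^sub>0 'b::comm_monoid_add"
  assumes single: "\<And>a b. P (Poly_Mapping.single a b)"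
    and plus: "\<And>f g. P f \<Longrightarrow> P g \<Longrightarrow> P (f + g)"
  shows "P f"
proof (induction f rule: update_induct)
  case const
  show ?case using single[of undefined 0] by simp
next
  case (update f a b)
  have "Poly_Mapping.update a b f = f + Poly_Mapping.single a b"
    using update(1)
    by (intro poly_mapping_eqI)
       (auto simp: lookup_update lookup_add lookup_single in_keys_iff when_def)
  then show ?case using plus single update by simp
qed

lemma tq_add: "tq (i + j) = tq i * tq j"
  by (simp add: tq_def mult_single)

lemma tq_0 [simp]: "tq 0 = 1"
  by (simp add: tq_def)

lemma tq_nonzero [simp]: "tq i \<noteq> 0"
  by (simp add: tq_def)

lemma lam_add_left: "lam (e + e') f = lam e f + lam e' f"
  and lam_add_right: "lam f (e + e') = lam f e + lam f e'"
  by (simp_all add: lam_def algebra_simps)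

lemma tmult_alt:
  "x \<star> y = (\<Sum>e\<in>Poly_Mapping.keys x. \<Sum>f\<in>Poly_Mapping.keys y.
     Poly_Mapping.single (e + f) (Poly_Mapping.lookup x e * Poly_Mapping.lookup y f * tq (lam e f)))"
  by (simp add: tmult_def plus_prod_def)

lemma tmult_single:
  "Poly_Mapping.single e a \<star> Poly_Mapping.single f b = Poly_Mapping.single (e + f) (a * b * tq (lam e f))"
  by (cases "a = 0"; cases "b = 0") (simp_all add: tmult_alt)

lemma tmult_add_left: "(x + y) \<star> z = x \<star> z + y \<star> z"
  unfolding tmult_alt
  by (subst setsum_keys_plus_distrib[where f = "\<lambda>e c. \<Sum>f\<in>Poly_Mapping.keys z.
     Poly_Mapping.single (e + f) (c * Poly_Mapping.lookup z f * tq (lam e f))"])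
     (simp_all add: sum.distrib algebra_simps single_add)

lemma tmult_add_right: "z \<star> (x + y) = z \<star> x + z \<star> y"
proof -
  have "(\<Sum>f\<in>Poly_Mapping.keys (x + y).
      Poly_Mapping.single (e + f) (Poly_Mapping.lookup z e * Poly_Mapping.lookup (x + y) f * tq (lam e f))) =
     (\<Sum>f\<in>Poly_Mapping.keys x.
      Poly_Mapping.single (e + f) (Poly_Mapping.lookup z e * Poly_Mapping.lookup x f * tq (lam e f))) +
     (\<Sum>f\<in>Poly_Mapping.keys y.
      Poly_Mapping.single (e + f) (Poly_Mapping.lookup z e * Poly_Mapping.lookup y f * tq (lam e f)))" for e
    by (subst setsum_keys_plus_distrib[where f = "\<lambda>f c.
     Poly_Mapping.single (e + f) (Poly_Mapping.lookup z e * c * tq (lam e f))"])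
     (simp_all add: algebra_simps single_add)
  then show ?thesis by (simp add: tmult_alt sum.distrib)
qed

lemma tmult_assoc: "(x \<star> y) \<star> z = x \<star> (y \<star> z)"
proof (induction x rule: poly_mapping_single_induct)
  case (single a b)
  then show ?case
  proof (induction y rule: poly_mapping_single_induct)
    case (single c d)
    then show ?case
      by (induction z rule: poly_mapping_single_induct)
         (simp_all add: tmult_single tmult_add_right lam_add_left lam_add_right tq_add ac_simps)
  qed (simp add: tmult_add_left tmult_add_right)
qed (simp add: tmult_add_left)

lemma tmult_lookup:
  "Poly_Mapping.lookup (x \<star> y) g = (\<Sum>e\<in>Poly_Mapping.keys x. \<Sum>f\<in>Poly_Mapping.keys y.
     if e + f = g then Poly_Mapping.lookup x e * Poly_Mapping.lookup y f * tq (lam e f) else 0)"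
  by (simp add: tmult_alt lookup_sum lookup_single when_def)

text \<open>A copy of the quantum torus type, whose ring structure is the twisted product.\<close>

typedef qt = "UNIV :: qtorus set" morphisms rep mk
  by simp

setup_lifting type_definition_qt

instantiation qt :: ring_1
begin
lift_definition zero_qt :: qt is 0 .
lift_definition one_qt :: qt is tone .
lift_definition plus_qt :: "qt \<Rightarrow> qt \<Rightarrow> qt" is plus .
lift_definition minus_qt :: "qt \<Rightarrow> qt \<Rightarrow> qt" is minus .
lift_definition uminus_qt :: "qt \<Rightarrow> qt" is uminus .
lift_definition times_qt :: "qt \<Rightarrow> qt \<Rightarrow> qt" is tmult .
instance
proof
  fix a b c :: qt
  show "a * b * c = a * (b * c)" by transfer (rule tmult_assoc)
  show "(a + b) * c = a * c + b * c" by transfer (rule tmult_add_left)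
  show "a * (b + c) = a * b + a * c" by transfer (rule tmult_add_right)
  show "1 * a = a"
  proof transfer
    fix a show "tone \<star> a = a"
      by (induction a rule: poly_mapping_single_induct)
         (simp_all add: tone_def qmon_def tmult_single tmult_add_right plus_prod_def lam_def)
  qed
  show "a * 1 = a"
  proof transfer
    fix a show "a \<star> tone = a"
      by (induction a rule: poly_mapping_single_induct)
         (simp_all add: tone_def qmon_def tmult_single tmult_add_left plus_prod_def lam_def)
  qed
  show "(0::qt) \<noteq> 1"
    by transfer (metis lookup_single_eq lookup_zero qmon_def tone_def zero_neq_one)
qed (transfer, simp add: algebra_simps)+
end

definition coef :: "qt \<Rightarrow> int \<times> int \<Rightarrow> lpoly" where
  "coef x = Poly_Mapping.lookup (rep x)"

definition supp :: "qt \<Rightarrow> (int \<times> int) set" where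
  "supp x = Poly_Mapping.keys (rep x)"

definition mon :: "lpoly \<Rightarrow> int \<times> int \<Rightarrow> qt" where
  "mon c e = mk (Poly_Mapping.single e c)"

lemma rep_mk [simp]: "rep (mk x) = x"
  by (simp add: mk_inverse)

abbreviation Xe :: "int \<times> int \<Rightarrow> qt" where "Xe \<equiv> mon 1"

definition sm :: "lpoly \<Rightarrow> qt \<Rightarrow> qt" (infixr \<open>\<cdot>\<close> 75) where
  "c \<cdot> x = mon c 0 * x"

lemma finite_supp [simp]: "finite (supp x)"
  by (simp add: supp_def)

lemma supp_iff: "e \<in> supp x \<longleftrightarrow> coef x e \<noteq> 0"
  by (simp add: supp_def coef_def in_keys_iff)

lemma qt_eqI: "(\<And>e. coef x e = coef y e) \<Longrightarrow> x = y"
  by (auto simp: coef_def rep_inject[symmetric] intro: poly_mapping_eqI)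

lemma coef_simps [simp]:
  "coef 0 e = 0" "coef (x + y) e = coef x e + coef y e" "coef (x - y) e = coef x e - coef y e" "coef (- x) e = - coef x e"
  by (simp_all add: coef_def zero_qt.rep_eq plus_qt.rep_eq minus_qt.rep_eq uminus_qt.rep_eq
      lookup_add lookup_minus)

lemma coef_sum [simp]: "coef (sum f A) e = (\<Sum>a\<in>A. coef (f a) e)"
  by (induction A rule: infinite_finite_induct) auto

lemma coef_mon: "coef (mon c e) f = (if e = f then c else 0)"
  by (simp add: coef_def mon_def lookup_single when_def)

lemma mon_mult: "mon a e * mon b f = mon (a * b * tq (lam e f)) (e + f)"
  by (simp add: rep_inject[symmetric] mon_def times_qt.rep_eq tmult_single)

lemma one_mon: "1 = Xe 0"
  by (simp add: rep_inject[symmetric] mon_def one_qt.rep_eq tone_def qmon_def zero_prod_def)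

lemma coef_1: "coef 1 e = (if e = 0 then 1 else 0)"
  by (simp add: one_mon coef_mon)

lemma coef_mult:
  "coef (x * y) g = (\<Sum>e\<in>supp x. \<Sum>f\<in>supp y. if e + f = g then coef x e * coef y f * tq (lam e f) else 0)"
  unfolding coef_def supp_def times_qt.rep_eq by (rule tmult_lookup)

lemma lam_0 [simp]: "lam 0 e = 0" "lam e 0 = 0" "lam e e = 0"
  by (simp_all add: lam_def)

text \<open>No cancellation is possible at an exponent that arises from one pair of support points
  only; if \<open>e\<close> or \<open>f\<close> lies outside the supports, both sides vanish.
  Absence of zero divisors, additivity of degrees and products of pointed elements all rest on
  this.\<close>

lemma coef_mult_corner:
  assumes "\<And>e' f'. e' \<in> supp x \<Longrightarrow> f' \<in> supp y \<Longrightarrow> e' + f' = e + f \<Longrightarrow> e' = e"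
  shows "coef (x * y) (e + f) = coef x e * coef y f * tq (lam e f)"
proof -
  have "coef (x * y) (e + f) = (\<Sum>e'\<in>supp x. \<Sum>f'\<in>supp y.
      if e' = e \<and> f' = f then coef x e * coef y f * tq (lam e f) else 0)"
  proof (unfold coef_mult, intro sum.cong refl if_cong)
    fix e' f' assume "e' \<in> supp x" "f' \<in> supp y"
    then show "e' + f' = e + f \<longleftrightarrow> e' = e \<and> f' = f"
      using assms by (metis add_left_cancel)
  qed auto
  also have "\<dots> = (\<Sum>e'\<in>supp x. if e' = e then coef x e * coef y f * tq (lam e f) else 0)"
    by (intro sum.cong refl) (auto simp: supp_iff sum.delta')
  also have "\<dots> = coef x e * coef y f * tq (lam e f)"
    by (auto simp: supp_iff)
  finally show ?thesis .
qed

lemma supp_mon_0: "e \<in> supp (mon c 0) \<Longrightarrow> e = 0"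
  by (simp add: supp_iff coef_mon split: if_splits)

lemma coef_sm [simp]: "coef (c \<cdot> x) e = c * coef x e"
  using coef_mult_corner[of "mon c 0" x 0 e] by (simp add: supp_mon_0 sm_def coef_mon)

lemma mon_central: "mon c 0 * x = x * mon c 0"
proof (intro qt_eqI)
  fix e
  have "coef (x * mon c 0) (e + 0) = coef x e * coef (mon c 0) 0 * tq (lam e 0)"
    by (rule coef_mult_corner) (metis add_0_right supp_mon_0)
  then show "coef (mon c 0 * x) e = coef (x * mon c 0) e"
    by (simp add: coef_mon mult.commute flip: sm_def)
qed

lemma sm_add_left: "(c + d) \<cdot> x = c \<cdot> x + d \<cdot> x"
  and sm_diff_left: "(c - d) \<cdot> x = c \<cdot> x - d \<cdot> x"
  and sm_minus_left: "(- c) \<cdot> x = - (c \<cdot> x)"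
  and sm_add_right: "c \<cdot> (x + y) = c \<cdot> x + c \<cdot> y"
  and sm_diff_right: "c \<cdot> (x - y) = c \<cdot> x - c \<cdot> y"
  and sm_minus_right: "c \<cdot> (- x) = - (c \<cdot> x)"
  and sm_zero_left [simp]: "0 \<cdot> x = 0"
  and sm_zero_right [simp]: "c \<cdot> 0 = 0"
  and sm_one [simp]: "1 \<cdot> x = x"
  and sm_sm [simp]: "c \<cdot> d \<cdot> x = (c * d) \<cdot> x"
  by (intro qt_eqI; simp add: algebra_simps)+

lemma sm_mult_left [simp]: "(c \<cdot> x) * y = c \<cdot> (x * y)"
  by (simp add: sm_def mult.assoc)

lemma sm_mult_right [simp]: "x * (c \<cdot> y) = c \<cdot> (x * y)"
  by (metis sm_def mon_central mult.assoc)

lemma sm_sum_right: "c \<cdot> (sum f A) = (\<Sum>a\<in>A. c \<cdot> f a)"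
  by (intro qt_eqI) (simp add: sum_distrib_left)

lemma mon_sm: "mon c e = c \<cdot> Xe e"
  by (intro qt_eqI) (simp add: coef_mon)

lemma Xe_mult: "Xe e * Xe f = tq (lam e f) \<cdot> Xe (e + f)"
  by (simp add: mon_mult mon_sm[of "tq _"])

lemma supp_add: "supp (x + y) \<subseteq> supp x \<union> supp y"
  and supp_diff: "supp (x - y) \<subseteq> supp x \<union> supp y"
  and supp_sm: "supp (c \<cdot> x) \<subseteq> supp x"
  by (auto simp: supp_iff)

lemma supp_mult: "g \<in> supp (x * y) \<Longrightarrow> \<exists>e\<in>supp x. \<exists>f\<in>supp y. g = e + f"
proof (rule ccontr)
  assume "g \<in> supp (x * y)" and "\<not> (\<exists>e\<in>supp x. \<exists>f\<in>supp y. g = e + f)"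
  then have "coef (x * y) g = 0"
    unfolding coef_mult by (intro sum.neutral ballI) auto
  with \<open>g \<in> supp (x * y)\<close> show False by (simp add: supp_iff)
qed

lemma qt_expand: "x = (\<Sum>e\<in>supp x. coef x e \<cdot> Xe e)"
  by (intro qt_eqI) (auto simp: coef_mon supp_iff sum.delta if_distrib cong: if_cong)

lemma supp_empty: "supp x = {} \<longleftrightarrow> x = 0"
  by (metis coef_simps(1) ex_in_conv qt_eqI supp_iff)

definition wt :: "int \<times> int \<Rightarrow> int \<times> int \<Rightarrow> int" where
  "wt g e = fst g * fst e + snd g * snd e"

lemma wt_add: "wt g (e + f) = wt g e + wt g f"
  and wt_0 [simp]: "wt g 0 = 0"
  by (simp_all add: wt_def algebra_simps)

text \<open>Several terms may share the maximal weight. Comparing weight and exponent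
  lexicographically breaks ties by an order compatible with addition, so leading terms are unique
  and multiply without cancellation.\<close>

lemma lex_max_exists:
  assumes "x \<noteq> 0"
  obtains e where "e \<in> supp x" "\<And>e'. e' \<in> supp x \<Longrightarrow> (wt g e', e') \<le> (wt g e, e)"
proof -
  let ?S = "(\<lambda>e. (wt g e, e)) ` supp x"
  have "?S \<noteq> {}" using assms by (simp add: supp_empty)
  then have "Max ?S \<in> ?S" by (intro Max_in) auto
  then obtain e where "e \<in> supp x" "Max ?S = (wt g e, e)" by auto
  moreover have "(wt g e', e') \<le> Max ?S" if "e' \<in> supp x" for e'
    using that by (intro Max_ge) auto
  ultimately show ?thesis using that by metis
qed

lemma coef_mult_lex_max:
  assumes "e \<in> supp x" "\<And>e'. e' \<in> supp x \<Longrightarrow> (wt g e', e') \<le> (wt g e, e)"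
    and "f \<in> supp y" "\<And>f'. f' \<in> supp y \<Longrightarrow> (wt g f', f') \<le> (wt g f, f)"
  shows "e + f \<in> supp (x * y)"
proof -
  have "coef (x * y) (e + f) = coef x e * coef y f * tq (lam e f)"
  proof (rule coef_mult_corner)
    fix e' f' assume *: "e' \<in> supp x" "f' \<in> supp y" "e' + f' = e + f"
    then have "wt g e' + wt g f' = wt g e + wt g f"
      by (simp flip: wt_add)
    with assms(2)[OF *(1)] assms(4)[OF *(2)] *(3) show "e' = e"
      by (cases e; cases e'; cases f; cases f') (auto simp: less_eq_prod_def less_prod_def)
  qed
  then show ?thesis using assms by (simp add: supp_iff)
qed

instance qt :: ring_1_no_zero_divisors
proof
  fix x y :: qt assume "x \<noteq> 0" "y \<noteq> 0"
  with lex_max_exists[of x 0] lex_max_exists[of y 0] coef_mult_lex_max[of _ x 0 _ y]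
  have "supp (x * y) \<noteq> {}" by (metis empty_iff)
  then show "x * y \<noteq> 0" by (simp add: supp_empty)
qed

section \<open>The cluster variables\<close>

lemmas q_simps = sm_add_left sm_diff_left sm_minus_left sm_add_right sm_diff_right sm_minus_right
  tq_add[symmetric] algebra_simps

definition Xdelta_qt :: qt where
  "Xdelta_qt = Xe (-1, -2) + Xe (-1, 2) + Xe (1, -2) + (tq (-1) + tq 1) \<cdot> Xe (0, -2)"

text \<open>The solution \<open>X_0\<close> of \<open>X_0 X_2 = t X_1 + 1\<close>, written in
  normalized monomials.\<close>

definition ev0 :: qt where "ev0 = Xe (1, -1) + Xe (0, -1)"
definition ev1 :: qt where "ev1 = Xe (0, 1)"

fun ev_up :: "nat \<Rightarrow> qt" where
  "ev_up 0 = ev0"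
| "ev_up (Suc 0) = ev1"
| "ev_up (Suc (Suc n)) = tq 1 \<cdot> (Xdelta_qt * ev_up (Suc n)) - tq 2 \<cdot> ev_up n"

text \<open>The recurrence solved for its lowest term: \<open>ev_down n\<close> stands for
  \<open>ev (1 - n)\<close>, so that both directions start from the same pair
  \<open>ev0, ev1\<close>.\<close>

fun ev_down :: "nat \<Rightarrow> qt" where
  "ev_down 0 = ev1"
| "ev_down (Suc 0) = ev0"
| "ev_down (Suc (Suc n)) = tq (-1) \<cdot> (Xdelta_qt * ev_down (Suc n)) - tq (-2) \<cdot> ev_down n"

text \<open>The cluster variables with even index form a linear recurrent sequence with
  characteristic element \<open>Xdelta_qt\<close>, so that they can be defined without any division; \<open>ev j\<close> is \<open>X_2j\<close>.\<close>

definition ev :: "int \<Rightarrow> qt" where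
  "ev j = (if j \<ge> 0 then ev_up (nat j) else ev_down (nat (1 - j)))"

text \<open>\<open>od j\<close> is \<open>X_(2j+1)\<close>. This choice makes the exchange relation
  at odd indices an identity; the one at even indices remains to be proved.\<close>

definition od :: "int \<Rightarrow> qt" where
  "od j = tq (-1) \<cdot> (ev j * ev (j + 1) - 1)"

lemma ev_rec: "ev (j + 1) = tq 1 \<cdot> (Xdelta_qt * ev j) - tq 2 \<cdot> ev (j - 1)"
proof (cases "j \<ge> 1")
  case True
  then obtain n where j: "j = int n + 1" by (metis add.commute zle_iff_zadd)
  have "nat (j + 1) = Suc (Suc n)" "nat j = Suc n" "nat (j - 1) = n" using j by auto
  then show ?thesis using True by (simp add: ev_def)
next
  case False
  define n where "n = nat (- j)"
  have n: "nat (1 - j) = Suc n" "nat (1 - (j - 1)) = Suc (Suc n)" "nat (1 - (j + 1)) = n" "j = - int n"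
    using False by (auto simp: n_def)
  have "ev_down n = tq 1 \<cdot> (Xdelta_qt * ev_down (Suc n)) - tq 2 \<cdot> ev_down (Suc (Suc n))"
    by (simp add: q_simps)
  moreover have "ev (j + 1) = ev_down n" "ev j = ev_down (Suc n)" "ev (j - 1) = ev_down (Suc (Suc n))"
  proof -
    consider "n = 0" | "n = 1" | "n \<ge> 2" by linarith
    then show "ev (j + 1) = ev_down n"
    proof cases
      case 3
      then have "j + 1 < 0" using n by simp
      then show ?thesis using n(3) by (simp add: ev_def)
    qed (use n in \<open>auto simp: ev_def\<close>)
    show "ev j = ev_down (Suc n)" using n
      by (cases n) (auto simp: ev_def)
    show "ev (j - 1) = ev_down (Suc (Suc n))" using n by (auto simp: ev_def)
  qed
  ultimately show ?thesis by simp
qed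

lemma ev_0: "ev 0 = ev0" and ev_1: "ev 1 = ev1"
  by (simp_all add: ev_def)

lemma ev_2: "ev 2 = tq 1 \<cdot> (Xdelta_qt * ev1) - tq 2 \<cdot> ev0"
  using ev_rec[of 1] by (simp add: ev_0 ev_1)

lemma int_const:
  assumes "\<And>j::int. f (j + 1) = f j"
  shows "f j = f i"
proof (induction j rule: int_induct[where k = i])
  case (step2 k)
  then show ?case using assms[of "k - 1"] by simp
qed (auto simp: assms)

text \<open>Two neighbouring zeros propagate in both directions, downwards because
  \<open>tq 2\<close> is a unit. Identities linear in the sequence \<open>ev\<close> thus reduce to
  the indices 0 and 1.\<close>

lemma ev_linear_rec_zero:
  assumes rec: "\<And>j. D (j + 1) = tq 1 \<cdot> (Xdelta_qt * D j) - tq 2 \<cdot> D (j - 1)" and "D 0 = 0" "D 1 = 0"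
  shows "D (j::int) = 0"
proof -
  have "D j = 0 \<and> D (j + 1) = 0"
  proof (induction j rule: int_induct[where k = 0])
    case (step1 k)
    then show ?case using rec[of "k + 1"] by simp
  next
    case (step2 k)
    have "D (k - 1) = tq (-2) \<cdot> (tq 1 \<cdot> (Xdelta_qt * D k) - D (k + 1))"
      unfolding rec[of k] by (simp add: q_simps)
    then show ?case using step2 by simp
  qed (use assms in auto)
  then show ?thesis by simp
qed

text \<open>The left recurrence survives multiplication by \<open>Xdelta_qt\<close> on either side,
  so the defect of the commutation rule obeys it too. The rule turns the left recurrence into the
  right one, in which \<open>t\<close> is inverted.\<close>

lemma ev_Xdelta_qt_comm: "ev j * Xdelta_qt - tq 2 \<cdot> (Xdelta_qt * ev j) = (tq (-1) - tq 3) \<cdot> ev (j - 1)"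
proof -
  define D where "D j = ev j * Xdelta_qt - tq 2 \<cdot> (Xdelta_qt * ev j) - (tq (-1) - tq 3) \<cdot> ev (j - 1)" for j
  have "D j = 0"
  proof (rule ev_linear_rec_zero)
    fix j
    have *: "ev j = tq 1 \<cdot> (Xdelta_qt * ev (j - 1)) - tq 2 \<cdot> ev (j - 2)"
      using ev_rec[of "j - 1"] by simp
    have "D (j + 1) - tq 1 \<cdot> (Xdelta_qt * D j) + tq 2 \<cdot> D (j - 1) =
      (tq (-1) - tq 3) \<cdot> (tq 1 \<cdot> (Xdelta_qt * ev (j - 1)) - tq 2 \<cdot> ev (j - 2) - ev j)"
      unfolding D_def ev_rec[of j] by (simp add: q_simps)
    also have "\<dots> = 0" using * by simp
    finally show "D (j + 1) = tq 1 \<cdot> (Xdelta_qt * D j) - tq 2 \<cdot> D (j - 1)"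
      by (simp add: algebra_simps)
  next
    show "D 1 = 0"
      by (simp add: D_def ev_1 ev_0 ev1_def ev0_def Xdelta_qt_def q_simps Xe_mult lam_def)
    have "ev (-1) = tq (-1) \<cdot> (Xdelta_qt * ev0) - tq (-2) \<cdot> ev1"
      by (simp add: ev_def numeral_2_eq_2)
    then show "D 0 = 0"
      by (simp add: D_def ev_1 ev_0 ev1_def ev0_def Xdelta_qt_def q_simps Xe_mult lam_def)
  qed
  then show ?thesis by (simp add: D_def)
qed

lemma Xdelta_qt_ev: "Xdelta_qt * ev j = tq (-1) \<cdot> ev (j + 1) + tq 1 \<cdot> ev (j - 1)"
  unfolding ev_rec[of j] by (simp add: q_simps)

lemma ev_Xdelta_qt: "ev j * Xdelta_qt = tq 1 \<cdot> ev (j + 1) + tq (-1) \<cdot> ev (j - 1)"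
  using ev_Xdelta_qt_comm[of j] by (simp add: Xdelta_qt_ev q_simps)

lemma ev_ev_Xdelta_qt: "ev j * (Xdelta_qt * x) = tq 1 \<cdot> (ev (j + 1) * x) + tq (-1) \<cdot> (ev (j - 1) * x)"
  by (simp add: ev_Xdelta_qt distrib_right flip: mult.assoc)

lemma ev_rec': "ev (j + 1) = tq (-1) \<cdot> (ev j * Xdelta_qt) - tq (-2) \<cdot> ev (j - 1)"
  by (simp add: ev_Xdelta_qt q_simps)

text \<open>The quadratic expression is a conserved quantity of the linear recurrence, so its value
  can be computed at \<open>j = 1\<close>, from \<open>X_0, X_2, X_4\<close> in the initial
  cluster.\<close>

lemma Xdelta_qt_eq: "Xdelta_qt = tq 1 \<cdot> (ev (j - 1) * ev (j + 1)) - tq 3 \<cdot> (ev j * ev j)"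
proof -
  define T where "T j = tq 1 \<cdot> (ev (j - 1) * ev (j + 1)) - tq 3 \<cdot> (ev j * ev j)" for j
  have "T j = T 1"
  proof (rule int_const)
    fix j
    have "T (j + 1) = tq 1 \<cdot> (ev j * ev (j + 1 + 1)) - tq 3 \<cdot> (ev (j + 1) * ev (j + 1))"
      by (simp add: T_def)
    also have "\<dots> = T j"
      unfolding ev_rec[of "j + 1"] by (simp add: T_def q_simps ev_ev_Xdelta_qt)
    finally show "T (j + 1) = T j" .
  qed
  also have "T 1 = Xdelta_qt"
    by (simp add: T_def ev_2 ev_1 ev_0 ev1_def ev0_def Xdelta_qt_def q_simps Xe_mult lam_def)
  finally show ?thesis by (simp add: T_def)
qed

text \<open>The same invariant with factors reversed and \<open>t\<close> inverted, from the right
  recurrence; reflections need this form.\<close>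

lemma Xdelta_qt_eq': "Xdelta_qt = tq (-1) \<cdot> (ev (j + 1) * ev (j - 1)) - tq (-3) \<cdot> (ev j * ev j)"
proof -
  define T where "T j = tq (-1) \<cdot> (ev (j + 1) * ev (j - 1)) - tq (-3) \<cdot> (ev j * ev j)" for j
  have "T j = T 1"
  proof (rule int_const)
    fix j
    have "T (j + 1) = tq (-1) \<cdot> (ev (j + 1 + 1) * ev j) - tq (-3) \<cdot> (ev (j + 1) * ev (j + 1))"
      by (simp add: T_def)
    also have "\<dots> = T j"
      unfolding ev_rec'[of "j + 1"] by (simp add: T_def q_simps Xdelta_qt_ev)
    finally show "T (j + 1) = T j" .
  qed
  also have "T 1 = Xdelta_qt"
    by (simp add: T_def ev_2 ev_1 ev_0 ev1_def ev0_def Xdelta_qt_def q_simps Xe_mult lam_def)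
  finally show ?thesis by (simp add: T_def)
qed

text \<open>A twisted Casoratian: with the right recurrence in one product and the left one in the
  other, the terms containing \<open>Xdelta_qt\<close> cancel, so the expression does not depend on
  \<open>j\<close>.\<close>

lemma ev_ev_Suc: "ev j * ev (j + 1) = tq 2 \<cdot> (ev (j + 1) * ev j) + (1 - tq 2) \<cdot> 1"
proof -
  define T where "T j = tq 2 \<cdot> (ev (j + 1) * ev j) - ev j * ev (j + 1)" for j
  have "T j = T 0"
  proof (rule int_const)
    fix j
    have "T (j + 1) = tq 2 \<cdot> (ev (j + 1 + 1) * ev (j + 1)) - ev (j + 1) * ev (j + 1 + 1)"
      by (simp add: T_def)
    also have "\<dots> = tq 2 \<cdot> ((tq (-1) \<cdot> (ev (j + 1) * Xdelta_qt) - tq (-2) \<cdot> ev j) * ev (j + 1))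
        - ev (j + 1) * (tq 1 \<cdot> (Xdelta_qt * ev (j + 1)) - tq 2 \<cdot> ev j)"
      using ev_rec[of "j + 1"] ev_rec'[of "j + 1"] by simp
    also have "\<dots> = T j"
      by (simp add: T_def q_simps)
    finally show "T (j + 1) = T j" .
  qed
  also have "T 0 = (tq 2 - 1) \<cdot> 1"
    by (simp add: T_def ev_1 ev_0 ev1_def ev0_def q_simps Xe_mult lam_def one_mon zero_prod_def)
  finally show ?thesis by (simp add: T_def q_simps)
qed

lemma ev_Suc_ev: "ev (j + 1) * ev j = tq (-2) \<cdot> (ev j * ev (j + 1)) + (1 - tq (-2)) \<cdot> 1"
  unfolding ev_ev_Suc by (simp add: q_simps)

lemma ev_exch: "ev j * ev (j + 1) = tq 1 \<cdot> od j + 1"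
  by (simp add: od_def q_simps)

lemma ev_exch': "ev (j + 1) * ev j = tq (-1) \<cdot> od j + 1"
  by (simp add: od_def ev_Suc_ev[of j] sm_diff_left sm_diff_right sm_sm flip: tq_add)

lemma od_exch: "od (j - 1) * od j = tq 4 \<cdot> ev j ^ 4 + 1"
proof -
  define a b c where abc: "a = ev (j - 1)" "b = ev j" "c = ev (j + 1)"
  have ab: "a * b = tq 2 \<cdot> (b * a) + (1 - tq 2) \<cdot> 1"
    using ev_ev_Suc[of "j - 1"] by (simp add: abc)
  have abx: "a * (b * x) = tq 2 \<cdot> (b * (a * x)) + (1 - tq 2) \<cdot> x" for x
    by (simp add: ab distrib_right flip: mult.assoc)
  have ac: "a * c = tq (-1) \<cdot> Xdelta_qt + tq 2 \<cdot> (b * b)"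
    by (subst Xdelta_qt_eq[of j]) (simp add: abc q_simps)
  have bz: "b * Xdelta_qt = tq 1 \<cdot> c + tq (-1) \<cdot> a"
    by (simp add: abc ev_Xdelta_qt)
  \<comment> \<open>Sorting \<open>a b b c\<close> brings \<open>a\<close> next to \<open>c\<close>.
    Then \<open>a c\<close> is traded for \<open>Xdelta_qt\<close> and \<open>b b\<close>, and
    \<open>b Xdelta_qt\<close> gives back \<open>c\<close> and \<open>a\<close>; all mixed terms
    cancel.\<close>
  have "(a * b - 1) * (b * c - 1) = tq 6 \<cdot> b ^ 4 + tq 2 \<cdot> 1"
    by (simp add: q_simps ab abx ac bz power4_eq_xxxx)
  moreover have "od (j - 1) * od j = tq (-2) \<cdot> ((a * b - 1) * (b * c - 1))"
    by (simp add: od_def abc flip: tq_add)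
  ultimately show ?thesis by (simp add: abc q_simps)
qed

lemma ev_od: "ev j * od j = tq 2 \<cdot> (od j * ev j)"
proof -
  define b c where bc: "b = ev j" "c = ev (j + 1)"
  have cb: "c * b = tq (-2) \<cdot> (b * c) + (1 - tq (-2)) \<cdot> 1"
    by (simp add: bc ev_Suc_ev)
  have "b * (tq (-1) \<cdot> (b * c - 1)) = tq 2 \<cdot> ((tq (-1) \<cdot> (b * c - 1)) * b)"
    by (simp add: q_simps cb)
  then show ?thesis by (simp only: od_def bc)
qed

lemma od_ev: "od j * ev (j + 1) = tq 2 \<cdot> (ev (j + 1) * od j)"
proof -
  define b c where bc: "b = ev j" "c = ev (j + 1)"
  have "b * c = tq 2 \<cdot> (c * b) + (1 - tq 2) \<cdot> 1"
    by (simp add: bc ev_ev_Suc)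
  then have bcx: "b * (c * x) = tq 2 \<cdot> (c * (b * x)) + (1 - tq 2) \<cdot> x" for x
    by (simp add: distrib_right flip: mult.assoc)
  have "(tq (-1) \<cdot> (b * c - 1)) * c = tq 2 \<cdot> (c * (tq (-1) \<cdot> (b * c - 1)))"
    by (simp add: q_simps bcx)
  then show ?thesis by (simp only: od_def bc)
qed

section \<open>The full sequence of cluster variables and its exchange relations\<close>

definition Xq :: "int \<Rightarrow> qt" where
  "Xq k = (if even k then ev (k div 2) else od (k div 2))"

lemma Xq_1: "Xq 1 = Xe (1, 0)"
  by (simp add: Xq_def od_def ev_1 ev_0 ev1_def ev0_def q_simps Xe_mult lam_def one_mon zero_prod_def)

lemma Xq_2: "Xq 2 = Xe (0, 1)"
  by (simp add: Xq_def ev_1 ev1_def)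

lemma Xq_exch_odd: "odd k \<Longrightarrow> Xq (k - 1) * Xq (k + 1) = tq 1 \<cdot> Xq k + 1"
  by (auto simp: Xq_def ev_exch elim!: oddE)

lemma Xq_exch_odd': "odd k \<Longrightarrow> Xq (k + 1) * Xq (k - 1) = tq (-1) \<cdot> Xq k + 1"
  by (auto simp: Xq_def ev_exch' elim!: oddE)

lemma Xq_exch_even: "even k \<Longrightarrow> Xq (k - 1) * Xq (k + 1) = tq 4 \<cdot> Xq k ^ 4 + 1"
proof (elim evenE)
  fix j assume k: "k = 2 * j"
  then have "(k - 1) div 2 = j - 1" "(k + 1) div 2 = j" by auto
  then show ?thesis using k by (simp add: Xq_def od_exch)
qed

lemma Xq_comm: "Xq k * Xq (k + 1) = tq 2 \<cdot> (Xq (k + 1) * Xq k)"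
proof (cases "even k")
  case True
  then show ?thesis by (auto simp: Xq_def ev_od elim!: evenE)
next
  case False
  then obtain j where "k = 2 * j + 1" by (elim oddE)
  then have "k div 2 = j" "(k + 1) div 2 = j + 1" by auto
  then show ?thesis using False by (simp add: Xq_def od_ev)
qed

section \<open>Degrees\<close>

definition deg_le :: "int \<times> int \<Rightarrow> qt \<Rightarrow> int \<Rightarrow> bool" where
  "deg_le g x n \<longleftrightarrow> (\<forall>e\<in>supp x. wt g e \<le> n)"

definition deg_eq :: "int \<times> int \<Rightarrow> qt \<Rightarrow> int \<Rightarrow> bool" where
  "deg_eq g x n \<longleftrightarrow> deg_le g x n \<and> (\<exists>e\<in>supp x. wt g e = n)"

lemma vleD: "deg_le g x n \<Longrightarrow> n < wt g e \<Longrightarrow> coef x e = 0"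
  by (force simp: deg_le_def supp_iff)

lemma deg_le_mono: "deg_le g x m \<Longrightarrow> m \<le> n \<Longrightarrow> deg_le g x n"
  by (force simp: deg_le_def)

lemma deg_eq_nonzero: "deg_eq g x n \<Longrightarrow> x \<noteq> 0"
  by (auto simp: deg_eq_def supp_iff)

lemma deg_le_mult: "deg_le g x m \<Longrightarrow> deg_le g y n \<Longrightarrow> deg_le g (x * y) (m + n)"
  unfolding deg_le_def by (metis add_mono supp_mult wt_add)

lemma deg_le_add: "deg_le g x n \<Longrightarrow> deg_le g y n \<Longrightarrow> deg_le g (x + y) n"
  and deg_le_diff: "deg_le g x n \<Longrightarrow> deg_le g y n \<Longrightarrow> deg_le g (x - y) n"
  and deg_le_sm: "deg_le g x n \<Longrightarrow> deg_le g (c \<cdot> x) n"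
  using supp_add supp_diff supp_sm by (fastforce simp: deg_le_def)+

lemma deg_le_Xe: "wt g e \<le> n \<Longrightarrow> deg_le g (Xe e) n"
  by (auto simp: deg_le_def supp_iff coef_mon split: if_splits)

lemma deg_eq_Xe: "deg_eq g (Xe e) (wt g e)"
  by (auto simp: deg_eq_def deg_le_Xe supp_iff coef_mon)

lemma deg_eq_1: "deg_eq g 1 0"
  using deg_eq_Xe[of g 0] by (simp add: one_mon)

lemma deg_eq_sm: "deg_eq g x n \<Longrightarrow> deg_eq g (tq i \<cdot> x) n"
  by (auto simp: deg_eq_def deg_le_def supp_iff)

lemma deg_eq_add: "deg_eq g x n \<Longrightarrow> deg_le g y m \<Longrightarrow> m < n \<Longrightarrow> deg_eq g (x + y) n"
  unfolding deg_eq_def using deg_le_add[OF _ deg_le_mono]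
  by (metis add.right_neutral coef_simps(2) less_imp_le supp_iff vleD)

lemma deg_eq_exists: "x \<noteq> 0 \<Longrightarrow> \<exists>n. deg_eq g x n"
proof -
  assume "x \<noteq> 0"
  then obtain e where "e \<in> supp x" "\<And>e'. e' \<in> supp x \<Longrightarrow> (wt g e', e') \<le> (wt g e, e)"
    using lex_max_exists[of x g] by metis
  then show ?thesis by (force simp: deg_eq_def deg_le_def)
qed

lemma deg_eq_mult:
  assumes "deg_eq g x m" "deg_eq g y n"
  shows "deg_eq g (x * y) (m + n)"
proof -
  obtain e where e: "e \<in> supp x" "\<And>e'. e' \<in> supp x \<Longrightarrow> (wt g e', e') \<le> (wt g e, e)"
    using lex_max_exists[OF deg_eq_nonzero[OF assms(1)], of g] by metis
  obtain f where f: "f \<in> supp y" "\<And>f'. f' \<in> supp y \<Longrightarrow> (wt g f', f') \<le> (wt g f, f)"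
    using lex_max_exists[OF deg_eq_nonzero[OF assms(2)], of g] by metis
  have "wt g e = m" using assms(1) e by (force simp: deg_eq_def deg_le_def)
  moreover have "wt g f = n" using assms(2) f by (force simp: deg_eq_def deg_le_def)
  ultimately have "wt g (e + f) = m + n" by (simp add: wt_add)
  then show ?thesis
    using coef_mult_lex_max[OF e f] deg_le_mult[of g x m y n] assms by (auto simp: deg_eq_def)
qed

lemma deg_eq_power: "deg_eq g x m \<Longrightarrow> deg_eq g (x ^ n) (int n * m)"
  by (induction n) (auto simp: deg_eq_1 algebra_simps dest: deg_eq_mult)

lemma deg_eq_unique: "deg_eq g x m \<Longrightarrow> deg_eq g x n \<Longrightarrow> m = n"
  by (force simp: deg_eq_def deg_le_def)

text \<open>A nonzero \<open>y\<close> has some degree, and additivity forces its value. This is how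
  degrees of new cluster variables are read off from exchange relations.\<close>

lemma deg_eq_div_left: "deg_eq g x m \<Longrightarrow> deg_eq g (x * y) n \<Longrightarrow> deg_eq g y (n - m)"
  by (metis add_diff_cancel_left' mult_zero_right deg_eq_exists deg_eq_mult deg_eq_nonzero deg_eq_unique)

lemma deg_eq_div_right: "deg_eq g y m \<Longrightarrow> deg_eq g (x * y) n \<Longrightarrow> deg_eq g x (n - m)"
  by (metis add_diff_cancel_right' mult_zero_left deg_eq_exists deg_eq_mult deg_eq_nonzero deg_eq_unique)

section \<open>Pointed elements\<close>

definition pointed :: "int \<times> int \<Rightarrow> qt \<Rightarrow> bool" where
  "pointed p x \<longleftrightarrow> (\<forall>e\<in>supp x. fst p \<le> fst e \<and> snd p \<le> snd e) \<and> (\<exists>i. coef x p = tq i)"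

lemma pointed_nonzero: "pointed p x \<Longrightarrow> x \<noteq> 0"
  by (auto simp: pointed_def dest: sym)

lemma pointed_Xe: "pointed p (Xe p)"
  by (auto simp: pointed_def supp_iff coef_mon split: if_splits intro: exI[of _ 0])

lemma pointed_1: "pointed 0 1"
  by (simp add: one_mon pointed_Xe)

lemma pointed_sm: "pointed p x \<Longrightarrow> pointed p (tq i \<cdot> x)"
  by (auto simp: pointed_def supp_iff simp flip: tq_add)

lemma pointed_unique: "pointed p x \<Longrightarrow> pointed p' x \<Longrightarrow> p = p'"
proof -
  assume *: "pointed p x" "pointed p' x"
  then have "p \<in> supp x" "p' \<in> supp x" by (auto simp: pointed_def supp_iff)
  with * show ?thesis by (force simp: pointed_def prod_eq_iff)
qed

lemma pointed_add:
  assumes "pointed p x" and "\<And>e. e \<in> supp y \<Longrightarrow> fst p \<le> fst e \<and> snd p \<le> snd e \<and> e \<noteq> p"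
  shows "pointed p (x + y)"
proof -
  have "coef y p = 0" using assms(2)[of p] by (auto simp: supp_iff)
  then show ?thesis
    using assms supp_add[of x y] by (auto simp: pointed_def)
qed

lemma pointed_mult:
  assumes "pointed p x" "pointed r y"
  shows "pointed (p + r) (x * y)"
proof -
  have "coef (x * y) (p + r) = coef x p * coef y r * tq (lam p r)"
  proof (rule coef_mult_corner)
    fix e' f' assume "e' \<in> supp x" "f' \<in> supp y" "e' + f' = p + r"
    with assms show "e' = p"
      by (force simp: pointed_def prod_eq_iff)
  qed
  then have "\<exists>i. coef (x * y) (p + r) = tq i"
    using assms by (auto simp: pointed_def simp flip: tq_add)
  moreover have "fst (p + r) \<le> fst e \<and> snd (p + r) \<le> snd e" if "e \<in> supp (x * y)" for e
    using supp_mult[OF that] assms by (force simp: pointed_def intro: add_mono)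
  ultimately show ?thesis by (simp add: pointed_def)
qed

definition scale_pt :: "nat \<Rightarrow> int \<times> int \<Rightarrow> int \<times> int" where
  "scale_pt n p = (int n * fst p, int n * snd p)"

lemma pointed_power: "pointed p x \<Longrightarrow> pointed (scale_pt n p) (x ^ n)"
proof (induction n)
  case 0
  then show ?case using pointed_1 by (simp add: scale_pt_def zero_prod_def)
next
  case (Suc n)
  have "p + scale_pt n p = scale_pt (Suc n) p"
    by (simp add: scale_pt_def prod_eq_iff algebra_simps)
  then show ?case using pointed_mult[OF Suc.prems Suc.IH[OF Suc.prems]] by simp
qed

lemma pointed_deg_eq:
  assumes "pointed p x"
  shows "deg_eq (-1, 0) x (- fst p)" "deg_eq (0, -1) x (- snd p)"
proof -
  have "p \<in> supp x" using assms by (auto simp: pointed_def supp_iff)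
  then show "deg_eq (-1, 0) x (- fst p)" "deg_eq (0, -1) x (- snd p)"
    using assms by (auto simp: deg_eq_def deg_le_def wt_def pointed_def)
qed

text \<open>The lower bounds on the exponents of \<open>y\<close> come from additivity of the
  degrees with weights \<open>(-1, 0)\<close> and \<open>(0, -1)\<close>. The corner coefficient of
  \<open>x * y\<close> is then a product in which two of the three factors, and the result, are
  powers of \<open>t\<close>, hence so is the third.\<close>

lemma pointed_div_left:
  assumes x: "pointed p x" and xy: "pointed r (x * y)"
  shows "pointed (r - p) y"
proof -
  have lower: "fst (r - p) \<le> fst e \<and> snd (r - p) \<le> snd e" if "e \<in> supp y" for e
    using deg_eq_div_left[OF pointed_deg_eq(1)[OF x] pointed_deg_eq(1)[OF xy]]
      deg_eq_div_left[OF pointed_deg_eq(2)[OF x] pointed_deg_eq(2)[OF xy]] that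
    by (force simp: deg_eq_def deg_le_def wt_def)
  have "coef (x * y) (p + (r - p)) = coef x p * coef y (r - p) * tq (lam p (r - p))"
  proof (rule coef_mult_corner)
    fix e' f' assume "e' \<in> supp x" "f' \<in> supp y" "e' + f' = p + (r - p)"
    with x lower[of f'] show "e' = p"
      by (force simp: pointed_def prod_eq_iff)
  qed
  then obtain i j where "tq i = tq j * coef y (r - p) * tq (lam p (r - p))"
    using x xy by (auto simp: pointed_def) metis
  then have "tq (- j - lam p (r - p)) * tq i =
      tq (- j - lam p (r - p)) * tq j * tq (lam p (r - p)) * coef y (r - p)"
    by (simp add: ac_simps)
  then have "coef y (r - p) = tq (- j - lam p (r - p) + i)"
    by (simp flip: tq_add)
  then show ?thesis using lower by (auto simp: pointed_def)
qed

lemma pointed_div_right: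
  assumes y: "pointed p y" and xy: "pointed r (x * y)"
  shows "pointed (r - p) x"
proof -
  have lower: "fst (r - p) \<le> fst e \<and> snd (r - p) \<le> snd e" if "e \<in> supp x" for e
    using deg_eq_div_right[OF pointed_deg_eq(1)[OF y] pointed_deg_eq(1)[OF xy]]
      deg_eq_div_right[OF pointed_deg_eq(2)[OF y] pointed_deg_eq(2)[OF xy]] that
    by (force simp: deg_eq_def deg_le_def wt_def)
  have "coef (x * y) (r - p + p) = coef x (r - p) * coef y p * tq (lam (r - p) p)"
  proof (rule coef_mult_corner)
    fix e' f' assume "e' \<in> supp x" "f' \<in> supp y" "e' + f' = r - p + p"
    with y lower[of e'] show "e' = r - p"
      by (force simp: pointed_def prod_eq_iff)
  qed
  then obtain i j where "tq i = coef x (r - p) * tq j * tq (lam (r - p) p)"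
    using y xy by (auto simp: pointed_def) metis
  then have "tq (- j - lam (r - p) p) * tq i =
      tq (- j - lam (r - p) p) * tq j * tq (lam (r - p) p) * coef x (r - p)"
    by (simp add: ac_simps)
  then have "coef x (r - p) = tq (- j - lam (r - p) p + i)"
    by (simp flip: tq_add)
  then show ?thesis using lower by (auto simp: pointed_def)
qed

section \<open>Denominator vectors of the cluster variables\<close>

text \<open>The exponent of the term at which \<open>X_k\<close> is pointed, i.e. minus its denominator vector.\<close>

definition Xq_pt :: "int \<Rightarrow> int \<times> int" where
  "Xq_pt k = (if k \<ge> 2 then (if even k then (1 - k div 2, 3 - k) else (2 - k, 6 - 2 * k))
           else (if even k then (k div 2, k - 1) else (k, 2 * k - 2)))"

lemma pointed_sm_add_1:
  assumes "pointed p x" "fst p \<le> 0" "snd p \<le> 0" "p \<noteq> 0"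
  shows "pointed p (tq i \<cdot> x + 1)"
  by (rule pointed_add[OF pointed_sm[OF assms(1)]])
     (use assms in \<open>auto simp: supp_iff coef_1 split: if_splits\<close>)

text \<open>Here the constant is the least term. Among the exchange relations this happens only at
  \<open>k = 2\<close> when going up and at \<open>k = 1\<close> when going down.\<close>

lemma pointed_sm_add_1':
  assumes "pointed p x" "fst p \<ge> 0" "snd p \<ge> 0" "p \<noteq> 0"
  shows "pointed 0 (tq i \<cdot> x + 1)"
proof -
  have "0 \<le> fst e \<and> 0 \<le> snd e \<and> e \<noteq> 0" if "e \<in> supp (tq i \<cdot> x)" for e
    using that assms supp_sm[of "tq i" x] by (force simp: pointed_def prod_eq_iff)
  then show ?thesis
    using pointed_add[OF pointed_1, of "tq i \<cdot> x"] by (simp add: add.commute)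
qed

lemma Xq_pointed_up: "pointed (Xq_pt (int n + 1)) (Xq (int n + 1)) \<and> pointed (Xq_pt (int n + 2)) (Xq (int n + 2))"
proof (induction n)
  case 0
  then show ?case using pointed_Xe[of "(1, 0)"] pointed_Xe[of "(0, 1)"]
    by (simp add: Xq_1 Xq_2 Xq_pt_def)
next
  case (Suc n)
  define k where "k = int n + 2"
  have k: "k \<ge> 2" by (simp add: k_def)
  have IH: "pointed (Xq_pt (k - 1)) (Xq (k - 1))" "pointed (Xq_pt k) (Xq k)"
    using Suc by (simp_all add: k_def add.commute)
  have "pointed (Xq_pt (k + 1)) (Xq (k + 1))"
  proof (cases "even k")
    case True
    define r where "r = (if k = 2 then 0 else scale_pt 4 (Xq_pt k))"
    have "pointed r (tq 4 \<cdot> Xq k ^ 4 + 1)"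
    proof (cases "k = 2")
      case True
      then show ?thesis
        using pointed_sm_add_1'[OF pointed_power[OF IH(2), of 4]] by (simp add: r_def scale_pt_def Xq_pt_def prod_eq_iff)
    next
      case False
      then have "k \<ge> 4" using k \<open>even k\<close> by presburger
      with \<open>even k\<close> have "fst (Xq_pt k) \<le> 0" "snd (Xq_pt k) < 0" by (auto simp: Xq_pt_def elim!: evenE)
      then show ?thesis
        using pointed_sm_add_1[OF pointed_power[OF IH(2), of 4]] False
        by (simp add: r_def scale_pt_def prod_eq_iff)
    qed
    then have "pointed (r - Xq_pt (k - 1)) (Xq (k + 1))"
      using pointed_div_left[OF IH(1)] Xq_exch_even[OF True] by simp
    moreover have "r - Xq_pt (k - 1) = Xq_pt (k + 1)"
      using True k by (auto simp: r_def scale_pt_def Xq_pt_def prod_eq_iff elim!: evenE)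
    ultimately show ?thesis by simp
  next
    case False
    then have "k \<ge> 3" using k by presburger
    with \<open>odd k\<close> have "fst (Xq_pt k) < 0" "snd (Xq_pt k) \<le> 0" by (auto simp: Xq_pt_def)
    then have "pointed (Xq_pt k) (tq 1 \<cdot> Xq k + 1)"
      using pointed_sm_add_1[OF IH(2)] by (auto simp: prod_eq_iff)
    then have "pointed (Xq_pt k - Xq_pt (k - 1)) (Xq (k + 1))"
      using pointed_div_left[OF IH(1)] Xq_exch_odd[OF False] by simp
    moreover have "Xq_pt k - Xq_pt (k - 1) = Xq_pt (k + 1)"
      using False \<open>k \<ge> 3\<close> by (auto simp: Xq_pt_def prod_eq_iff elim!: oddE)
    ultimately show ?thesis by simp
  qed
  with IH show ?case by (simp add: k_def algebra_simps)
qed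

lemma Xq_pointed_down: "pointed (Xq_pt (2 - int n)) (Xq (2 - int n)) \<and> pointed (Xq_pt (1 - int n)) (Xq (1 - int n))"
proof (induction n)
  case 0
  then show ?case using Xq_pointed_up[of 0] by simp
next
  case (Suc n)
  define k where "k = 1 - int n"
  have k: "k \<le> 1" by (simp add: k_def)
  have IH: "pointed (Xq_pt (k + 1)) (Xq (k + 1))" "pointed (Xq_pt k) (Xq k)"
    using Suc by (simp_all add: k_def)
  have "pointed (Xq_pt (k - 1)) (Xq (k - 1))"
  proof (cases "even k")
    case True
    then have "k \<le> 0" using k by presburger
    with True have "fst (Xq_pt k) \<le> 0" "snd (Xq_pt k) < 0" by (auto simp: Xq_pt_def)
    then have "pointed (scale_pt 4 (Xq_pt k)) (tq 4 \<cdot> Xq k ^ 4 + 1)"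
      using pointed_sm_add_1[OF pointed_power[OF IH(2), of 4]]
      by (simp add: scale_pt_def prod_eq_iff)
    then have "pointed (scale_pt 4 (Xq_pt k) - Xq_pt (k + 1)) (Xq (k - 1))"
      using pointed_div_right[OF IH(1)] Xq_exch_even[OF True] by simp
    moreover have "scale_pt 4 (Xq_pt k) - Xq_pt (k + 1) = Xq_pt (k - 1)"
      using True \<open>k \<le> 0\<close> by (auto simp: scale_pt_def Xq_pt_def prod_eq_iff elim!: evenE)
    ultimately show ?thesis by simp
  next
    case False
    define r where "r = (if k = 1 then 0 else Xq_pt k)"
    have "pointed r (tq 1 \<cdot> Xq k + 1)"
    proof (cases "k = 1")
      case True
      then show ?thesis
        using pointed_sm_add_1'[OF IH(2)] by (simp add: r_def Xq_pt_def prod_eq_iff)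
    next
      case False
      then have "k < 0" using k \<open>odd k\<close> by presburger
      with \<open>odd k\<close> have "fst (Xq_pt k) < 0" "snd (Xq_pt k) \<le> 0" by (auto simp: Xq_pt_def)
      then show ?thesis
        using pointed_sm_add_1[OF IH(2)] False by (auto simp: r_def prod_eq_iff)
    qed
    then have "pointed (r - Xq_pt (k + 1)) (Xq (k - 1))"
      using pointed_div_right[OF IH(1)] Xq_exch_odd[OF False] by simp
    moreover have "r - Xq_pt (k + 1) = Xq_pt (k - 1)"
      using False k by (auto simp: r_def Xq_pt_def prod_eq_iff elim!: oddE)
    ultimately show ?thesis by simp
  qed
  with IH show ?case by (simp add: k_def algebra_simps)
qed

lemma Xq_pointed: "pointed (Xq_pt k) (Xq k)"
  using Xq_pointed_up[of "nat (k - 1)"] Xq_pointed_down[of "nat (1 - k)"]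
  by (cases "k \<ge> 1") auto

lemma Xq_nonzero [simp]: "Xq k \<noteq> 0"
  using Xq_pointed pointed_nonzero by blast

lemma qcomm_power:
  assumes "x * y = tq i \<cdot> (y * x)"
  shows "x ^ a * y ^ b = tq (i * int a * int b) \<cdot> (y ^ b * x ^ a)"
proof -
  have 1: "x * y ^ b = tq (i * int b) \<cdot> (y ^ b * x)" for b
  proof (induction b)
    case (Suc b)
    have "x * y ^ Suc b = (x * y) * y ^ b" by (simp add: mult.assoc)
    also have "\<dots> = tq i \<cdot> (y * (x * y ^ b))" by (simp add: assms mult.assoc)
    also have "\<dots> = tq (i * int (Suc b)) \<cdot> (y ^ Suc b * x)"
      by (simp add: Suc mult.assoc algebra_simps flip: tq_add)
    finally show ?case .
  qed simp
  show ?thesis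
  proof (induction a)
    case (Suc a)
    have "x ^ Suc a * y ^ b = x * (x ^ a * y ^ b)" by (simp add: mult.assoc)
    also have "\<dots> = tq (i * int a * int b) \<cdot> ((x * y ^ b) * x ^ a)" by (simp add: Suc mult.assoc)
    also have "\<dots> = tq (i * int (Suc a) * int b) \<cdot> (y ^ b * x ^ Suc a)"
      by (simp add: 1 mult.assoc algebra_simps flip: tq_add)
    finally show ?case .
  qed simp
qed

text \<open>Bracketing \<open>Xq (k - 1) * Xq (k + 1) * Xq (k - 1)\<close> in two ways relates both
  products; moving \<open>Xq (k - 1)\<close> past \<open>Xq k ^ 4\<close> costs \<open>tq 8\<close>,
  and the left factor is cancelled.\<close>

lemma Xq_exch_even':
  assumes "even k"
  shows "Xq (k + 1) * Xq (k - 1) = tq (-4) \<cdot> Xq k ^ 4 + 1"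
proof -
  have "Xq (k - 1) * Xq k = tq 2 \<cdot> (Xq k * Xq (k - 1))"
    using Xq_comm[of "k - 1"] by simp
  then have "Xq (k - 1) * Xq k ^ 4 = tq 8 \<cdot> (Xq k ^ 4 * Xq (k - 1))"
    using qcomm_power[of "Xq (k - 1)" "Xq k" 2 1 4] by simp
  then have "Xq (k - 1) * (tq (-4) \<cdot> Xq k ^ 4 + 1) = (tq 4 \<cdot> Xq k ^ 4 + 1) * Xq (k - 1)"
    by (simp add: q_simps)
  also have "\<dots> = Xq (k - 1) * (Xq (k + 1) * Xq (k - 1))"
    by (simp add: Xq_exch_even[OF assms] flip: mult.assoc)
  finally show ?thesis by simp
qed

section \<open>Identification with the cluster variables \<open>Xc\<close>\<close>

lemma rep_power: "tpow (rep x) n = rep (x ^ n)"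
  by (induction n) (simp_all add: tpow_def one_qt.rep_eq times_qt.rep_eq power_Suc2 del: power_Suc)

lemma rep_sm: "tsmul c (rep x) = rep (c \<cdot> x)"
  by (simp add: tsmul_def sm_def mon_def times_qt.rep_eq zero_prod_def)

lemma rep_1: "tone = rep 1"
  by (simp add: one_qt.rep_eq)

lemma rep_Xe: "qmon e = rep (Xe e)"
  by (simp add: qmon_def mon_def)

lemmas rep_simps = rep_power rep_sm rep_1 rep_Xe times_qt.rep_eq[symmetric] plus_qt.rep_eq[symmetric]
  minus_qt.rep_eq[symmetric] rep_inject

lemma clrec_rep:
  "clrec (\<lambda>k. rep (S k)) \<longleftrightarrow> S 1 = Xe (1, 0) \<and> S 2 = Xe (0, 1) \<and>
     (\<forall>k. odd k \<longrightarrow> S (k - 1) * S (k + 1) = tq 1 \<cdot> S k + 1) \<and>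
     (\<forall>k. even k \<longrightarrow> S (k - 1) * S (k + 1) = tq 4 \<cdot> S k ^ 4 + 1)"
  by (simp add: clrec_def rep_simps)

text \<open>Each term fixes the product of its two neighbours, and there are no zero divisors, so
  two consecutive values determine the sequence.\<close>

lemma exchange_unique:
  assumes "S 1 = Xe (1, 0)" "S 2 = Xe (0, 1)"
    and odd: "\<And>k. odd k \<Longrightarrow> S (k - 1) * S (k + 1) = tq 1 \<cdot> S k + 1"
    and even: "\<And>k. even k \<Longrightarrow> S (k - 1) * S (k + 1) = tq 4 \<cdot> S k ^ 4 + 1"
  shows "S k = Xq k"
proof -
  have exch: "S (k - 1) * S (k + 1) = Xq (k - 1) * Xq (k + 1)" if "S k = Xq k" for k
    using that by (cases "even k") (simp_all add: odd even Xq_exch_odd Xq_exch_even)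
  have "S k = Xq k \<and> S (k + 1) = Xq (k + 1)"
  proof (induction k rule: int_induct[where k = 1])
    case base
    then show ?case using assms by (simp add: Xq_1 Xq_2)
  next
    case (step1 k)
    then have "Xq k * S (k + 1 + 1) = Xq k * Xq (k + 1 + 1)"
      using exch[of "k + 1"] by simp
    then show ?case using step1 by simp
  next
    case (step2 k)
    then have "S (k - 1) * Xq (k + 1) = Xq (k - 1) * Xq (k + 1)"
      using exch[of k] by simp
    then show ?case using step2 by simp
  qed
  then show ?thesis by simp
qed

lemma Xc_eq: "Xc k = rep (Xq k)"
proof -
  have "Xc = (\<lambda>k. rep (Xq k))"
    unfolding Xc_def
  proof (rule the_equality)
    show "clrec (\<lambda>k. rep (Xq k))"
      by (simp add: clrec_rep Xq_1 Xq_2 Xq_exch_odd Xq_exch_even)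
    fix s assume s: "clrec s"
    define S where "S k = mk (s k)" for k
    have "s = (\<lambda>k. rep (S k))" by (simp add: S_def)
    then show "s = (\<lambda>k. rep (Xq k))"
      using s exchange_unique[of S] clrec_rep[of S] by auto
  qed
  then show ?thesis by (rule fun_cong)
qed

section \<open>Generators and standard monomials\<close>

interpretation Q: module sm
  by unfold_locales (simp_all add: sm_add_left sm_add_right)

text \<open>Products of cluster variables at distance three. At \<open>j = 1\<close> they express
  \<open>X_4\<close> by \<open>X_0, X_2, X_3\<close>, and eliminating \<open>X_4\<close> between
  them gives the rule for reordering \<open>X_3 X_0\<close>.\<close>

lemma ev_od_far: "ev (j - 1) * od j = tq (-1) \<cdot> ev (j + 1) + tq 3 \<cdot> ev j ^ 3"
  and od_ev_far: "od j * ev (j - 1) = tq 1 \<cdot> ev (j + 1) + tq (-3) \<cdot> ev j ^ 3"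
proof -
  define a b c where abc: "a = ev (j - 1)" "b = ev j" "c = ev (j + 1)"
  have ab: "a * b = tq 2 \<cdot> (b * a) + (1 - tq 2) \<cdot> 1"
    using ev_ev_Suc[of "j - 1"] by (simp add: abc)
  have abx: "a * (b * x) = tq 2 \<cdot> (b * (a * x)) + (1 - tq 2) \<cdot> x" for x
    by (simp add: ab distrib_right flip: mult.assoc)
  have ac: "a * c = tq (-1) \<cdot> Xdelta_qt + tq 2 \<cdot> (b * b)"
    by (subst Xdelta_qt_eq[of j]) (simp add: abc q_simps)
  have ca: "c * a = tq 1 \<cdot> Xdelta_qt + tq (-2) \<cdot> (b * b)"
    by (subst Xdelta_qt_eq'[of j]) (simp add: abc q_simps)
  have bz: "b * Xdelta_qt = tq 1 \<cdot> c + tq (-1) \<cdot> a"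
    by (simp add: abc ev_Xdelta_qt)
  have "a * (tq (-1) \<cdot> (b * c - 1)) = tq (-1) \<cdot> c + tq 3 \<cdot> b ^ 3"
    by (simp add: q_simps abx ac bz power3_eq_cube)
  then show "ev (j - 1) * od j = tq (-1) \<cdot> ev (j + 1) + tq 3 \<cdot> ev j ^ 3"
    by (simp only: od_def abc)
  have "(tq (-1) \<cdot> (b * c - 1)) * a = tq 1 \<cdot> c + tq (-3) \<cdot> b ^ 3"
    by (simp add: q_simps ca bz power3_eq_cube)
  then show "od j * ev (j - 1) = tq 1 \<cdot> ev (j + 1) + tq (-3) \<cdot> ev j ^ 3"
    by (simp only: od_def abc)
qed

lemma Xq_small: "Xq 0 = ev 0" "Xq 2 = ev 1" "Xq 3 = od 1"
  by (simp_all add: Xq_def)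

text \<open>Three variables suffice: the distance-three product gives \<open>X_4\<close>, the
  quadratic invariant then gives \<open>Xdelta_qt\<close>, the recurrence all even indices, and the
  exchange relation the odd ones.\<close>

lemma Xq_mem_generated:
  assumes gen: "Xq 0 \<in> L" "Xq 2 \<in> L" "Xq 3 \<in> L" and one: "1 \<in> L"
    and add: "\<And>x y. x \<in> L \<Longrightarrow> y \<in> L \<Longrightarrow> x + y \<in> L"
    and mult: "\<And>x y. x \<in> L \<Longrightarrow> y \<in> L \<Longrightarrow> x * y \<in> L"
    and sm: "\<And>c x. x \<in> L \<Longrightarrow> c \<cdot> x \<in> L"
  shows "Xq k \<in> L" "Xdelta_qt \<in> L"
proof -
  have diff: "x - y \<in> L" if "x \<in> L" "y \<in> L" for x y
    using add[OF that(1) sm[OF that(2), of "-1"]] by (simp add: sm_minus_left)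
  have e: "ev 0 \<in> L" "ev 1 \<in> L" and o: "od 1 \<in> L"
    using gen by (simp_all add: Xq_small)
  have "ev 2 = tq 1 \<cdot> (ev 0 * od 1) - tq 4 \<cdot> (ev 1 * (ev 1 * ev 1))"
    using ev_od_far[of 1] by (simp add: q_simps power3_eq_cube)
  then have "ev 2 \<in> L" using e o by (simp add: diff mult sm)
  then show z: "Xdelta_qt \<in> L" by (subst Xdelta_qt_eq[of 1]) (use e in \<open>simp add: diff mult sm\<close>)
  have ev: "ev j \<in> L \<and> ev (j + 1) \<in> L" for j
  proof (induction j rule: int_induct[where k = 0])
    case (step1 j)
    then show ?case using ev_rec[of "j + 1"] z by (simp add: diff mult sm)
  next
    case (step2 j)
    have "ev (j - 1) = tq (-1) \<cdot> (Xdelta_qt * ev j) - tq (-2) \<cdot> ev (j + 1)"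
      by (simp add: Xdelta_qt_ev q_simps)
    then show ?case using step2 z by (simp add: diff mult sm)
  qed (use e in auto)
  show "Xq k \<in> L"
    unfolding Xq_def od_def using ev by (auto simp: one intro!: diff mult sm)
qed

section \<open>Straightening into ordered monomials\<close>

definition ordered_mon :: "nat \<Rightarrow> nat \<Rightarrow> nat \<Rightarrow> nat \<Rightarrow> qt" where
  "ordered_mon a b c d = Xq 0 ^ a * Xq 1 ^ b * Xq 2 ^ c * Xq 3 ^ d"

lemma Xq_rels:
  "Xq 0 * Xq 1 = tq 2 \<cdot> (Xq 1 * Xq 0)" "Xq 1 * Xq 2 = tq 2 \<cdot> (Xq 2 * Xq 1)"
  "Xq 2 * Xq 3 = tq 2 \<cdot> (Xq 3 * Xq 2)"
  "Xq 0 * Xq 2 = tq 1 \<cdot> Xq 1 + 1" "Xq 2 * Xq 0 = tq (-1) \<cdot> Xq 1 + 1"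
  "Xq 1 * Xq 3 = tq 4 \<cdot> Xq 2 ^ 4 + 1" "Xq 3 * Xq 1 = tq (-4) \<cdot> Xq 2 ^ 4 + 1"
  "Xq 3 * Xq 0 = tq 2 \<cdot> (Xq 0 * Xq 3) + (tq (-3) - tq 5) \<cdot> Xq 2 ^ 3"
  using Xq_comm[of 0] Xq_comm[of 1] Xq_comm[of 2] Xq_exch_odd[of 1] Xq_exch_odd'[of 1]
    Xq_exch_even[of 2] Xq_exch_even'[of 2] ev_od_far[of 1] od_ev_far[of 1]
  by (simp_all add: Xq_small sm_diff_left sm_add_right flip: tq_add)

lemma swap_power:
  assumes "x * y = tq i \<cdot> (y * x)"
  shows "y * x ^ a = tq (- i * int a) \<cdot> (x ^ a * y)"
  using qcomm_power[OF assms, of a 1] by (simp flip: tq_add)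

definition ordered_span :: "qt set" where
  "ordered_span = Q.span {ordered_mon a b c d | a b c d. True}"

lemma ordered_mon_ordered_span: "ordered_mon a b c d \<in> ordered_span"
  unfolding ordered_span_def by (rule Q.span_base) auto

lemmas ordered_span_closed = Q.span_add[where S = "{ordered_mon a b c d | a b c d. True}", folded ordered_span_def]
  Q.span_scale[where S = "{ordered_mon a b c d | a b c d. True}", folded ordered_span_def]

text \<open>An idealizer device: the elements whose left multiplication preserves the span form a
  subalgebra for free. It is thus enough to treat left multiplication by generators, and applying an
  element of the algebra to 1 puts it into the span.\<close>

definition left_stab :: "qt set" where
  "left_stab = {y. \<forall>v\<in>ordered_span. y * v \<in> ordered_span}"

lemma left_stab_I:
  assumes "\<And>a b c d. y * ordered_mon a b c d \<in> ordered_span"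
  shows "y \<in> left_stab"
proof -
  have "y * v \<in> ordered_span" if "v \<in> ordered_span" for v
    using that unfolding ordered_span_def
  proof (induction v rule: Q.span_induct_alt)
    case base
    show ?case by (simp add: Q.span_zero)
  next
    case (step c x z)
    then have "y * x \<in> ordered_span" "y * z \<in> ordered_span" using assms by (auto simp: ordered_span_def)
    then have "c \<cdot> (y * x) + y * z \<in> ordered_span" by (intro ordered_span_closed)
    then show ?case by (simp add: distrib_left ordered_span_def)
  qed
  then show ?thesis by (simp add: left_stab_def)
qed

lemma left_stab_closed:
  "1 \<in> left_stab" "x \<in> left_stab \<Longrightarrow> y \<in> left_stab \<Longrightarrow> x + y \<in> left_stab" "x \<in> left_stab \<Longrightarrow> y \<in> left_stab \<Longrightarrow> x * y \<in> left_stab"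
  "x \<in> left_stab \<Longrightarrow> c \<cdot> x \<in> left_stab"
  by (simp_all add: left_stab_def distrib_right ordered_span_closed mult.assoc)

lemma left_stab_mult: "x \<in> left_stab \<Longrightarrow> v \<in> ordered_span \<Longrightarrow> x * v \<in> ordered_span"
  by (simp add: left_stab_def)

lemma left_stab_power: "x \<in> left_stab \<Longrightarrow> x ^ n \<in> left_stab"
  by (induction n) (simp_all add: left_stab_closed)

lemma Xq_0_left_stab: "Xq 0 \<in> left_stab"
proof (rule left_stab_I)
  fix a b c d
  show "Xq 0 * ordered_mon a b c d \<in> ordered_span"
    using ordered_mon_ordered_span[of "Suc a" b c d] by (simp add: ordered_mon_def mult.assoc)
qed

lemma Xq_1_left_stab: "Xq 1 \<in> left_stab"
proof (rule left_stab_I)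
  fix a b c d
  have "Xq 1 * ordered_mon a b c d = (Xq 1 * Xq 0 ^ a) * (Xq 1 ^ b * Xq 2 ^ c * Xq 3 ^ d)"
    by (simp add: ordered_mon_def mult.assoc)
  also have "\<dots> = tq (- 2 * int a) \<cdot> ordered_mon a (Suc b) c d"
    by (subst swap_power[OF Xq_rels(1)]) (simp add: ordered_mon_def mult.assoc)
  finally show "Xq 1 * ordered_mon a b c d \<in> ordered_span"
    by (simp only: ordered_span_closed ordered_mon_ordered_span)
qed

lemma Xq_2_left_stab: "Xq 2 \<in> left_stab"
proof (rule left_stab_I)
  fix a b c d
  show "Xq 2 * ordered_mon a b c d \<in> ordered_span"
  proof (cases a)
    case 0
    have "Xq 2 * ordered_mon 0 b c d = (Xq 2 * Xq 1 ^ b) * (Xq 2 ^ c * Xq 3 ^ d)"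
      by (simp add: ordered_mon_def mult.assoc)
    also have "\<dots> = tq (- 2 * int b) \<cdot> ordered_mon 0 b (Suc c) d"
      by (subst swap_power[OF Xq_rels(2)]) (simp add: ordered_mon_def mult.assoc)
    finally show ?thesis using 0
      by (simp only: ordered_span_closed ordered_mon_ordered_span)
  next
    case (Suc a')
    have "Xq 2 * ordered_mon (Suc a') b c d = (Xq 2 * Xq 0) * ordered_mon a' b c d"
      by (simp add: ordered_mon_def mult.assoc)
    also have "\<dots> = tq (-1) \<cdot> (Xq 1 * ordered_mon a' b c d) + ordered_mon a' b c d"
      by (simp add: Xq_rels distrib_right)
    finally show ?thesis using Suc
      by (simp only: ordered_span_closed ordered_mon_ordered_span left_stab_mult[OF Xq_1_left_stab])
  qed
qed

lemma Xq_3_left_stab: "Xq 3 \<in> left_stab"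
proof (rule left_stab_I)
  fix a b c d
  show "Xq 3 * ordered_mon a b c d \<in> ordered_span"
  proof (induction a)
    case 0
    show ?case
    proof (cases b)
      case 0
      have "Xq 3 * ordered_mon 0 0 c d = (Xq 3 * Xq 2 ^ c) * Xq 3 ^ d"
        by (simp add: ordered_mon_def mult.assoc)
      also have "\<dots> = tq (- 2 * int c) \<cdot> ordered_mon 0 0 c (Suc d)"
        by (subst swap_power[OF Xq_rels(3)]) (simp add: ordered_mon_def mult.assoc)
      finally show ?thesis using 0
        by (simp only: ordered_span_closed ordered_mon_ordered_span)
    next
      case (Suc b')
      have "Xq 3 * ordered_mon 0 (Suc b') c d = (Xq 3 * Xq 1) * ordered_mon 0 b' c d"
        by (simp add: ordered_mon_def mult.assoc)
      also have "\<dots> = tq (-4) \<cdot> (Xq 2 ^ 4 * ordered_mon 0 b' c d) + ordered_mon 0 b' c d"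
        by (simp add: Xq_rels distrib_right)
      finally show ?thesis using Suc
        by (simp only: ordered_span_closed ordered_mon_ordered_span left_stab_mult[OF left_stab_power[OF Xq_2_left_stab]])
    qed
  next
    case (Suc a)
    have "Xq 3 * ordered_mon (Suc a) b c d = (Xq 3 * Xq 0) * ordered_mon a b c d"
      by (simp add: ordered_mon_def mult.assoc)
    also have "\<dots> = tq 2 \<cdot> (Xq 0 * (Xq 3 * ordered_mon a b c d)) + (tq (-3) - tq 5) \<cdot> (Xq 2 ^ 3 * ordered_mon a b c d)"
      by (simp add: Xq_rels distrib_right mult.assoc)
    finally show ?case
      by (simp only: ordered_span_closed ordered_mon_ordered_span left_stab_mult[OF left_stab_power[OF Xq_2_left_stab]] left_stab_mult[OF Xq_0_left_stab] Suc)
  qed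
qed

lemma Aq_ordered_span: "y \<in> Aq \<Longrightarrow> mk y \<in> ordered_span"
proof -
  have *: "mk (x + y) = mk x + mk y" "mk (x \<star> y) = mk x * mk y" "mk (tsmul c x) = c \<cdot> mk x"
    "mk tone = 1" "mk (Xc k) = Xq k" for x y c k
    using rep_sm[of c "mk x"]
    by (simp_all add: plus_qt.abs_eq times_qt.abs_eq Xc_eq rep_inverse one_qt_def)
  assume "y \<in> Aq"
  then have "mk y \<in> left_stab"
    by induction (simp_all add: * left_stab_closed
        Xq_mem_generated(1)[OF Xq_0_left_stab Xq_2_left_stab Xq_3_left_stab left_stab_closed])
  then show ?thesis
    using ordered_mon_ordered_span[of 0 0 0 0] left_stab_mult by (fastforce simp: ordered_mon_def)
qed

text \<open>The standard monomials of an acyclic seed. \<open>X_3\<close> and \<open>X_0\<close> are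
  the mutations of \<open>X_1\<close> and \<open>X_2\<close>, pointed at \<open>(-1, 0)\<close> and
  \<open>(0, -1)\<close>; a positive coordinate uses the cluster variable, a negative one its
  mutation, never both.\<close>

definition standard_mon :: "int \<times> int \<Rightarrow> qt" where
  "standard_mon p = ordered_mon (nat (- snd p)) (nat (fst p)) (nat (snd p)) (nat (- fst p))"

text \<open>A factor pair \<open>X_0, X_2\<close> or \<open>X_1, X_3\<close> is removed by its
  exchange relation. Exponents of \<open>X_1\<close> and \<open>X_2\<close> may grow, but the number
  \<open>a + d\<close> of mutated variables drops.\<close>

lemma ordered_mon_span_standard_mon: "ordered_mon a b c d \<in> Q.span (range standard_mon)"
proof (induction "a + d" arbitrary: a b c d rule: less_induct)
  case less
  consider "a > 0" "c > 0" | "b > 0" "d > 0" | "a = 0 \<or> c = 0" "b = 0 \<or> d = 0" by blast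
  then show ?case
  proof cases
    case 1
    then obtain a' c' where ac: "a = Suc a'" "c = Suc c'" by (auto simp: gr0_conv_Suc)
    have "ordered_mon a b c d = Xq 0 ^ a' * (Xq 0 * Xq 1 ^ b) * Xq 2 * Xq 2 ^ c' * Xq 3 ^ d"
      by (simp add: ordered_mon_def ac mult.assoc power_Suc2[of "Xq 0"] del: power_Suc) (simp add: mult.assoc)
    also have "\<dots> = tq (2 * int b) \<cdot> (Xq 0 ^ a' * Xq 1 ^ b * (Xq 0 * Xq 2) * Xq 2 ^ c' * Xq 3 ^ d)"
      using qcomm_power[OF Xq_rels(1), of 1 b] by (simp add: mult.assoc)
    also have "\<dots> = tq (2 * int b) \<cdot> (tq 1 \<cdot> ordered_mon a' (Suc b) c' d + ordered_mon a' b c' d)"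
      by (simp add: Xq_rels(4) ordered_mon_def distrib_left distrib_right mult.assoc power_Suc2 del: power_Suc)
    finally show ?thesis
      using less[of a' d] ac by (simp add: Q.span_add Q.span_scale del: sm_sm)
  next
    case 2
    then obtain b' d' where bd: "b = Suc b'" "d = Suc d'" by (auto simp: gr0_conv_Suc)
    have "ordered_mon a b c d = Xq 0 ^ a * Xq 1 ^ b' * (Xq 1 * Xq 2 ^ c) * Xq 3 * Xq 3 ^ d'"
      by (simp add: ordered_mon_def bd mult.assoc power_Suc2[of "Xq 1"] del: power_Suc) (simp add: mult.assoc)
    also have "\<dots> = tq (2 * int c) \<cdot> (Xq 0 ^ a * Xq 1 ^ b' * Xq 2 ^ c * (Xq 1 * Xq 3) * Xq 3 ^ d')"
      using qcomm_power[OF Xq_rels(2), of 1 c] by (simp add: mult.assoc)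
    also have "\<dots> = tq (2 * int c) \<cdot> (tq 4 \<cdot> ordered_mon a b' (c + 4) d' + ordered_mon a b' c d')"
      by (simp add: Xq_rels(6) ordered_mon_def distrib_left distrib_right mult.assoc power_add)
    finally show ?thesis
      using less[of a d'] bd by (simp add: Q.span_add Q.span_scale del: sm_sm)
  next
    case 3
    then have "ordered_mon a b c d = standard_mon (int b - int d, int c - int a)"
      by (auto simp: standard_mon_def)
    then show ?thesis by (simp add: Q.span_base)
  qed
qed

lemma ordered_span_span_standard_mon: "ordered_span \<subseteq> Q.span (range standard_mon)"
  unfolding ordered_span_def by (rule Q.span_minimal) (auto simp: ordered_mon_span_standard_mon)

lemma standard_mon_pointed: "pointed p (standard_mon p)"
proof -
  have "pointed (scale_pt (nat (- snd p)) (Xq_pt 0) + scale_pt (nat (fst p)) (Xq_pt 1) + scale_pt (nat (snd p)) (Xq_pt 2)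
      + scale_pt (nat (- fst p)) (Xq_pt 3)) (standard_mon p)"
    unfolding standard_mon_def ordered_mon_def by (intro pointed_mult pointed_power Xq_pointed)
  also have "scale_pt (nat (- snd p)) (Xq_pt 0) + scale_pt (nat (fst p)) (Xq_pt 1) + scale_pt (nat (snd p)) (Xq_pt 2)
      + scale_pt (nat (- fst p)) (Xq_pt 3) = p"
    by (simp add: scale_pt_def Xq_pt_def prod_eq_iff)
  finally show ?thesis .
qed

text \<open>A minimal index \<open>r\<close> below \<open>p\<close> cannot be cancelled: any
  \<open>s\<close> contributing at \<open>r\<close> satisfies \<open>s <= r\<close> componentwise,
  hence equals \<open>r\<close>. The coordinate sum \<open>h\<close> selects such a minimal index.
  Both independence and triangularity use this.\<close>

lemma pointed_combination:
  assumes "finite S" and M: "\<And>p. p \<in> S \<Longrightarrow> pointed p (M p)" and c: "\<And>p. p \<in> S \<Longrightarrow> c p \<noteq> 0"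
    and "p \<in> S"
  obtains r where "r \<in> supp (\<Sum>p\<in>S. c p \<cdot> M p)" "fst r \<le> fst p" "snd r \<le> snd p"
proof -
  define T where "T = {r \<in> S. fst r \<le> fst p \<and> snd r \<le> snd p}"
  define h where "h r = fst r + snd r" for r :: "int \<times> int"
  have "p \<in> T" using \<open>p \<in> S\<close> by (simp add: T_def)
  moreover have "finite T" using \<open>finite S\<close> by (simp add: T_def)
  ultimately have T: "finite (h ` T)" "h ` T \<noteq> {}" by blast+
  then obtain r where r: "r \<in> T" "h r = Min (h ` T)" by (metis (no_types) Min_in imageE)
  have min: "h r \<le> h s" if "s \<in> T" for s
    using that T r by simp
  have "coef (\<Sum>p\<in>S. c p \<cdot> M p) r = (\<Sum>s\<in>S. if s = r then c r * coef (M r) r else 0)"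
    unfolding coef_sum
  proof (rule sum.cong)
    fix s assume s: "s \<in> S"
    have "s = r" if "coef (M s) r \<noteq> 0"
    proof -
      have "fst s \<le> fst r" "snd s \<le> snd r" using M[OF s] that by (auto simp: pointed_def supp_iff)
      moreover from this have "s \<in> T" using s r by (auto simp: T_def)
      ultimately show ?thesis using min[of s] by (auto simp: h_def prod_eq_iff)
    qed
    then show "coef (c s \<cdot> M s) r = (if s = r then c r * coef (M r) r else 0)" by auto
  qed simp
  also have "\<dots> = c r * coef (M r) r" using r \<open>finite S\<close> by (simp add: T_def)
  also have "\<dots> \<noteq> 0"
    using c[of r] M[of r] r by (auto simp: T_def pointed_def)
  finally have "r \<in> supp (\<Sum>p\<in>S. c p \<cdot> M p)" by (simp add: supp_iff)
  then show ?thesis using that r by (auto simp: T_def)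
qed

section \<open>The basis\<close>

definition cluster_mon :: "int \<Rightarrow> nat \<Rightarrow> nat \<Rightarrow> qt" where
  "cluster_mon m a b = tq (- (int a * int b)) \<cdot> (Xq m ^ a * Xq (m + 1) ^ b)"

fun cheb_delta :: "nat \<Rightarrow> qt" where
  "cheb_delta 0 = 1"
| "cheb_delta (Suc 0) = Xdelta_qt"
| "cheb_delta (Suc (Suc 0)) = Xdelta_qt * Xdelta_qt - 2 \<cdot> 1"
| "cheb_delta (Suc (Suc (Suc n))) = cheb_delta (Suc (Suc n)) * Xdelta_qt - cheb_delta (Suc n)"

definition basis_set :: "qt set" where
  "basis_set = {cluster_mon m a b | m a b. True} \<union> {cheb_delta n | n. n \<ge> 1}"

lemma cluster_mon_basis_set: "cluster_mon m a b \<in> basis_set" and cheb_delta_basis_set: "n \<ge> 1 \<Longrightarrow> cheb_delta n \<in> basis_set"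
  by (auto simp: basis_set_def)

lemma rep_Xdelta_qt: "Xdelta = rep Xdelta_qt"
  by (simp add: Xdelta_def Xdelta_qt_def rep_simps)

lemma rep_cheb_delta: "cheb n Xdelta = rep (cheb_delta n)"
proof (induction n rule: cheb_delta.induct)
  case (4 n)
  then show ?case by (simp add: rep_Xdelta_qt times_qt.rep_eq minus_qt.rep_eq)
qed (simp_all add: rep_Xdelta_qt rep_simps)

lemma Bset_eq: "Bset = rep ` basis_set"
  unfolding Bset_def basis_set_def image_Un by (auto simp: cluster_mon_def Xc_eq rep_cheb_delta rep_simps)

section \<open>Exponent vectors of the basis elements\<close>

lemma cluster_mon_pointed: "pointed (scale_pt a (Xq_pt m) + scale_pt b (Xq_pt (m + 1))) (cluster_mon m a b)"
  unfolding cluster_mon_def by (intro pointed_sm pointed_mult pointed_power Xq_pointed)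

lemma Xdelta_qt_pointed: "pointed (-1, -2) Xdelta_qt"
  by (auto simp: pointed_def Xdelta_qt_def supp_iff coef_mon split: if_splits intro: exI[of _ 0])

lemma cheb_delta_pointed: "pointed (- int n, - 2 * int n) (cheb_delta n)"
proof (induction n rule: cheb_delta.induct)
  case 1
  then show ?case using pointed_1 by (simp add: zero_prod_def)
next
  case 2
  then show ?case using Xdelta_qt_pointed by simp
next
  case 3
  have "pointed (-2, -4) (Xdelta_qt * Xdelta_qt + - (2 \<cdot> 1))"
    by (rule pointed_add) (use pointed_mult[OF Xdelta_qt_pointed Xdelta_qt_pointed] in
        \<open>auto simp: supp_iff coef_1 zero_prod_def split: if_splits\<close>)
  then show ?case by simp
next
  case (4 n)
  have "pointed (- int (Suc (Suc (Suc n))), - 2 * int (Suc (Suc (Suc n)))) (cheb_delta (Suc (Suc n)) * Xdelta_qt + - cheb_delta (Suc n))"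
  proof (rule pointed_add)
    show "pointed (- int (Suc (Suc (Suc n))), - 2 * int (Suc (Suc (Suc n)))) (cheb_delta (Suc (Suc n)) * Xdelta_qt)"
      using pointed_mult[OF 4(1) Xdelta_qt_pointed] by (simp add: algebra_simps)
    fix e assume "e \<in> supp (- cheb_delta (Suc n))"
    then have "e \<in> supp (cheb_delta (Suc n))" by (simp add: supp_iff)
    then show "fst (- int (Suc (Suc (Suc n))), - 2 * int (Suc (Suc (Suc n)))) \<le> fst e \<and>
        snd (- int (Suc (Suc (Suc n))), - 2 * int (Suc (Suc (Suc n)))) \<le> snd e \<and>
        e \<noteq> (- int (Suc (Suc (Suc n))), - 2 * int (Suc (Suc (Suc n))))"
      using 4(2) by (force simp: pointed_def)
  qed
  then show ?case by simp
qed

text \<open>Rescaling by this weight symmetrizes the exchange exponents 1 and 4: writing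
  \<open>p_k = parity_wt k * u_k\<close>, both tropical relations become
  \<open>u_(k-1) + u_(k+1) = 2 u_k\<close>. So \<open>u\<close> is affine on each side of the
  initial cluster.\<close>

definition parity_wt :: "int \<Rightarrow> int" where
  "parity_wt k = (if even k then 1 else 2)"

lemma Xq_pt_right: "k \<ge> 2 \<Longrightarrow> 2 * fst (Xq_pt k) = parity_wt k * (2 - k)" "k \<ge> 2 \<Longrightarrow> snd (Xq_pt k) - 2 * fst (Xq_pt k) = parity_wt k"
  by (auto simp: Xq_pt_def parity_wt_def elim!: evenE)

lemma Xq_pt_left: "k \<le> 1 \<Longrightarrow> 2 * fst (Xq_pt k) = parity_wt k * k" "k \<le> 1 \<Longrightarrow> snd (Xq_pt k) - 2 * fst (Xq_pt k) = - parity_wt k"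
  by (auto simp: Xq_pt_def parity_wt_def elim!: evenE)

lemma parity_wt_pos [simp]: "0 < parity_wt k" "parity_wt k \<noteq> 0"
  by (simp_all add: parity_wt_def)

definition cluster_pt :: "int \<Rightarrow> nat \<Rightarrow> nat \<Rightarrow> int \<times> int" where
  "cluster_pt m a b = scale_pt a (Xq_pt m) + scale_pt b (Xq_pt (m + 1))"

text \<open>With weighted exponents \<open>A\<close>, \<open>B\<close> of the two variables and
  \<open>D = A + B\<close>, the second equation is a division with remainder,
  \<open>- 2 * fst p = (m - 2) * D + B\<close>. It determines \<open>m\<close> and \<open>B\<close>
  as soon as \<open>A > 0\<close>.\<close>

lemma cluster_pt_right:
  assumes "m \<ge> 2"
  shows "snd (cluster_pt m a b) - 2 * fst (cluster_pt m a b) = int a * parity_wt m + int b * parity_wt (m + 1)"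
    and "2 * fst (cluster_pt m a b) = (2 - m) * (int a * parity_wt m + int b * parity_wt (m + 1)) - int b * parity_wt (m + 1)"
proof -
  have "snd (cluster_pt m a b) - 2 * fst (cluster_pt m a b) =
      int a * (snd (Xq_pt m) - 2 * fst (Xq_pt m)) + int b * (snd (Xq_pt (m + 1)) - 2 * fst (Xq_pt (m + 1)))"
    by (simp add: cluster_pt_def scale_pt_def algebra_simps)
  then show "snd (cluster_pt m a b) - 2 * fst (cluster_pt m a b) = int a * parity_wt m + int b * parity_wt (m + 1)"
    using assms by (simp add: Xq_pt_right(2))
  have "2 * fst (cluster_pt m a b) = int a * (2 * fst (Xq_pt m)) + int b * (2 * fst (Xq_pt (m + 1)))"
    by (simp add: cluster_pt_def scale_pt_def algebra_simps)
  then show "2 * fst (cluster_pt m a b) = (2 - m) * (int a * parity_wt m + int b * parity_wt (m + 1)) - int b * parity_wt (m + 1)"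
    using assms by (simp add: Xq_pt_right) (simp add: algebra_simps)
qed

lemma cluster_pt_left:
  assumes "m \<le> 0"
  shows "snd (cluster_pt m a b) - 2 * fst (cluster_pt m a b) = - (int a * parity_wt m + int b * parity_wt (m + 1))"
    and "2 * fst (cluster_pt m a b) = m * (int a * parity_wt m + int b * parity_wt (m + 1)) + int b * parity_wt (m + 1)"
proof -
  have "snd (cluster_pt m a b) - 2 * fst (cluster_pt m a b) =
      int a * (snd (Xq_pt m) - 2 * fst (Xq_pt m)) + int b * (snd (Xq_pt (m + 1)) - 2 * fst (Xq_pt (m + 1)))"
    by (simp add: cluster_pt_def scale_pt_def algebra_simps)
  then show "snd (cluster_pt m a b) - 2 * fst (cluster_pt m a b) = - (int a * parity_wt m + int b * parity_wt (m + 1))"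
    using assms by (simp add: Xq_pt_left(2))
  have "2 * fst (cluster_pt m a b) = int a * (2 * fst (Xq_pt m)) + int b * (2 * fst (Xq_pt (m + 1)))"
    by (simp add: cluster_pt_def scale_pt_def algebra_simps)
  then show "2 * fst (cluster_pt m a b) = m * (int a * parity_wt m + int b * parity_wt (m + 1)) + int b * parity_wt (m + 1)"
    using assms by (simp add: Xq_pt_left) (simp add: algebra_simps)
qed

lemma cluster_pt_mid: "cluster_pt 1 a b = (int a, int b)"
  by (simp add: cluster_pt_def scale_pt_def Xq_pt_def)

lemma div_mod_unique_int:
  fixes m m' B B' D :: int
  assumes "m * D + B = m' * D + B'" "0 \<le> B" "B < D" "0 \<le> B'" "B' < D"
  shows "m = m' \<and> B = B'"
proof -
  have "(m * D + B) div D = m" using assms(2,3) by simp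
  moreover have "(m' * D + B') div D = m'" using assms(4,5) by simp
  ultimately have "m = m'" using assms(1) by metis
  then show ?thesis using assms(1) by simp
qed

text \<open>A power of one cluster variable belongs to two neighbouring clusters. Requiring
  \<open>a > 0\<close> on the right and \<open>b > 0\<close> on the left removes the repetition, and
  the powers of \<open>X_1\<close> and \<open>X_2\<close> are assigned to the initial
  cluster.\<close>

lemma basis_set_cases:
  assumes "x \<in> basis_set"
  obtains (mid) a b where "x = cluster_mon 1 a b"
    | (right) m a b where "m \<ge> 2" "a > 0" "m = 2 \<Longrightarrow> b > 0" "x = cluster_mon m a b"
    | (left) m a b where "m \<le> 0" "b > 0" "m = 0 \<Longrightarrow> a > 0" "x = cluster_mon m a b"
    | (cheb) n where "n \<ge> 1" "x = cheb_delta n"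
proof -
  from assms consider (c) m a b where "x = cluster_mon m a b" | (z) n where "n \<ge> 1" "x = cheb_delta n"
    by (auto simp: basis_set_def)
  then show ?thesis
  proof cases
    case c
    have shift: "cluster_mon m 0 b = cluster_mon (m + 1) b 0" for m b by (simp add: cluster_mon_def)
    consider "m = 1" | "m \<ge> 2" | "m \<le> 0" by linarith
    then show ?thesis
    proof cases
      case 1
      then show ?thesis using c mid by blast
    next
      case 2
      consider "a = 0" "b = 0" | "a = 0" "b > 0" | "a > 0" "m = 2 \<longrightarrow> b > 0" | "m = 2" "b = 0" by auto
      then show ?thesis
      proof cases
        case 1
        then show ?thesis using c mid[of 0 0] by (simp add: cluster_mon_def)
      next
        case 2
        then show ?thesis using c shift[of m b] right[of "m + 1" b 0] \<open>m \<ge> 2\<close> by simp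
      next
        case 3
        then show ?thesis using c right[of m a b] \<open>m \<ge> 2\<close> by simp
      next
        case 4
        then show ?thesis using c shift[of 1 a] mid[of 0 a] by simp
      qed
    next
      case 3
      consider "a = 0" "b = 0" | "b = 0" "a > 0" | "b > 0" "m = 0 \<longrightarrow> a > 0" | "m = 0" "a = 0" by auto
      then show ?thesis
      proof cases
        case 1
        then show ?thesis using c mid[of 0 0] by (simp add: cluster_mon_def)
      next
        case 2
        then show ?thesis using c shift[of "m - 1" a] left[of "m - 1" a 0] \<open>m \<le> 0\<close> by simp
      next
        case 3
        then show ?thesis using c left[of m b a] \<open>m \<le> 0\<close> by simp
      next
        case 4
        then show ?thesis using c shift[of 0 b] mid[of b 0] by simp
      qed
    qed
  qed (use cheb in blast)
qed

lemma cluster_pt_right_region: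
  assumes "m \<ge> 2" "a > 0" "m = 2 \<Longrightarrow> b > 0"
  shows "fst (cluster_pt m a b) < 0" "snd (cluster_pt m a b) > 2 * fst (cluster_pt m a b)"
proof -
  let ?A = "int a * parity_wt m" and ?B = "int b * parity_wt (m + 1)"
  have pos: "?A > 0" "?B \<ge> 0" "m = 2 \<Longrightarrow> ?B > 0" using assms by (simp_all add: less_imp_le)
  then show "snd (cluster_pt m a b) > 2 * fst (cluster_pt m a b)" using cluster_pt_right(1)[OF assms(1), of a b] by linarith
  show "fst (cluster_pt m a b) < 0"
  proof (cases "m = 2")
    case True
    then show ?thesis using cluster_pt_right(2)[OF assms(1), of a b] pos by auto
  next
    case False
    then have "(2 - m) * (?A + ?B) < 0" using assms pos by (intro mult_neg_pos) linarith+
    then show ?thesis using cluster_pt_right(2)[OF assms(1), of a b] pos by linarith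
  qed
qed

lemma cluster_pt_left_region:
  assumes "m \<le> 0" "b > 0" "m = 0 \<Longrightarrow> a > 0"
  shows "snd (cluster_pt m a b) < 0" "snd (cluster_pt m a b) < 2 * fst (cluster_pt m a b)"
proof -
  let ?A = "int a * parity_wt m" and ?B = "int b * parity_wt (m + 1)"
  have pos: "?B > 0" "?A \<ge> 0" "m = 0 \<Longrightarrow> ?A > 0" using assms by (simp_all add: less_imp_le)
  then show "snd (cluster_pt m a b) < 2 * fst (cluster_pt m a b)" using cluster_pt_left(1)[OF assms(1), of a b] by linarith
  have *: "snd (cluster_pt m a b) = m * (?A + ?B) - ?A"
    using cluster_pt_left[OF assms(1), of a b] by linarith
  show "snd (cluster_pt m a b) < 0"
  proof (cases "m = 0")
    case True
    then show ?thesis using * pos by auto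
  next
    case False
    then have "m * (?A + ?B) < 0" using assms pos by (intro mult_neg_pos) linarith+
    then show ?thesis using * pos by linarith
  qed
qed

lemma cluster_pt_right_inj:
  assumes "m \<ge> 2" "a > 0" "m' \<ge> 2" "a' > 0" and eq: "cluster_pt m a b = cluster_pt m' a' b'"
  shows "m = m' \<and> a = a' \<and> b = b'"
proof -
  define A B A' B' where AB: "A = int a * parity_wt m" "B = int b * parity_wt (m + 1)"
    "A' = int a' * parity_wt m'" "B' = int b' * parity_wt (m' + 1)"
  have pos: "A > 0" "B \<ge> 0" "A' > 0" "B' \<ge> 0" using assms by (simp_all add: AB less_imp_le)
  have D: "A + B = A' + B'"
    using cluster_pt_right(1)[OF assms(1), of a b] cluster_pt_right(1)[OF assms(3), of a' b'] eq unfolding AB by simp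
  have "(2 - m) * (A + B) - B = (2 - m') * (A + B) - B'"
    using cluster_pt_right(2)[OF assms(1), of a b] cluster_pt_right(2)[OF assms(3), of a' b'] eq
    unfolding AB[symmetric] D by simp
  then have "(m - 2) * (A + B) + B = (m' - 2) * (A + B) + B'" by (simp add: algebra_simps)
  then have "m - 2 = m' - 2 \<and> B = B'" using pos D by (intro div_mod_unique_int[where D = "A + B"]) auto
  then show ?thesis using D by (auto simp: AB)
qed

lemma cluster_pt_left_inj:
  assumes "m \<le> 0" "b > 0" "m' \<le> 0" "b' > 0" and eq: "cluster_pt m a b = cluster_pt m' a' b'"
  shows "m = m' \<and> a = a' \<and> b = b'"
proof -
  define A B A' B' where AB: "A = int a * parity_wt m" "B = int b * parity_wt (m + 1)"
    "A' = int a' * parity_wt m'" "B' = int b' * parity_wt (m' + 1)"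
  have pos: "A \<ge> 0" "B > 0" "A' \<ge> 0" "B' > 0" using assms by (simp_all add: AB less_imp_le)
  have D: "A + B = A' + B'"
    using cluster_pt_left(1)[OF assms(1), of a b] cluster_pt_left(1)[OF assms(3), of a' b'] eq unfolding AB by simp
  have "m * (A + B) + B = m' * (A + B) + B'"
    using cluster_pt_left(2)[OF assms(1), of a b] cluster_pt_left(2)[OF assms(3), of a' b'] eq
    unfolding AB[symmetric] D by simp
  then have "(- m - 1) * (A + B) + A = (- m' - 1) * (A + B) + A'" using D by (simp add: algebra_simps)
  then have "- m - 1 = - m' - 1 \<and> A = A'" using pos D by (intro div_mod_unique_int[where D = "A + B"]) auto
  then show ?thesis using D by (auto simp: AB)
qed

text \<open>The four cases occupy disjoint regions of the plane: the closed first quadrant, the two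
  sides of the line \<open>snd p = 2 * fst p\<close>, and the ray of this line where the Chebyshev
  elements sit.\<close>

lemma basis_set_pointed_cases:
  assumes "x \<in> basis_set" "pointed p x"
  obtains (mid) a b where "x = cluster_mon 1 a b" "p = (int a, int b)"
    | (right) m a b where "m \<ge> 2" "a > 0" "x = cluster_mon m a b" "p = cluster_pt m a b" "fst p < 0" "snd p > 2 * fst p"
    | (left) m a b where "m \<le> 0" "b > 0" "x = cluster_mon m a b" "p = cluster_pt m a b" "snd p < 0" "snd p < 2 * fst p"
    | (cheb) n where "n \<ge> 1" "x = cheb_delta n" "p = (- int n, - 2 * int n)"
proof -
  have c: "p = cluster_pt m a b" if "x = cluster_mon m a b" for m a b
    using that cluster_mon_pointed[of a m b] pointed_unique[OF assms(2)] unfolding cluster_pt_def by blast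
  have z: "p = (- int n, - 2 * int n)" if "x = cheb_delta n" for n
    using that cheb_delta_pointed[of n] pointed_unique[OF assms(2)] by blast
  show thesis
    using assms(1)
  proof (cases rule: basis_set_cases)
    case (mid a b)
    then show ?thesis using c[OF mid] that(1)[of a b] by (simp add: cluster_pt_mid)
  next
    case (right m a b)
    then show ?thesis using c[OF right(4)] that(2)[of m a b] cluster_pt_right_region[OF right(1-3)] by simp
  next
    case (left m a b)
    then show ?thesis using c[OF left(4)] that(3)[of m b a] cluster_pt_left_region[OF left(1-3)] by simp
  next
    case (cheb n)
    then show ?thesis using z[OF cheb(2)] that(4)[of n] by simp
  qed
qed

lemma basis_set_pointed_unique:
  assumes x: "x \<in> basis_set" "pointed p x" and y: "y \<in> basis_set" "pointed p y"
  shows "x = y"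
  using x
proof (cases rule: basis_set_pointed_cases)
  case (mid a b)
  then have reg: "fst p \<ge> 0" "snd p \<ge> 0" by simp_all
  from y show ?thesis
  proof (cases rule: basis_set_pointed_cases)
    case mid': (mid a' b')
    then show ?thesis using mid by simp
  qed (use reg in \<open>linarith, linarith, simp\<close>)
next
  case (right m a b)
  from y show ?thesis
  proof (cases rule: basis_set_pointed_cases)
    case right': (right m' a' b')
    then show ?thesis using cluster_pt_right_inj[of m a m' a' b b'] right by metis
  qed (use right(5,6) in simp_all)
next
  case (left m a b)
  from y show ?thesis
  proof (cases rule: basis_set_pointed_cases)
    case left': (left m' a' b')
    then show ?thesis using cluster_pt_left_inj[of m b m' b' a a'] left by metis
  qed (use left(5,6) in simp_all)
next
  case (cheb n)
  then have reg: "fst p < 0" "snd p = 2 * fst p" by simp_all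
  from y show ?thesis
  proof (cases rule: basis_set_pointed_cases)
    case cheb': (cheb n')
    then show ?thesis using cheb by simp
  qed (use reg in \<open>simp, linarith, linarith\<close>)
qed

lemma basis_set_pointed: "x \<in> basis_set \<Longrightarrow> \<exists>p. pointed p x"
  unfolding basis_set_def using cluster_mon_pointed cheb_delta_pointed by blast

lemma parity_wt_dvd: "parity_wt m dvd A \<Longrightarrow> A \<ge> 0 \<Longrightarrow> \<exists>a. A = int a * parity_wt m"
  by (rule exI[of _ "nat (A div parity_wt m)"]) (simp add: pos_imp_zdiv_nonneg_iff less_imp_le)

text \<open>The open third quadrant is where a standard monomial need not be a cluster monomial up
  to a power of \<open>t\<close>, so it is where triangularity requires a basis element at a
  prescribed point.\<close>

lemma basis_set_surj:
  assumes "fst p < 0" "snd p < 0"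
  shows "\<exists>x\<in>basis_set. pointed p x"
proof -
  have main: "\<exists>x\<in>basis_set. pointed p x" if "p = cluster_pt m a b" for m a b
  proof
    show "cluster_mon m a b \<in> basis_set" by (auto simp: basis_set_def)
    show "pointed p (cluster_mon m a b)" using that cluster_mon_pointed[of a m b] by (simp add: cluster_pt_def)
  qed
  define D where "D = snd p - 2 * fst p"
  \<comment> \<open>The variable with odd index has weight 2, so its weighted exponent must be even:
    this is \<open>B\<close> for even \<open>m\<close> and \<open>A\<close> for odd
    \<open>m\<close>, and in both cases it is the parity condition.\<close>
  have split: "\<exists>a b. A = int a * parity_wt m \<and> B = int b * parity_wt (m + 1)"
    if "A \<ge> 0" "B \<ge> 0" "even (m * (A + B) + B)" for m A B
  proof -
    have "parity_wt m dvd A \<and> parity_wt (m + 1) dvd B"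
      using that(3) by (auto simp: parity_wt_def algebra_simps)
    then show ?thesis using that parity_wt_dvd by metis
  qed
  consider "D > 0" | "D < 0" | "D = 0" by linarith
  then show ?thesis
  proof cases
    case 1
    \<comment> \<open>By \<open>cluster_pt_right\<close> the target satisfies
      \<open>Q = m * D + B\<close>; since \<open>fst p < 0\<close> gives \<open>Q >= 2 * D\<close>,
      the quotient is at least 2.\<close>
    define Q where "Q = 2 * (D - fst p)"
    define m where "m = Q div D"
    define B where "B = Q mod D"
    have Q: "Q = m * (D - B + B) + B" by (simp add: m_def B_def)
    have B: "0 \<le> B" "B < D" using 1 by (simp_all add: B_def)
    have "2 * D div D \<le> Q div D" using 1 assms by (intro zdiv_mono1) (auto simp: Q_def)
    then have m: "m \<ge> 2" using 1 by (simp add: m_def)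
    have "even (m * (D - B + B) + B)" unfolding Q[symmetric] Q_def by simp
    then obtain a b where ab: "D - B = int a * parity_wt m" "B = int b * parity_wt (m + 1)"
      using split[of "D - B" B m] B by auto
    have "snd (cluster_pt m a b) - 2 * fst (cluster_pt m a b) = D"
      using cluster_pt_right(1)[OF m, of a b] ab by linarith
    moreover have "2 * fst (cluster_pt m a b) = 2 * fst p"
      using cluster_pt_right(2)[OF m, of a b] Q unfolding ab[symmetric] by (simp add: Q_def algebra_simps)
    ultimately have "p = cluster_pt m a b" by (simp add: D_def prod_eq_iff)
    then show ?thesis by (rule main)
  next
    case 2
    \<comment> \<open>By \<open>cluster_pt_left\<close> now \<open>Q = m * D' + B\<close> with
      \<open>D' = - D\<close>, and \<open>Q <= 0\<close> gives \<open>m <= 0\<close>.\<close>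
    define Q where "Q = 2 * fst p"
    define D' where "D' = - D"
    define m where "m = Q div D'"
    define B where "B = Q mod D'"
    have D': "D' > 0" using 2 by (simp add: D'_def)
    have Q: "Q = m * (D' - B + B) + B" by (simp add: m_def B_def)
    have B: "0 \<le> B" "B < D'" using D' by (simp_all add: B_def)
    have m: "m \<le> 0" using D' assms by (simp add: m_def Q_def div_nonpos_pos_le0)
    have "even (m * (D' - B + B) + B)" unfolding Q[symmetric] Q_def by simp
    then obtain a b where ab: "D' - B = int a * parity_wt m" "B = int b * parity_wt (m + 1)"
      using split[of "D' - B" B m] B by auto
    have "snd (cluster_pt m a b) - 2 * fst (cluster_pt m a b) = D"
      using cluster_pt_left(1)[OF m, of a b] ab D'_def by linarith
    moreover have "2 * fst (cluster_pt m a b) = 2 * fst p"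
      using cluster_pt_left(2)[OF m, of a b] Q unfolding ab[symmetric] by (simp add: Q_def algebra_simps)
    ultimately have "p = cluster_pt m a b" by (simp add: D_def prod_eq_iff)
    then show ?thesis by (rule main)
  next
    case 3
    define n where "n = nat (- fst p)"
    have "p = (- int n, - 2 * int n)" "n \<ge> 1" using 3 assms by (auto simp: D_def n_def prod_eq_iff)
    then show ?thesis using cheb_delta_pointed[of n] by (auto simp: basis_set_def)
  qed
qed

section \<open>Linear independence\<close>

lemma basis_set_independent: "Q.independent basis_set"
proof
  assume "Q.dependent basis_set"
  then obtain T u v where T: "finite T" "T \<subseteq> basis_set" "(\<Sum>v\<in>T. u v \<cdot> v) = 0" "v \<in> T" "u v \<noteq> 0"
    by (auto simp: Q.dependent_explicit)
  define pt where "pt x = (THE p. pointed p x)" for x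
  have pt: "pointed (pt x) x" if x: "x \<in> basis_set" for x
  proof -
    obtain p where p: "pointed p x" using basis_set_pointed[OF x] by blast
    then have "pt x = p" unfolding pt_def by (rule the_equality) (rule pointed_unique[OF _ p])
    then show ?thesis using p by simp
  qed
  define S where "S = {x \<in> T. u x \<noteq> 0}"
  have inj: "inj_on pt S"
  proof (rule inj_onI)
    fix x y assume "x \<in> S" "y \<in> S" "pt x = pt y"
    then show "x = y"
      using basis_set_pointed_unique[of x "pt x" y] pt[of x] pt[of y] T(2) by (auto simp: S_def)
  qed
  define M where "M = the_inv_into S pt"
  have M: "M (pt x) = x" if "x \<in> S" for x
    using that inj by (simp add: M_def the_inv_into_f_f)
  have "0 = (\<Sum>x\<in>S. u x \<cdot> x)"
    unfolding T(3)[symmetric] S_def using T(1) by (intro sum.mono_neutral_right) auto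
  also have "\<dots> = (\<Sum>p\<in>pt ` S. u (M p) \<cdot> M p)"
    by (simp add: sum.reindex inj M)
  finally have sum: "(\<Sum>p\<in>pt ` S. u (M p) \<cdot> M p) = 0" by simp
  have "finite (pt ` S)" "pt v \<in> pt ` S" using T by (auto simp: S_def)
  moreover have "pointed p (M p) \<and> u (M p) \<noteq> 0" if "p \<in> pt ` S" for p
    using that M pt T by (auto simp: S_def)
  ultimately obtain r where "r \<in> supp (\<Sum>p\<in>pt ` S. u (M p) \<cdot> M p)"
    using pointed_combination[of "pt ` S" M "\<lambda>p. u (M p)" "pt v"] by metis
  then show False by (simp add: sum supp_iff)
qed

section \<open>Spanning of the algebra\<close>

lemma Aq_closed:
  "rep 1 \<in> Aq" "rep x \<in> Aq \<Longrightarrow> rep y \<in> Aq \<Longrightarrow> rep (x + y) \<in> Aq"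
  "rep x \<in> Aq \<Longrightarrow> rep y \<in> Aq \<Longrightarrow> rep (x * y) \<in> Aq" "rep x \<in> Aq \<Longrightarrow> rep (c \<cdot> x) \<in> Aq"
  "rep (Xq k) \<in> Aq"
  using Aq.intros by (simp_all add: one_qt.rep_eq plus_qt.rep_eq times_qt.rep_eq flip: rep_sm Xc_eq)

lemma Aq_diff: "rep x \<in> Aq \<Longrightarrow> rep y \<in> Aq \<Longrightarrow> rep (x - y) \<in> Aq"
  using Aq_closed(2)[of x "(-1) \<cdot> y"] Aq_closed(4)[of y "-1"] by (simp add: sm_minus_left)

lemma Aq_power: "rep x \<in> Aq \<Longrightarrow> rep (x ^ n) \<in> Aq"
  by (induction n) (simp_all add: Aq_closed)

lemma Xdelta_qt_Aq: "rep Xdelta_qt \<in> Aq"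
  using Xq_mem_generated(2)[of "{x. rep x \<in> Aq}"] by (simp add: Aq_closed)

lemma basis_set_Aq: "x \<in> basis_set \<Longrightarrow> rep x \<in> Aq"
proof -
  have "rep (cheb_delta n) \<in> Aq" for n
    by (induction n rule: cheb_delta.induct) (simp_all add: Aq_closed Aq_diff Xdelta_qt_Aq)
  moreover have "rep (cluster_mon m a b) \<in> Aq" for m a b
    by (simp add: cluster_mon_def Aq_closed Aq_power)
  ultimately show "x \<in> basis_set \<Longrightarrow> rep x \<in> Aq" by (auto simp: basis_set_def)
qed

lemma inj_standard_mon: "inj standard_mon"
  by (rule injI) (metis pointed_unique standard_mon_pointed)

lemma ordered_span_combination:
  assumes "y \<in> ordered_span"
  obtains S c where "finite S" "\<And>p. p \<in> S \<Longrightarrow> c p \<noteq> 0" "y = (\<Sum>p\<in>S. c p \<cdot> standard_mon p)"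
proof -
  have "y \<in> Q.span (range standard_mon)" using assms ordered_span_span_standard_mon by blast
  then obtain t r where t: "finite t" "t \<subseteq> range standard_mon" "y = (\<Sum>a\<in>t. r a \<cdot> a)"
    by (auto simp: Q.span_explicit)
  then obtain S where S: "finite S" "t = standard_mon ` S" by (metis finite_subset_image)
  have "y = (\<Sum>p\<in>S. r (standard_mon p) \<cdot> standard_mon p)"
    using t(3) S(2) inj_standard_mon by (simp add: sum.reindex inj_on_subset)
  also have "\<dots> = (\<Sum>p | p \<in> S \<and> r (standard_mon p) \<noteq> 0. r (standard_mon p) \<cdot> standard_mon p)"
    using S(1) by (intro sum.mono_neutral_right) auto
  finally show ?thesis
    using S(1) by (intro that[of "{p \<in> S. r (standard_mon p) \<noteq> 0}" "\<lambda>p. r (standard_mon p)"]) auto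
qed

text \<open>Subtracting the basis element with the same corner leaves a combination of standard
  monomials strictly above \<open>p\<close>. There are infinitely many such vectors; the measure
  counts only negative parts, and drops since both coordinates of \<open>p\<close> are
  negative.\<close>

lemma standard_mon_span_basis_set: "standard_mon p \<in> Q.span basis_set"
proof (induction "nat (- fst p) + nat (- snd p)" arbitrary: p rule: less_induct)
  case less
  have c: "tq i \<cdot> cluster_mon m a b \<in> Q.span basis_set" for i m a b
    by (rule Q.span_scale, rule Q.span_base) (auto simp: basis_set_def)
  have cluster_mon: "Xq m ^ a * Xq (m + 1) ^ b = tq (int a * int b) \<cdot> cluster_mon m a b" for m a b
    by (simp add: cluster_mon_def flip: tq_add)
  consider "fst p \<ge> 0" "snd p \<ge> 0" | "fst p \<ge> 0" "snd p \<le> 0" | "fst p \<le> 0" "snd p \<ge> 0"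
    | "fst p < 0" "snd p < 0" by linarith
  then show ?case
  proof cases
    case 1
    then have "standard_mon p = Xq 1 ^ nat (fst p) * Xq (1 + 1) ^ nat (snd p)" by (simp add: standard_mon_def ordered_mon_def)
    then show ?thesis using c cluster_mon by metis
  next
    case 2
    then have "standard_mon p = Xq 0 ^ nat (- snd p) * Xq (0 + 1) ^ nat (fst p)" by (simp add: standard_mon_def ordered_mon_def)
    then show ?thesis using c cluster_mon by metis
  next
    case 3
    then have "standard_mon p = Xq 2 ^ nat (snd p) * Xq (2 + 1) ^ nat (- fst p)" by (simp add: standard_mon_def ordered_mon_def)
    then show ?thesis using c cluster_mon by metis
  next
    case 4
    obtain x where x: "x \<in> basis_set" "pointed p x" using basis_set_surj[OF 4] by blast
    obtain i j where ij: "coef (standard_mon p) p = tq i" "coef x p = tq j"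
      using x(2) standard_mon_pointed[of p] by (auto simp: pointed_def)
    define y where "y = standard_mon p - tq (i - j) \<cdot> x"
    have "rep y \<in> Aq"
      using basis_set_Aq[OF x(1)] by (simp add: y_def standard_mon_def ordered_mon_def Aq_diff Aq_closed Aq_power)
    then have "y \<in> ordered_span" using Aq_ordered_span by (metis rep_inverse)
    then obtain S c where S: "finite S" "\<And>p. p \<in> S \<Longrightarrow> c p \<noteq> 0" "y = (\<Sum>p\<in>S. c p \<cdot> standard_mon p)"
      using ordered_span_combination by blast
    have supp_y: "fst p \<le> fst e \<and> snd p \<le> snd e \<and> e \<noteq> p" if e: "e \<in> supp y" for e
    proof -
      have "coef y p = 0" by (simp add: y_def ij flip: tq_add)
      moreover have "e \<in> supp (standard_mon p) \<or> e \<in> supp x"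
        using e by (auto simp: y_def supp_iff)
      ultimately show ?thesis
        using e x(2) standard_mon_pointed[of p] by (auto simp: pointed_def supp_iff)
    qed
    \<comment> \<open>Each index occurring in \<open>y\<close> dominates some support point of
      \<open>y\<close>, hence dominates \<open>p\<close> without being \<open>p\<close>.\<close>
    have "standard_mon p' \<in> Q.span basis_set" if p': "p' \<in> S" for p'
    proof -
      obtain r where r: "r \<in> supp y" "fst r \<le> fst p'" "snd r \<le> snd p'"
        using pointed_combination[of S standard_mon c p', folded S(3)] S(1,2) standard_mon_pointed p' by blast
      then have "fst p \<le> fst p'" "snd p \<le> snd p'" "p' \<noteq> p"
        using supp_y[OF r(1)] by (auto simp: prod_eq_iff)
      then have "nat (- fst p') + nat (- snd p') < nat (- fst p) + nat (- snd p)"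
        using 4 by (auto simp: prod_eq_iff)
      then show ?thesis by (rule less)
    qed
    then have "y \<in> Q.span basis_set"
      unfolding S(3) by (intro Q.span_sum Q.span_scale)
    moreover have "tq (i - j) \<cdot> x \<in> Q.span basis_set"
      using x by (intro Q.span_scale Q.span_base)
    ultimately have "y + tq (i - j) \<cdot> x \<in> Q.span basis_set" by (rule Q.span_add)
    then show ?thesis by (simp add: y_def)
  qed
qed

lemma Aq_span_basis_set: "rep x \<in> Aq \<longleftrightarrow> x \<in> Q.span basis_set"
proof
  assume "rep x \<in> Aq"
  then have "x \<in> ordered_span" using Aq_ordered_span by (metis rep_inverse)
  then have "x \<in> Q.span (range standard_mon)" using ordered_span_span_standard_mon by blast
  also have "\<dots> \<subseteq> Q.span basis_set" by (rule Q.span_minimal) (auto simp: standard_mon_span_basis_set)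
  finally show "x \<in> Q.span basis_set" .
next
  assume "x \<in> Q.span basis_set"
  then show "rep x \<in> Aq"
  proof (induction rule: Q.span_induct_alt)
    case base
    then show ?case using Aq_closed(4)[OF Aq_closed(1), of 0] by simp
  next
    case (step c x y)
    then show ?case by (simp add: Aq_closed basis_set_Aq)
  qed
qed

section \<open>Expansions in other clusters\<close>

lemma sm_eq_0_iff [simp]: "c \<cdot> x = 0 \<longleftrightarrow> c = 0 \<or> x = 0"
proof -
  have "mon c 0 = 0 \<longleftrightarrow> c = 0" by (metis coef_mon coef_simps(1) qt_eqI)
  then show ?thesis by (simp add: sm_def)
qed

lemma supp_Xe: "e \<in> supp (Xe f) \<Longrightarrow> e = f"
  by (simp add: supp_iff coef_mon split: if_splits)

section \<open>Polynomial elements and common denominators\<close>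

definition polyn :: "qt \<Rightarrow> bool" where
  "polyn P \<longleftrightarrow> (\<forall>e\<in>supp P. 0 \<le> fst e \<and> 0 \<le> snd e)"

definition diag :: "nat \<Rightarrow> qt" where
  "diag n = Xe (int n, int n)"

lemma polyn_diag: "polyn (diag n)"
  by (auto simp: polyn_def diag_def dest!: supp_Xe)

lemma diag_add: "diag (m + n) = diag m * diag n"
  by (simp add: diag_def Xe_mult lam_def)

lemma diag_0: "diag 0 = 1"
  by (simp add: diag_def one_mon zero_prod_def)

lemma diag_nonzero [simp]: "diag n \<noteq> 0"
  by (metis coef_mon coef_simps(1) diag_def zero_neq_one)

text \<open>The Ore condition made explicit: \<open>diag n\<close> is a normal element, and
  conjugation by it changes only coefficients, by powers of \<open>t\<close>. Denominators can thus
  be moved past polynomial elements.\<close>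

definition conj_diag :: "nat \<Rightarrow> qt \<Rightarrow> qt" where
  "conj_diag n P = Xe (- int n, - int n) * P * diag n"

lemma diag_conj: "diag n * conj_diag n P = P * diag n"
proof -
  have "diag n * Xe (- int n, - int n) = 1"
    by (simp add: diag_def Xe_mult lam_def one_mon zero_prod_def)
  then show ?thesis by (simp add: conj_diag_def flip: mult.assoc)
qed

lemma polyn_conj: "polyn P \<Longrightarrow> polyn (conj_diag n P)"
  unfolding polyn_def conj_diag_def diag_def by (fastforce dest!: supp_mult supp_Xe)

definition bounded :: "nat \<Rightarrow> qt \<Rightarrow> bool" where
  "bounded n Z \<longleftrightarrow> (\<forall>e\<in>supp Z. - int n \<le> fst e \<and> - int n \<le> snd e)"

lemma bounded_mono: "bounded n Z \<Longrightarrow> n \<le> n' \<Longrightarrow> bounded n' Z"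
  by (force simp: bounded_def)

lemma bounded_exists: "\<exists>n. bounded n Z"
proof -
  define n where "n = (\<Sum>e\<in>supp Z. nat \<bar>fst e\<bar> + nat \<bar>snd e\<bar>)"
  have "- int n \<le> fst e \<and> - int n \<le> snd e" if "e \<in> supp Z" for e
  proof -
    have "nat \<bar>fst e\<bar> + nat \<bar>snd e\<bar> \<le> n"
      unfolding n_def using that by (intro member_le_sum) auto
    then show ?thesis by linarith
  qed
  then show ?thesis unfolding bounded_def by blast
qed

lemma bounded_polyn: "bounded n Z \<Longrightarrow> polyn (Z * diag n)"
  unfolding bounded_def polyn_def diag_def by (fastforce dest!: supp_mult supp_Xe)

lemma bounded_add: "bounded n Z \<Longrightarrow> bounded n Z' \<Longrightarrow> bounded n (Z + Z')"
  and bounded_sm: "bounded n Z \<Longrightarrow> bounded n (c \<cdot> Z)"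
  using supp_add supp_sm by (fastforce simp: bounded_def)+

lemma bounded_mult: "bounded m Z \<Longrightarrow> bounded n Z' \<Longrightarrow> bounded (m + n) (Z * Z')"
  unfolding bounded_def by (fastforce dest!: supp_mult)

definition nonneg_coeffs :: "qt \<Rightarrow> bool" where
  "nonneg_coeffs x \<longleftrightarrow> (\<forall>e. lpoly_nonneg (coef x e))"

lemma lpoly_nonneg_add: "lpoly_nonneg p \<Longrightarrow> lpoly_nonneg q \<Longrightarrow> lpoly_nonneg (p + q)"
  by (simp add: lpoly_nonneg_def lookup_add)

lemma lpoly_nonneg_tq: "lpoly_nonneg (tq i)"
  by (simp add: lpoly_nonneg_def tq_def lookup_single when_def)

lemma lpoly_nonneg_0: "lpoly_nonneg 0"
  by (simp add: lpoly_nonneg_def)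

lemma lpoly_nonneg_mult: "lpoly_nonneg p \<Longrightarrow> lpoly_nonneg q \<Longrightarrow> lpoly_nonneg (p * q)"
  unfolding lpoly_nonneg_def lookup_mult Sum_any.expand_set
  by (auto intro!: sum_nonneg mult_nonneg_nonneg simp: when_def)

lemma nonneg_coeffs_add: "nonneg_coeffs x \<Longrightarrow> nonneg_coeffs y \<Longrightarrow> nonneg_coeffs (x + y)"
  by (simp add: nonneg_coeffs_def lpoly_nonneg_add)

lemma nonneg_coeffs_sum: "(\<And>a. a \<in> A \<Longrightarrow> nonneg_coeffs (f a)) \<Longrightarrow> nonneg_coeffs (sum f A)"
proof (induction A rule: infinite_finite_induct)
  case (insert a A)
  then show ?case by (simp add: nonneg_coeffs_add)
qed (auto simp: nonneg_coeffs_def lpoly_nonneg_0)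

lemma nonneg_coeffs_sm: "lpoly_nonneg c \<Longrightarrow> nonneg_coeffs x \<Longrightarrow> nonneg_coeffs (c \<cdot> x)"
  by (simp add: nonneg_coeffs_def lpoly_nonneg_mult)

lemma nonneg_coeffs_1: "nonneg_coeffs 1"
  using lpoly_nonneg_tq[of 0] by (simp add: nonneg_coeffs_def coef_1 lpoly_nonneg_0)

lemma nonneg_coeffs_Xe_mult: "nonneg_coeffs x \<Longrightarrow> nonneg_coeffs (Xe e * x)"
proof -
  assume "nonneg_coeffs x"
  have "coef (Xe e * x) (e + (f - e)) = coef (Xe e) e * coef x (f - e) * tq (lam e (f - e))" for f
    by (rule coef_mult_corner) (rule supp_Xe)
  moreover have "lpoly_nonneg (coef x (f - e))" for f using \<open>nonneg_coeffs x\<close> by (simp only: nonneg_coeffs_def)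
  ultimately show ?thesis
    unfolding nonneg_coeffs_def by (simp add: coef_mon lpoly_nonneg_mult lpoly_nonneg_tq del: split_paired_All)
qed

lemma nonneg_coeffs_mult_Xe: "nonneg_coeffs x \<Longrightarrow> nonneg_coeffs (x * Xe e)"
proof -
  assume "nonneg_coeffs x"
  have "coef (x * Xe e) (f - e + e) = coef x (f - e) * coef (Xe e) e * tq (lam (f - e) e)" for f
    by (rule coef_mult_corner) (metis add_right_cancel supp_Xe)
  moreover have "lpoly_nonneg (coef x (f - e))" for f using \<open>nonneg_coeffs x\<close> by (simp only: nonneg_coeffs_def)
  ultimately show ?thesis
    unfolding nonneg_coeffs_def by (simp add: coef_mon lpoly_nonneg_mult lpoly_nonneg_tq del: split_paired_All)
qed

lemma nonneg_coeffs_Xe_power_mult: "nonneg_coeffs x \<Longrightarrow> nonneg_coeffs (Xe e ^ n * x)"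
  by (induction n) (simp_all add: nonneg_coeffs_Xe_mult mult.assoc)

lemma nonneg_coeffs_mult_Xe_power: "nonneg_coeffs x \<Longrightarrow> nonneg_coeffs (x * Xe e ^ n)"
  by (induction n) (simp_all add: nonneg_coeffs_mult_Xe power_Suc2 del: power_Suc flip: mult.assoc)

lemma Xe_minus: "Xe (- e) * Xe e = 1" "Xe e * Xe (- e) = 1"
  by (simp_all add: Xe_mult lam_def one_mon)

lemma Xe_minus_power: "Xe (- e) ^ n * Xe e ^ n = 1" "Xe e ^ n * Xe (- e) ^ n = 1"
  by (metis Xe_minus left_right_inverse_power)+

text \<open>For \<open>eps = 1\<close> the sequence \<open>xs\<close> is a shift of the cluster variables by an even number; for
  \<open>eps = - 1\<close> it is a reflection, which is a homomorphism only when combined with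
  the bar involution \<open>tau\<close> of the coefficients.\<close>

locale reindexed =
  fixes xs :: "int \<Rightarrow> qt" and eps :: int and tau :: "lpoly \<Rightarrow> lpoly"
  assumes tau_add: "tau (a + b) = tau a + tau b"
    and tau_mult: "tau (a * b) = tau a * tau b"
    and tau_tq: "tau (tq i) = tq (eps * i)"
    and tau_tau: "tau (tau a) = a"
    and tau_nonneg: "lpoly_nonneg a \<Longrightarrow> lpoly_nonneg (tau a)"
    and xs_nonzero [simp]: "xs k \<noteq> 0"
    and xs_comm: "xs k * xs (k + 1) = tq (2 * eps) \<cdot> (xs (k + 1) * xs k)"
    and xs_exch_odd: "odd k \<Longrightarrow> xs (k - 1) * xs (k + 1) = tq eps \<cdot> xs k + 1"
    and xs_exch_odd': "odd k \<Longrightarrow> xs (k + 1) * xs (k - 1) = tq (- eps) \<cdot> xs k + 1"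
    and xs_exch_even: "even k \<Longrightarrow> xs (k - 1) * xs (k + 1) = tq (4 * eps) \<cdot> xs k ^ 4 + 1"
    and xs_exch_even': "even k \<Longrightarrow> xs (k + 1) * xs (k - 1) = tq (- 4 * eps) \<cdot> xs k ^ 4 + 1"
    and Xdelta_qt_xs: "Xdelta_qt = tq eps \<cdot> (xs 0 * xs 4) - tq (3 * eps) \<cdot> (xs 2 * xs 2)"
    and xs_indep: "finite S \<Longrightarrow> (\<And>e. e \<in> S \<Longrightarrow> 0 \<le> fst e \<and> 0 \<le> snd e) \<Longrightarrow>
       (\<Sum>e\<in>S. c e \<cdot> (xs 1 ^ nat (fst e) * xs 2 ^ nat (snd e))) = 0 \<Longrightarrow> e \<in> S \<Longrightarrow> c e = 0"
begin

lemma tau_0 [simp]: "tau 0 = 0"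
  using tau_add[of 0 0] by simp

lemma tau_1 [simp]: "tau 1 = 1"
  using tau_tq[of 0] by simp

lemma tau_minus: "tau (- a) = - tau a"
  using tau_add[of a "- a"] by (simp add: eq_neg_iff_add_eq_0 add.commute)

lemma tau_eq_0_iff [simp]: "tau a = 0 \<longleftrightarrow> a = 0"
  using tau_tau[of a] by auto

definition mm :: "int \<times> int \<Rightarrow> qt" where
  "mm e = tq (- eps * fst e * snd e) \<cdot> (xs 1 ^ nat (fst e) * xs 2 ^ nat (snd e))"

lemma mm_mult:
  assumes "0 \<le> fst e" "0 \<le> snd e" "0 \<le> fst f" "0 \<le> snd f"
  shows "mm e * mm f = tq (eps * lam e f) \<cdot> mm (e + f)"
proof -
  obtain a b where e: "e = (int a, int b)" using assms by (metis nonneg_int_cases prod.collapse)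
  obtain c d where f: "f = (int c, int d)" using assms by (metis nonneg_int_cases prod.collapse)
  have "xs 1 * xs 2 = tq (2 * eps) \<cdot> (xs 2 * xs 1)" using xs_comm[of 1] by simp
  from qcomm_power[OF this, of c b]
  have swap: "xs 2 ^ b * xs 1 ^ c = tq (- (2 * eps * int b * int c)) \<cdot> (xs 1 ^ c * xs 2 ^ b)"
    by (simp add: ac_simps flip: tq_add)
  have "(xs 1 ^ a * xs 2 ^ b) * (xs 1 ^ c * xs 2 ^ d) = xs 1 ^ a * (xs 2 ^ b * xs 1 ^ c) * xs 2 ^ d"
    by (simp add: mult.assoc)
  also have "\<dots> = tq (- (2 * eps * int b * int c)) \<cdot> (xs 1 ^ (a + c) * xs 2 ^ (b + d))"
    by (simp add: swap power_add mult.assoc)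
  finally show ?thesis
    by (simp add: mm_def e f lam_def nat_int_add algebra_simps flip: tq_add)
qed

text \<open>Substitution of \<open>xs 1, xs 2\<close> for \<open>X_1, X_2\<close>, semilinear
  through \<open>tau\<close>. It is multiplicative on \<open>polyn\<close> elements only, because
  \<open>nat\<close> in \<open>mm\<close> truncates negative exponents to 0.\<close>

definition E :: "qt \<Rightarrow> qt" where
  "E P = (\<Sum>e\<in>supp P. tau (coef P e) \<cdot> mm e)"

lemma E_superset: "finite A \<Longrightarrow> supp P \<subseteq> A \<Longrightarrow> E P = (\<Sum>e\<in>A. tau (coef P e) \<cdot> mm e)"
  unfolding E_def by (rule sum.mono_neutral_left) (auto simp: supp_iff)

lemma E_add: "E (P + Q) = E P + E Q"
proof -
  let ?A = "supp P \<union> supp Q"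
  have "E (P + Q) = (\<Sum>e\<in>?A. tau (coef (P + Q) e) \<cdot> mm e)"
    using supp_add by (intro E_superset) auto
  also have "\<dots> = (\<Sum>e\<in>?A. tau (coef P e) \<cdot> mm e) + (\<Sum>e\<in>?A. tau (coef Q e) \<cdot> mm e)"
    by (simp add: tau_add sm_add_left sum.distrib)
  also have "\<dots> = E P + E Q"
    using E_superset[of ?A P] E_superset[of ?A Q] by simp
  finally show ?thesis .
qed

lemma E_sm: "E (c \<cdot> P) = tau c \<cdot> E P"
proof -
  have "E (c \<cdot> P) = (\<Sum>e\<in>supp P. tau (coef (c \<cdot> P) e) \<cdot> mm e)"
    using supp_sm by (intro E_superset) auto
  then show ?thesis by (simp add: E_def tau_mult sm_sum_right)
qed

lemma E_0 [simp]: "E 0 = 0"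
  using E_add[of 0 0] by simp

lemma E_sum: "E (\<Sum>a\<in>A. f a) = (\<Sum>a\<in>A. E (f a))"
  by (induction A rule: infinite_finite_induct) (simp_all add: E_add)

lemma E_Xe: "E (Xe e) = mm e"
proof -
  have "supp (Xe e) = {e}" by (auto simp: supp_iff coef_mon dest: supp_Xe)
  then show ?thesis by (simp add: E_def coef_mon)
qed

lemma E_mult:
  assumes "polyn P" "polyn Q"
  shows "E (P * Q) = E P * E Q"
proof -
  have "P * Q = (\<Sum>e\<in>supp P. coef P e \<cdot> Xe e) * (\<Sum>f\<in>supp Q. coef Q f \<cdot> Xe f)"
    using qt_expand[of P] qt_expand[of Q] by simp
  also have "\<dots> = (\<Sum>e\<in>supp P. \<Sum>f\<in>supp Q. (coef P e * coef Q f * tq (lam e f)) \<cdot> Xe (e + f))"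
    by (simp add: sum_product Xe_mult ac_simps)
  finally have "E (P * Q) = (\<Sum>e\<in>supp P. \<Sum>f\<in>supp Q. (tau (coef P e) * tau (coef Q f)) \<cdot> tq (eps * lam e f) \<cdot> mm (e + f))"
    by (simp add: E_sum E_sm E_Xe tau_mult tau_tq)
  also have "\<dots> = (\<Sum>e\<in>supp P. \<Sum>f\<in>supp Q. (tau (coef P e) * tau (coef Q f)) \<cdot> (mm e * mm f))"
    using assms by (intro sum.cong refl) (simp add: mm_mult polyn_def del: sm_sm)
  also have "\<dots> = E P * E Q"
    by (simp add: E_def sum_product mult.commute)
  finally show ?thesis .
qed

lemma E_diag_nonzero [simp]: "E (diag n) \<noteq> 0"
  by (simp add: diag_def E_Xe mm_def)

lemma E_eq_0: "polyn P \<Longrightarrow> E P = 0 \<Longrightarrow> P = 0"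
proof -
  assume P: "polyn P" "E P = 0"
  let ?c = "\<lambda>e. tau (coef P e) * tq (- eps * fst e * snd e)"
  have "(\<Sum>e\<in>supp P. ?c e \<cdot> (xs 1 ^ nat (fst e) * xs 2 ^ nat (snd e))) = 0"
    using P(2) by (simp add: E_def mm_def)
  then have "?c e = 0" if "e \<in> supp P" for e
    using that P(1) xs_indep[of "supp P" ?c e] by (simp add: polyn_def)
  then have "supp P = {}" by (force simp: supp_iff)
  then show "P = 0" by (simp add: supp_empty)
qed

text \<open>\<open>rel Z Y\<close> says that the Laurent polynomial \<open>Z\<close> turns into \<open>Y\<close> when \<open>xs 1, xs 2\<close> are
  substituted for \<open>X_1, X_2\<close>, with the denominators cleared.\<close>

definition reln :: "nat \<Rightarrow> qt \<Rightarrow> qt \<Rightarrow> bool" where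
  "reln n Z Y \<longleftrightarrow> bounded n Z \<and> Y * E (diag n) = E (Z * diag n)"

definition rel :: "qt \<Rightarrow> qt \<Rightarrow> bool" where
  "rel Z Y \<longleftrightarrow> (\<exists>n. reln n Z Y)"

lemma reln_mono:
  assumes "reln n Z Y" "n \<le> n'"
  shows "reln n' Z Y"
proof -
  have d: "diag n' = diag n * diag (n' - n)" using assms by (simp flip: diag_add)
  have "Y * E (diag n') = Y * E (diag n) * E (diag (n' - n))"
    by (simp add: d E_mult polyn_diag mult.assoc)
  also have "\<dots> = E (Z * diag n) * E (diag (n' - n))"
    using assms by (simp add: reln_def)
  also have "\<dots> = E (Z * diag n')"
    using assms by (simp add: d E_mult polyn_diag bounded_polyn reln_def flip: mult.assoc)
  finally show ?thesis using assms bounded_mono by (auto simp: reln_def)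
qed

lemma rel_common:
  assumes "rel Z Y" "rel Z' Y'"
  obtains n where "reln n Z Y" "reln n Z' Y'"
  using assms by (metis max.cobounded1 max.cobounded2 reln_mono rel_def)

lemma rel_add: "rel Z Y \<Longrightarrow> rel Z' Y' \<Longrightarrow> rel (Z + Z') (Y + Y')"
proof -
  assume "rel Z Y" "rel Z' Y'"
  then obtain n where "reln n Z Y" "reln n Z' Y'" by (rule rel_common)
  then have "reln n (Z + Z') (Y + Y')"
    by (simp add: reln_def bounded_add distrib_right E_add)
  then show ?thesis by (auto simp: rel_def)
qed

lemma rel_sm: "rel Z Y \<Longrightarrow> rel (c \<cdot> Z) (tau c \<cdot> Y)"
  unfolding rel_def reln_def by (metis bounded_sm E_sm sm_mult_left)

lemma rel_diff: "rel Z Y \<Longrightarrow> rel Z' Y' \<Longrightarrow> rel (Z - Z') (Y - Y')"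
  using rel_add[of Z Y "(-1) \<cdot> Z'" "(-1) \<cdot> Y'"] rel_sm[of Z' Y' "-1"]
  by (simp add: sm_minus_left tau_minus)

text \<open>The denominator of \<open>Y\<close> stands to the right of \<open>Y'\<close>. First
  \<open>Y'\<close> absorbs one copy of it and becomes the image of the polynomial \<open>P\<close>;
  conjugation then moves the other copy left past \<open>P\<close>, next to
  \<open>Y\<close>.\<close>

lemma rel_mult:
  assumes "rel Z Y" "rel Z' Y'"
  shows "rel (Z * Z') (Y * Y')"
proof -
  obtain n where n: "reln n Z Y" "reln n Z' Y'" using assms by (rule rel_common)
  define P where "P = Z' * diag n"
  have P: "polyn P" "polyn (Z * diag n)" using n by (simp_all add: P_def reln_def bounded_polyn)
  have "Y * Y' * E (diag (n + n)) = Y * (Y' * E (diag n)) * E (diag n)"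
    by (simp add: diag_add E_mult polyn_diag mult.assoc)
  also have "\<dots> = Y * E (P * diag n)"
    using n P by (simp add: reln_def P_def[symmetric] E_mult polyn_diag mult.assoc)
  also have "\<dots> = Y * E (diag n) * E (conj_diag n P)"
    using P by (simp add: E_mult polyn_diag polyn_conj mult.assoc flip: diag_conj)
  also have "\<dots> = E (Z * diag n * conj_diag n P)"
    using n P by (simp add: reln_def E_mult[of "Z * diag n"] polyn_conj)
  also have "Z * diag n * conj_diag n P = Z * Z' * diag (n + n)"
    by (simp add: mult.assoc diag_conj) (simp add: P_def diag_add mult.assoc)
  finally show ?thesis
    using n bounded_mult[of n Z n Z'] by (auto simp: rel_def reln_def intro!: exI[of _ "n + n"])
qed

text \<open>Both quotients \<open>B\<close> and \<open>B'\<close> are already torus elements, so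
  clearing denominators as in \<open>rel_mult\<close> and cancelling \<open>A'\<close> is enough.
  Through this lemma the correspondence passes along exchange relations.\<close>

lemma rel_div:
  assumes "rel A A'" "rel (A * B) (A' * B')" "A' \<noteq> 0"
  shows "rel B B'"
proof -
  obtain k where k: "reln k A A'" "reln k (A * B) (A' * B')" using assms(1,2) by (rule rel_common)
  obtain l where l: "bounded l B" using bounded_exists by blast
  define n where "n = max k l"
  have n: "reln n A A'" "reln (n + n) (A * B) (A' * B')" "bounded n B"
    using reln_mono[OF k(1), of n] reln_mono[OF k(2), of "n + n"] bounded_mono[OF l, of n]
    by (simp_all add: n_def)
  define P where "P = B * diag n"
  have P: "polyn P" "polyn (A * diag n)" using n by (simp_all add: P_def reln_def bounded_polyn)
  have "A' * B' * E (diag n) * E (diag n) = E (A * B * diag (n + n))"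
    using n(2) by (simp add: reln_def diag_add E_mult polyn_diag mult.assoc)
  also have "A * B * diag (n + n) = A * diag n * conj_diag n P"
    by (simp add: mult.assoc diag_conj) (simp add: P_def diag_add mult.assoc)
  also have "E \<dots> = A' * E (diag n) * E (conj_diag n P)"
    using n P by (simp add: reln_def E_mult[of "A * diag n"] polyn_conj)
  also have "\<dots> = A' * E (P * diag n)"
    using P by (simp add: E_mult polyn_diag polyn_conj mult.assoc flip: diag_conj)
  also have "\<dots> = A' * E P * E (diag n)"
    using P by (simp add: E_mult polyn_diag mult.assoc)
  finally have "(A' * (B' * E (diag n))) * E (diag n) = (A' * E P) * E (diag n)"
    by (simp only: mult.assoc)
  then have "A' * (B' * E (diag n)) = A' * E P"
    by (simp only: mult_right_cancel[OF E_diag_nonzero])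
  then have "B' * E (diag n) = E P"
    by (simp only: mult_left_cancel[OF assms(3)])
  then show ?thesis using n(3) by (auto simp: rel_def reln_def P_def)
qed

lemma rel_E: "polyn P \<Longrightarrow> rel P (E P)"
proof -
  assume "polyn P"
  moreover have "E 1 = 1" using E_Xe[of 0] by (simp add: one_mon[symmetric] mm_def)
  ultimately show ?thesis
    by (auto simp: rel_def reln_def bounded_def polyn_def diag_0 intro!: exI[of _ 0])
qed

lemma rel_Xe: "0 \<le> fst e \<Longrightarrow> 0 \<le> snd e \<Longrightarrow> rel (Xe e) (mm e)"
  using rel_E[of "Xe e"] by (auto simp: E_Xe polyn_def dest: supp_Xe)

lemma rel_1: "rel 1 1"
  using rel_Xe[of 0] by (simp add: one_mon[symmetric] mm_def)

lemma rel_power: "rel Z Y \<Longrightarrow> rel (Z ^ n) (Y ^ n)"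
  by (induction n) (simp_all add: rel_1 rel_mult)

lemma rel_sum: "(\<And>a. a \<in> A \<Longrightarrow> rel (f a) (g a)) \<Longrightarrow> rel (sum f A) (sum g A)"
proof (induction A rule: infinite_finite_induct)
  case (insert a A)
  then show ?case by (simp add: rel_add)
qed (use rel_sm[OF rel_1, of 0] in auto)

text \<open>Algebraic independence of \<open>xs 1, xs 2\<close> makes \<open>E\<close> injective on
  polynomial elements, so an expansion is unique.\<close>

lemma rel_functional:
  assumes "rel Z Y" "rel Z' Y"
  shows "Z = Z'"
proof -
  have "rel (Z - Z') 0" using rel_diff[OF assms] by simp
  then obtain n where "bounded n (Z - Z')" "E ((Z - Z') * diag n) = 0"
    by (auto simp: rel_def reln_def)
  then have "(Z - Z') * diag n = 0" using E_eq_0 bounded_polyn by blast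
  then show ?thesis by simp
qed

lemma rel_injective:
  assumes "rel Z Y" "rel Z Y'"
  shows "Y = Y'"
proof -
  obtain n where "reln n Z Y" "reln n Z Y'" using assms by (rule rel_common)
  then have "Y * E (diag n) = Y' * E (diag n)" by (simp add: reln_def)
  then show ?thesis by simp
qed

text \<open>Both sequences obey the same exchange relations once \<open>tau\<close> is applied to
  the coefficients. Since \<open>rel_div\<close> cancels on the left, the downward step needs the
  relations with reversed factors.\<close>

lemma rel_Xq: "rel (Xq k) (xs k)"
proof -
  have "rel (Xq k) (xs k) \<and> rel (Xq (k + 1)) (xs (k + 1))"
  proof (induction k rule: int_induct[where k = 1])
    case base
    show ?case using rel_Xe[of "(1, 0)"] rel_Xe[of "(0, 1)"]
      by (simp add: Xq_1 Xq_2 mm_def)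
  next
    case (step1 k)
    have "rel (Xq k * Xq (k + 1 + 1)) (xs k * xs (k + 1 + 1))"
    proof (cases "even (k + 1)")
      case True
      have "rel (tq 4 \<cdot> Xq (k + 1) ^ 4 + 1) (tau (tq 4) \<cdot> xs (k + 1) ^ 4 + 1)"
        using step1 by (intro rel_add rel_sm rel_power rel_1) auto
      then show ?thesis
        using Xq_exch_even[OF True] xs_exch_even[OF True] by (simp add: tau_tq mult.commute)
    next
      case False
      have "rel (tq 1 \<cdot> Xq (k + 1) + 1) (tau (tq 1) \<cdot> xs (k + 1) + 1)"
        using step1 by (intro rel_add rel_sm rel_power rel_1) auto
      then show ?thesis
        using Xq_exch_odd[OF False] xs_exch_odd[OF False] by (simp add: tau_tq)
    qed
    then show ?case using rel_div step1 xs_nonzero by blast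
  next
    case (step2 k)
    have "rel (Xq (k + 1) * Xq (k - 1)) (xs (k + 1) * xs (k - 1))"
    proof (cases "even k")
      case True
      have "rel (tq (-4) \<cdot> Xq k ^ 4 + 1) (tau (tq (-4)) \<cdot> xs k ^ 4 + 1)"
        using step2 by (intro rel_add rel_sm rel_power rel_1) auto
      then show ?thesis
        using Xq_exch_even'[OF True] xs_exch_even'[OF True] by (simp add: tau_tq mult.commute)
    next
      case False
      have "rel (tq (-1) \<cdot> Xq k + 1) (tau (tq (-1)) \<cdot> xs k + 1)"
        using step2 by (intro rel_add rel_sm rel_power rel_1) auto
      then show ?thesis
        using Xq_exch_odd'[OF False] xs_exch_odd'[OF False] by (simp add: tau_tq)
    qed
    then have "rel (Xq (k - 1)) (xs (k - 1))" using rel_div step2 xs_nonzero by blast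
    then show ?case using step2 by simp
  qed
  then show ?thesis by simp
qed

text \<open>The quadratic expression in the variables with indices 0, 2, 4 reads alike in both
  sequences. Hence \<open>X_delta\<close>, and all \<open>F_n(X_delta)\<close>, are fixed by the
  reindexing.\<close>

lemma rel_Xdelta_qt: "rel Xdelta_qt Xdelta_qt"
proof -
  have "Xdelta_qt = tq 1 \<cdot> (Xq 0 * Xq 4) - tq 3 \<cdot> (Xq 2 * Xq 2)"
    using Xdelta_qt_eq[of 1] by (simp add: Xq_def)
  moreover have "rel (tq 1 \<cdot> (Xq 0 * Xq 4) - tq 3 \<cdot> (Xq 2 * Xq 2))
      (tau (tq 1) \<cdot> (xs 0 * xs 4) - tau (tq 3) \<cdot> (xs 2 * xs 2))"
    by (intro rel_diff rel_sm rel_mult rel_Xq)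
  ultimately show ?thesis using Xdelta_qt_xs by (simp add: tau_tq mult.commute)
qed

lemma rel_cheb_delta: "rel (cheb_delta n) (cheb_delta n)"
proof (induction n rule: cheb_delta.induct)
  case 3
  have "tau 2 = 2" using tau_add[of 1 1] by simp
  then show ?case using rel_diff[OF rel_mult[OF rel_Xdelta_qt rel_Xdelta_qt] rel_sm[OF rel_1, of 2]] by simp
qed (simp_all add: rel_1 rel_Xdelta_qt rel_diff rel_mult)

text \<open>The exponent \<open>e\<close> separates \<open>b0\<close> from the rest of
  \<open>S\<close>. By semilinearity the expansion carries \<open>tau (c b)\<close> in place of
  \<open>c b\<close>, which is harmless as \<open>tau\<close> is an involution preserving
  nonnegativity.\<close>

lemma coefficient_nonneg:
  assumes "finite S" "\<And>b. b \<in> S \<Longrightarrow> rel (\<phi> b) b" "\<And>Z. rel Z (\<Sum>b\<in>S. c b \<cdot> b) \<Longrightarrow> nonneg_coeffs Z"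
    and "b0 \<in> S" "coef (\<phi> b0) e = 1" "\<And>b. b \<in> S \<Longrightarrow> b \<noteq> b0 \<Longrightarrow> coef (\<phi> b) e = 0"
  shows "lpoly_nonneg (c b0)"
proof -
  define Z where "Z = (\<Sum>b\<in>S. tau (c b) \<cdot> \<phi> b)"
  have "rel Z (\<Sum>b\<in>S. tau (tau (c b)) \<cdot> b)"
    unfolding Z_def by (intro rel_sum rel_sm assms)
  then have "nonneg_coeffs Z" using assms(3) by (simp add: tau_tau)
  moreover have "coef Z e = (\<Sum>b\<in>S. if b = b0 then tau (c b0) else 0)"
    unfolding Z_def coef_sum by (rule sum.cong) (use assms in auto)
  then have "coef Z e = tau (c b0)" using assms by simp
  ultimately have "lpoly_nonneg (tau (c b0))" unfolding nonneg_coeffs_def by metis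
  then show ?thesis using tau_nonneg[of "tau (c b0)"] by (simp add: tau_tau)
qed

text \<open>In the expansion the cluster variables become monomials, which are units, so the cleared
  denominators can be divided out again. The exponents \<open>u, v\<close> stay open because a
  reflection interchanges the two variables.\<close>

lemma nonneg_coeffs_of_laurent:
  assumes "rel Z Y" "rel (Xe u) U" "rel (Xe v) V" "finite K" "\<And>e. e \<in> K \<Longrightarrow> lpoly_nonneg (c e)"
    and "U ^ N * Y * V ^ N = (\<Sum>e\<in>K. c e \<cdot> (U ^ f e * V ^ g e))"
  shows "nonneg_coeffs Z"
proof -
  define W where "W = (\<Sum>e\<in>K. tau (c e) \<cdot> (Xe u ^ f e * Xe v ^ g e))"
  have "rel W (\<Sum>e\<in>K. tau (tau (c e)) \<cdot> (U ^ f e * V ^ g e))"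
    unfolding W_def by (intro rel_sum rel_sm rel_mult rel_power assms)
  moreover have "rel (Xe u ^ N * Z * Xe v ^ N) (U ^ N * Y * V ^ N)"
    by (intro rel_mult rel_power assms)
  ultimately have "Xe u ^ N * Z * Xe v ^ N = W"
    using assms(6) rel_functional by (simp add: tau_tau)
  then have "Xe (- u) ^ N * W * Xe (- v) ^ N = (Xe (- u) ^ N * Xe u ^ N) * Z * (Xe v ^ N * Xe (- v) ^ N)"
    by (auto simp: mult.assoc)
  then have "Z = Xe (- u) ^ N * W * Xe (- v) ^ N"
    by (simp add: Xe_minus_power)
  moreover have "nonneg_coeffs W"
    unfolding W_def
    by (intro nonneg_coeffs_sum nonneg_coeffs_sm tau_nonneg assms nonneg_coeffs_Xe_power_mult)
       (use nonneg_coeffs_mult_Xe_power[OF nonneg_coeffs_1] in auto)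
  ultimately show ?thesis by (simp add: nonneg_coeffs_Xe_power_mult nonneg_coeffs_mult_Xe_power)
qed

end

section \<open>Leading terms and positivity\<close>

lemma cluster_mon_cluster_pt: "pointed (cluster_pt m a b) (cluster_mon m a b)"
  by (simp add: cluster_pt_def cluster_mon_pointed)

lemma cluster_pt_inj_fixed:
  assumes "cluster_pt m a b = cluster_pt m a' b'"
  shows "a = a' \<and> b = b'"
proof -
  consider "m = 1" | "m \<ge> 2" | "m \<le> 0" by linarith
  then show ?thesis
  proof cases
    case 1
    then show ?thesis using assms by (simp add: cluster_pt_mid)
  next
    case 2
    have D: "int a * parity_wt m + int b * parity_wt (m + 1) = int a' * parity_wt m + int b' * parity_wt (m + 1)"
      using cluster_pt_right(1)[OF 2, of a b] cluster_pt_right(1)[OF 2, of a' b'] assms by simp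
    moreover have "int b * parity_wt (m + 1) = int b' * parity_wt (m + 1)"
      using cluster_pt_right(2)[OF 2, of a b] cluster_pt_right(2)[OF 2, of a' b'] assms unfolding D by simp
    ultimately show ?thesis by simp
  next
    case 3
    have D: "int a * parity_wt m + int b * parity_wt (m + 1) = int a' * parity_wt m + int b' * parity_wt (m + 1)"
      using cluster_pt_left(1)[OF 3, of a b] cluster_pt_left(1)[OF 3, of a' b'] assms by simp
    moreover have "int b * parity_wt (m + 1) = int b' * parity_wt (m + 1)"
      using cluster_pt_left(2)[OF 3, of a b] cluster_pt_left(2)[OF 3, of a' b'] assms unfolding D by simp
    ultimately show ?thesis by simp
  qed
qed

text \<open>Up to powers of \<open>t\<close> the monomials of one cluster are distinct elements of
  \<open>basis_set\<close>, told apart by their corners. This provides the assumption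
  \<open>xs_indep\<close> for shifts and reflections.\<close>

lemma cluster_independent:
  assumes S: "finite S" "\<And>e. e \<in> S \<Longrightarrow> 0 \<le> fst e \<and> 0 \<le> snd e"
    and sum: "(\<Sum>e\<in>S. c e \<cdot> (Xq m ^ nat (fst e) * Xq (m + 1) ^ nat (snd e))) = 0" and "e \<in> S"
  shows "c e = 0"
proof -
  define f where "f e = cluster_mon m (nat (fst e)) (nat (snd e))" for e
  define d where "d e = c e * tq (int (nat (fst e)) * int (nat (snd e)))" for e
  have f: "Xq m ^ nat (fst e) * Xq (m + 1) ^ nat (snd e) =
      tq (int (nat (fst e)) * int (nat (snd e))) \<cdot> f e" for e
    by (simp add: f_def cluster_mon_def flip: tq_add)
  have "inj_on f S"
  proof (rule inj_onI)
    fix e e' assume e: "e \<in> S" "e' \<in> S" "f e = f e'"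
    then have "cluster_pt m (nat (fst e)) (nat (snd e)) = cluster_pt m (nat (fst e')) (nat (snd e'))"
      unfolding f_def by (metis cluster_mon_cluster_pt pointed_unique)
    then show "e = e'" using cluster_pt_inj_fixed S(2)[OF e(1)] S(2)[OF e(2)]
      by (metis eq_nat_nat_iff prod_eqI)
  qed
  then obtain h where h: "\<And>e. e \<in> S \<Longrightarrow> h (f e) = e" by (metis inv_into_f_f)
  have "(\<Sum>e\<in>S. d e \<cdot> f e) = 0" using sum by (simp add: f d_def)
  then have "(\<Sum>v\<in>f ` S. d (h v) \<cdot> v) = 0"
    using \<open>inj_on f S\<close> h by (simp add: sum.reindex)
  moreover have "f ` S \<subseteq> basis_set" by (auto simp: f_def basis_set_def)
  ultimately have "d (h (f e)) = 0"
    using Q.independentD[OF basis_set_independent, of "f ` S" "\<lambda>v. d (h v)" "f e"] S(1) \<open>e \<in> S\<close> by blast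
  then show ?thesis using h[OF \<open>e \<in> S\<close>] by (simp add: d_def)
qed

lemma shift_reindexed:
  assumes "odd m"
  shows "reindexed (\<lambda>k. Xq (k + m - 1)) 1 id"
proof
  fix k :: int
  show "Xq (k + m - 1) * Xq (k + 1 + m - 1) = tq (2 * 1) \<cdot> (Xq (k + 1 + m - 1) * Xq (k + m - 1))"
    using Xq_comm[of "k + m - 1"] by (simp add: algebra_simps)
  have ind: "k - 1 + m - 1 = (k + m - 1) - 1" "k + 1 + m - 1 = (k + m - 1) + 1" by simp_all
  {
    assume "odd k"
    then have k: "odd (k + m - 1)" using assms by simp
    show "Xq (k - 1 + m - 1) * Xq (k + 1 + m - 1) = tq 1 \<cdot> Xq (k + m - 1) + 1"
      unfolding ind by (rule Xq_exch_odd[OF k])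
    show "Xq (k + 1 + m - 1) * Xq (k - 1 + m - 1) = tq (- 1) \<cdot> Xq (k + m - 1) + 1"
      unfolding ind by (rule Xq_exch_odd'[OF k])
  next
    assume "even k"
    then have k: "even (k + m - 1)" using assms by simp
    show "Xq (k - 1 + m - 1) * Xq (k + 1 + m - 1) = tq (4 * 1) \<cdot> Xq (k + m - 1) ^ 4 + 1"
      unfolding ind using Xq_exch_even[OF k] by simp
    show "Xq (k + 1 + m - 1) * Xq (k - 1 + m - 1) = tq (- 4 * 1) \<cdot> Xq (k + m - 1) ^ 4 + 1"
      unfolding ind using Xq_exch_even'[OF k] by simp
  }
next
  obtain j where j: "m + 1 = 2 * j" using assms by (metis evenE odd_even_add odd_one)
  then have "m = 2 * j - 1" by simp
  then have "Xq (0 + m - 1) = ev (j - 1)" "Xq (4 + m - 1) = ev (j + 1)" "Xq (2 + m - 1) = ev j"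
    by (simp_all add: Xq_def add.commute)
  then show "Xdelta_qt = tq 1 \<cdot> (Xq (0 + m - 1) * Xq (4 + m - 1)) - tq (3 * 1) \<cdot> (Xq (2 + m - 1) * Xq (2 + m - 1))"
    using Xdelta_qt_eq[of j] by simp
next
  fix S c e
  assume "finite S" "\<And>e. e \<in> S \<Longrightarrow> 0 \<le> fst e \<and> 0 \<le> snd e" "e \<in> S"
    "(\<Sum>e\<in>S. c e \<cdot> (Xq (1 + m - 1) ^ nat (fst e) * Xq (2 + m - 1) ^ nat (snd e))) = 0"
  moreover have "2 + m - 1 = m + 1" "1 + m - 1 = m" by simp_all
  ultimately show "c e = 0"
    using cluster_independent[of S c m e] by metis
qed simp_all

definition tbar :: "lpoly \<Rightarrow> lpoly" where
  "tbar p = Poly_Mapping.map_key uminus p"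

lemma inj_uminus_int: "inj (uminus :: int \<Rightarrow> int)"
  by (simp add: inj_def)

lemma tbar_single: "tbar (Poly_Mapping.single i a) = Poly_Mapping.single (- i) a"
  using map_key_single[OF inj_uminus_int, of "- i" a] by (simp add: tbar_def)

lemma tbar_add: "tbar (p + q) = tbar p + tbar q"
  by (simp add: tbar_def map_key_plus inj_uminus_int)

lemma tbar_mult: "tbar (p * q) = tbar p * tbar q"
proof (induction p rule: poly_mapping_single_induct)
  case (single a b)
  show ?case
    by (induction q rule: poly_mapping_single_induct)
       (simp_all add: mult_single tbar_single tbar_add distrib_left)
qed (simp add: tbar_add distrib_right)

lemma tbar_tbar: "tbar (tbar p) = p"
  by (induction p rule: poly_mapping_single_induct) (simp_all add: tbar_single tbar_add)

lemma tbar_nonneg: "lpoly_nonneg p \<Longrightarrow> lpoly_nonneg (tbar p)"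
  by (simp add: lpoly_nonneg_def tbar_def map_key.rep_eq inj_uminus_int)

lemma Xq_comm': "Xq k * Xq (k - 1) = tq (-2) \<cdot> (Xq (k - 1) * Xq k)"
  using Xq_comm[of "k - 1"] by (simp flip: tq_add)

text \<open>For even \<open>m\<close> the map \<open>k -> m + 2 - k\<close> keeps parity and sends
  1, 2 to \<open>m + 1\<close>, \<open>m\<close>. It reverses the factors of each exchange relation,
  and the reversed relations are those with \<open>t\<close> inverted.\<close>

lemma reflect_reindexed:
  assumes "even m"
  shows "reindexed (\<lambda>k. Xq (m + 2 - k)) (-1) tbar"
proof
  fix k :: int
  have ind: "m + 2 - (k - 1) = (m + 2 - k) + 1" "m + 2 - (k + 1) = (m + 2 - k) - 1" by simp_all
  show "Xq (m + 2 - k) * Xq (m + 2 - (k + 1)) = tq (2 * - 1) \<cdot> (Xq (m + 2 - (k + 1)) * Xq (m + 2 - k))"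
    unfolding ind using Xq_comm'[of "m + 2 - k"] by simp
  {
    assume "odd k"
    then have k: "odd (m + 2 - k)" using assms by simp
    show "Xq (m + 2 - (k - 1)) * Xq (m + 2 - (k + 1)) = tq (- 1) \<cdot> Xq (m + 2 - k) + 1"
      unfolding ind by (rule Xq_exch_odd'[OF k])
    show "Xq (m + 2 - (k + 1)) * Xq (m + 2 - (k - 1)) = tq (- (- 1)) \<cdot> Xq (m + 2 - k) + 1"
      unfolding ind using Xq_exch_odd[OF k] by simp
  next
    assume "even k"
    then have k: "even (m + 2 - k)" using assms by simp
    show "Xq (m + 2 - (k - 1)) * Xq (m + 2 - (k + 1)) = tq (4 * - 1) \<cdot> Xq (m + 2 - k) ^ 4 + 1"
      unfolding ind using Xq_exch_even'[OF k] by simp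
    show "Xq (m + 2 - (k + 1)) * Xq (m + 2 - (k - 1)) = tq (- 4 * - 1) \<cdot> Xq (m + 2 - k) ^ 4 + 1"
      unfolding ind using Xq_exch_even[OF k] by simp
  }
next
  obtain j where j: "m = 2 * j" using assms by (elim evenE)
  then have "Xq (m + 2 - 0) = ev (j + 1)" "Xq (m + 2 - 4) = ev (j - 1)" "Xq (m + 2 - 2) = ev j"
    by (simp_all add: Xq_def)
  then show "Xdelta_qt = tq (- 1) \<cdot> (Xq (m + 2 - 0) * Xq (m + 2 - 4)) - tq (3 * - 1) \<cdot> (Xq (m + 2 - 2) * Xq (m + 2 - 2))"
    using Xdelta_qt_eq'[of j] by simp
next
  fix S :: "(int \<times> int) set" and c e
  assume S: "finite S" "\<And>e. e \<in> S \<Longrightarrow> 0 \<le> fst e \<and> 0 \<le> snd e" and e: "e \<in> S"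
    and sum: "(\<Sum>e\<in>S. c e \<cdot> (Xq (m + 2 - 1) ^ nat (fst e) * Xq (m + 2 - 2) ^ nat (snd e))) = 0"
  define s where "s e = tq (- 2 * int (nat (fst e)) * int (nat (snd e)))" for e :: "int \<times> int"
  have swap: "Xq (m + 2 - 1) ^ a * Xq (m + 2 - 2) ^ b =
      tq (- 2 * int a * int b) \<cdot> (Xq m ^ b * Xq (m + 1) ^ a)" for a b
    using qcomm_power[OF Xq_comm, of m b a] by (simp add: ac_simps flip: tq_add)
  have "(\<Sum>e\<in>S. (c e * s e) \<cdot> (Xq m ^ nat (snd e) * Xq (m + 1) ^ nat (fst e))) = 0"
    using sum unfolding swap by (simp add: s_def)
  moreover have "inj_on prod.swap S" by simp
  ultimately have "(\<Sum>e\<in>prod.swap ` S. (c (prod.swap e) * s (prod.swap e)) \<cdot>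
      (Xq m ^ nat (fst e) * Xq (m + 1) ^ nat (snd e))) = 0"
    by (simp add: sum.reindex)
  moreover have "0 \<le> fst e \<and> 0 \<le> snd e" if "e \<in> prod.swap ` S" for e
    using that S(2) by force
  ultimately have "c (prod.swap (prod.swap e)) * s (prod.swap (prod.swap e)) = 0"
    using cluster_independent[of "prod.swap ` S" "\<lambda>e. c (prod.swap e) * s (prod.swap e)" m "prod.swap e"]
      S(1) e by blast
  then show "c e = 0" by (simp add: s_def)
qed (simp_all add: tbar_add tbar_mult tbar_tbar tbar_nonneg tq_def tbar_single)

section \<open>Weights for which a distant cluster has negative degree\<close>

lemma deg_le_power: "deg_le g x n \<Longrightarrow> deg_le g (x ^ k) (int k * n)"
proof (induction k)
  case 0
  then show ?case using deg_eq_1 by (simp add: deg_eq_def)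
next
  case (Suc k)
  then show ?case using deg_le_mult[of g x n "x ^ k" "int k * n"] by (simp add: algebra_simps)
qed

lemma deg_le_cluster_mon: "deg_le g (Xq m) r \<Longrightarrow> deg_le g (Xq (m + 1)) s \<Longrightarrow> deg_le g (cluster_mon m a b) (int a * r + int b * s)"
  unfolding cluster_mon_def by (intro deg_le_sm deg_le_mult deg_le_power)

lemma deg_eq_exchange_pos: "deg_eq g x n \<Longrightarrow> n > 0 \<Longrightarrow> deg_eq g (tq i \<cdot> x + 1) n"
  using deg_eq_add[OF deg_eq_sm, of g x n 1 0] deg_eq_1[of g] by (simp add: deg_eq_def)

lemma deg_eq_exchange_neg: "deg_eq g x n \<Longrightarrow> n < 0 \<Longrightarrow> deg_eq g (tq i \<cdot> x + 1) 0"
  using deg_eq_add[OF deg_eq_1, of g "tq i \<cdot> x" n] deg_eq_sm[of g x n i] by (simp add: deg_eq_def add.commute)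

text \<open>The degrees of the cluster variables obey the tropical exchange relations. As long as they are
  positive these are linear, with solutions \<open>parity_wt j * u j\<close> for \<open>u\<close> affine.\<close>

lemma deg_right:
  assumes "m \<ge> 3"
  obtains g where "fst g > 0" "snd g > 0" "deg_le g (Xq m) (-1)" "deg_le g (Xq (m + 1)) (-1)"
proof -
  \<comment> \<open>The decreasing affine function with \<open>u (m - 1) = 1\<close> and
    \<open>u m = -1\<close>: degrees stay positive up to index \<open>m - 1\<close> and change sign
    exactly at \<open>m\<close>. The weight \<open>g\<close> consists of the prescribed degrees of
    \<open>X_1\<close> and \<open>X_2\<close>.\<close>
  define u where "u x = 2 * m - 1 - 2 * x" for x
  define g where "g = (2 * u 1, u 2)"
  have up: "int n + 2 \<le> m \<longrightarrow> deg_eq g (Xq (int n + 1)) (parity_wt (int n + 1) * u (int n + 1)) \<and>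
      deg_eq g (Xq (int n + 2)) (parity_wt (int n + 2) * u (int n + 2))" for n
  proof (induction n)
    case 0
    then show ?case
      using deg_eq_Xe[of g "(1, 0)"] deg_eq_Xe[of g "(0, 1)"] by (simp add: Xq_1 Xq_2 wt_def g_def parity_wt_def)
  next
    case (Suc n)
    define j where "j = int n + 2"
    show ?case
    proof
      assume "int (Suc n) + 2 \<le> m"
      then have j: "j + 1 \<le> m" by (simp add: j_def)
      then have IH: "deg_eq g (Xq (j - 1)) (parity_wt (j - 1) * u (j - 1))" "deg_eq g (Xq j) (parity_wt j * u j)"
        using Suc by (simp_all add: j_def add.commute)
      have pos: "parity_wt j * u j > 0" using j by (simp add: u_def)
      have "deg_eq g (Xq (j + 1)) (parity_wt (j + 1) * u (j + 1))"
      proof (cases "even j")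
        case True
        have "deg_eq g (Xq (j - 1) * Xq (j + 1)) (4 * (parity_wt j * u j))"
          unfolding Xq_exch_even[OF True]
          using deg_eq_exchange_pos[OF deg_eq_power[OF IH(2), of 4]] pos by simp
        from deg_eq_div_left[OF IH(1) this] show ?thesis
          using True by (simp add: parity_wt_def u_def algebra_simps)
      next
        case False
        have "deg_eq g (Xq (j - 1) * Xq (j + 1)) (parity_wt j * u j)"
          unfolding Xq_exch_odd[OF False] using deg_eq_exchange_pos[OF IH(2)] pos by simp
        from deg_eq_div_left[OF IH(1) this] show ?thesis
          using False by (simp add: parity_wt_def u_def algebra_simps)
      qed
      then show "deg_eq g (Xq (int (Suc n) + 1)) (parity_wt (int (Suc n) + 1) * u (int (Suc n) + 1)) \<and>
          deg_eq g (Xq (int (Suc n) + 2)) (parity_wt (int (Suc n) + 2) * u (int (Suc n) + 2))"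
        using IH(2) by (simp add: j_def algebra_simps)
    qed
  qed
  have ind: "int (nat (m - 2)) + 2 = m" "int (nat (m - 2)) + 1 = m - 1" using assms by simp_all
  have v: "deg_eq g (Xq (m - 1)) (parity_wt (m - 1) * u (m - 1))" "deg_eq g (Xq m) (parity_wt m * u m)"
    using up[of "nat (m - 2)"] unfolding ind by simp_all
  then have v': "deg_eq g (Xq (m - 1)) (parity_wt (m - 1))" "deg_eq g (Xq m) (- parity_wt m)"
    by (simp_all add: u_def)
  \<comment> \<open>\<open>Xq m\<close> has negative degree, so the constant now dominates the
    exchange relation and \<open>Xq (m + 1)\<close> gets the degree opposite to that of
    \<open>Xq (m - 1)\<close>.\<close>
  have "deg_eq g (Xq (m - 1) * Xq (m + 1)) 0"
  proof (cases "even m")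
    case True
    then show ?thesis
      unfolding Xq_exch_even[OF True] using deg_eq_exchange_neg[OF deg_eq_power[OF v'(2), of 4]] by simp
  next
    case False
    then show ?thesis
      unfolding Xq_exch_odd[OF False] using deg_eq_exchange_neg[OF v'(2)] by simp
  qed
  from deg_eq_div_left[OF v'(1) this] have v'': "deg_eq g (Xq (m + 1)) (- parity_wt (m - 1))" by simp
  show ?thesis
  proof
    show "fst g > 0" "snd g > 0" using assms by (simp_all add: g_def u_def)
    show "deg_le g (Xq m) (-1)" "deg_le g (Xq (m + 1)) (-1)"
      using v'(2) v'' by (auto simp: deg_eq_def parity_wt_def elim: deg_le_mono split: if_splits)
  qed
qed

text \<open>The mirror image of \<open>deg_right\<close>, with \<open>u (m + 2) = 1\<close> and
  \<open>u (m + 1) = -1\<close>. Here \<open>u\<close> increases, which yields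
  \<open>2 * snd g > fst g\<close>; this makes the weight of \<open>(-n, 2n)\<close> positive for
  \<open>n >= 1\<close>.\<close>

lemma deg_left:
  assumes "m \<le> -1"
  obtains g where "fst g > 0" "snd g > 0" "2 * snd g > fst g" "deg_le g (Xq m) (-1)" "deg_le g (Xq (m + 1)) (-1)"
proof -
  define u where "u x = 2 * x - 2 * m - 3" for x
  define g where "g = (2 * u 1, u 2)"
  have down: "m + 1 \<le> 1 - int n \<longrightarrow> deg_eq g (Xq (2 - int n)) (parity_wt (2 - int n) * u (2 - int n)) \<and>
      deg_eq g (Xq (1 - int n)) (parity_wt (1 - int n) * u (1 - int n))" for n
  proof (induction n)
    case 0
    then show ?case
      using deg_eq_Xe[of g "(1, 0)"] deg_eq_Xe[of g "(0, 1)"] by (simp add: Xq_1 Xq_2 wt_def g_def parity_wt_def)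
  next
    case (Suc n)
    define j where "j = 1 - int n"
    show ?case
    proof
      assume "m + 1 \<le> 1 - int (Suc n)"
      then have j: "m + 2 \<le> j" by (simp add: j_def)
      then have IH: "deg_eq g (Xq (j + 1)) (parity_wt (j + 1) * u (j + 1))" "deg_eq g (Xq j) (parity_wt j * u j)"
        using Suc by (simp_all add: j_def)
      have pos: "parity_wt j * u j > 0" using j by (simp add: u_def)
      have "deg_eq g (Xq (j - 1)) (parity_wt (j - 1) * u (j - 1))"
      proof (cases "even j")
        case True
        have "deg_eq g (Xq (j - 1) * Xq (j + 1)) (4 * (parity_wt j * u j))"
          unfolding Xq_exch_even[OF True]
          using deg_eq_exchange_pos[OF deg_eq_power[OF IH(2), of 4]] pos by simp
        from deg_eq_div_right[OF IH(1) this] show ?thesis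
          using True by (simp add: parity_wt_def u_def algebra_simps)
      next
        case False
        have "deg_eq g (Xq (j - 1) * Xq (j + 1)) (parity_wt j * u j)"
          unfolding Xq_exch_odd[OF False] using deg_eq_exchange_pos[OF IH(2)] pos by simp
        from deg_eq_div_right[OF IH(1) this] show ?thesis
          using False by (simp add: parity_wt_def u_def algebra_simps)
      qed
      then show "deg_eq g (Xq (2 - int (Suc n))) (parity_wt (2 - int (Suc n)) * u (2 - int (Suc n))) \<and>
          deg_eq g (Xq (1 - int (Suc n))) (parity_wt (1 - int (Suc n)) * u (1 - int (Suc n)))"
        using IH(2) by (simp add: j_def algebra_simps)
    qed
  qed
  have ind: "2 - int (nat (- m)) = m + 2" "1 - int (nat (- m)) = m + 1" using assms by simp_all
  have v: "deg_eq g (Xq (m + 2)) (parity_wt (m + 2) * u (m + 2))" "deg_eq g (Xq (m + 1)) (parity_wt (m + 1) * u (m + 1))"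
    using down[of "nat (- m)"] unfolding ind by simp_all
  then have v': "deg_eq g (Xq (m + 2)) (parity_wt (m + 2))" "deg_eq g (Xq (m + 1)) (- parity_wt (m + 1))"
    by (simp_all add: u_def)
  have "deg_eq g (Xq (m + 1 - 1) * Xq (m + 1 + 1)) 0"
  proof (cases "even (m + 1)")
    case True
    then show ?thesis
      unfolding Xq_exch_even[OF True] using deg_eq_exchange_neg[OF deg_eq_power[OF v'(2), of 4]] by simp
  next
    case False
    then show ?thesis
      unfolding Xq_exch_odd[OF False] using deg_eq_exchange_neg[OF v'(2)] by simp
  qed
  then have "deg_eq g (Xq m * Xq (m + 2)) 0" by (simp add: add.commute)
  from deg_eq_div_right[OF v'(1) this] have v'': "deg_eq g (Xq m) (- parity_wt (m + 2))" by simp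
  show ?thesis
  proof
    show "fst g > 0" "snd g > 0" "2 * snd g > fst g" using assms by (simp_all add: g_def u_def)
    show "deg_le g (Xq m) (-1)" "deg_le g (Xq (m + 1)) (-1)"
      using v'(2) v'' by (auto simp: deg_eq_def parity_wt_def elim: deg_le_mono split: if_splits)
  qed
qed

section \<open>Leading part of the Chebyshev elements\<close>

lemma Xe_power: "Xe e ^ n = Xe (scale_pt n e)"
proof (induction n)
  case 0
  then show ?case by (simp add: one_mon scale_pt_def zero_prod_def)
next
  case (Suc n)
  have "e + scale_pt n e = scale_pt (Suc n) e" by (simp add: scale_pt_def prod_eq_iff algebra_simps)
  moreover have "lam e (scale_pt n e) = 0" by (simp add: lam_def scale_pt_def)
  ultimately show ?case by (simp add: Suc Xe_mult)
qed

lemma cluster_mon_1: "cluster_mon 1 a b = Xe (int a, int b)"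
  by (simp add: cluster_mon_def Xq_1 Xq_2 Xe_power scale_pt_def Xe_mult lam_def flip: tq_add)

text \<open>The analogue of \<open>z^n + z^(-n)\<close> for \<open>z = X^(1,-2)\<close>, whose
  powers commute. Both terms have weight 0 for \<open>(2, 1)\<close>, and all other terms of
  \<open>Xdelta_qt\<close> have negative weight, so this is the leading part of
  \<open>F_n(X_delta)\<close>.\<close>

definition ray_pair :: "int \<Rightarrow> qt" where
  "ray_pair n = Xe (n, - 2 * n) + Xe (- n, 2 * n)"

lemma ray_pair_mult: "ray_pair n * ray_pair 1 = ray_pair (n + 1) + ray_pair (n - 1)"
  by (simp add: ray_pair_def distrib_left distrib_right Xe_mult lam_def algebra_simps)

lemma ray_pair_0: "ray_pair 0 = 2 \<cdot> 1"
  using sm_add_left[of 1 1 "1 :: qt"] by (simp add: ray_pair_def one_mon zero_prod_def)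

lemma deg_le_ray_pair: "deg_le (2, 1) (ray_pair n) 0"
  unfolding ray_pair_def by (intro deg_le_add deg_le_Xe) (simp_all add: wt_def)

lemma Xdelta_qt_leading: "deg_le (2, 1) (Xdelta_qt - ray_pair 1) (-1)"
proof -
  have "Xdelta_qt - ray_pair 1 = Xe (-1, -2) + (tq (-1) + tq 1) \<cdot> Xe (0, -2)"
    by (simp add: Xdelta_qt_def ray_pair_def)
  moreover have "deg_le (2, 1) \<dots> (-1)"
    by (intro deg_le_add deg_le_sm deg_le_Xe) (simp_all add: wt_def)
  ultimately show ?thesis by simp
qed

text \<open>The choice of Chebyshev polynomials of the first kind is responsible for the missing
  constant term.\<close>

lemma cheb_delta_leading: "n \<ge> 1 \<Longrightarrow> deg_le (2, 1) (cheb_delta n - ray_pair (int n)) (-1)"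
proof (induction n rule: cheb_delta.induct)
  case 2
  then show ?case using Xdelta_qt_leading by simp
next
  case 3
  define r where "r = Xdelta_qt - ray_pair 1"
  have r: "deg_le (2, 1) r (-1)" using Xdelta_qt_leading by (simp add: r_def)
  have z: "Xdelta_qt = ray_pair 1 + r" by (simp add: r_def)
  \<comment> \<open>\<open>ray_pair 0\<close> is the constant 2 that \<open>F_2\<close>
    subtracts.\<close>
  have "Xdelta_qt * Xdelta_qt - ray_pair 0 - ray_pair 2 = ray_pair 1 * r + r * ray_pair 1 + r * r"
    unfolding z using ray_pair_mult[of 1] by (simp add: algebra_simps)
  moreover have "deg_le (2, 1) \<dots> (-1)"
    using deg_le_mult[OF deg_le_ray_pair r] deg_le_mult[OF r deg_le_ray_pair] deg_le_mult[OF r r]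
    by (intro deg_le_add) (auto elim: deg_le_mono)
  ultimately show ?case by (simp add: ray_pair_0)
next
  case (4 n)
  define r where "r = Xdelta_qt - ray_pair 1"
  have r: "deg_le (2, 1) r (-1)" using Xdelta_qt_leading by (simp add: r_def)
  have z: "Xdelta_qt = ray_pair 1 + r" by (simp add: r_def)
  have vz: "deg_le (2, 1) Xdelta_qt 0"
    unfolding z using r deg_le_ray_pair by (intro deg_le_add) (auto elim: deg_le_mono)
  define s where "s = cheb_delta (Suc (Suc n)) - ray_pair (int n + 2)"
  define s' where "s' = cheb_delta (Suc n) - ray_pair (int n + 1)"
  have s: "deg_le (2, 1) s (-1)" "deg_le (2, 1) s' (-1)"
    using 4 by (simp_all add: s_def s'_def add.commute)
  have "cheb_delta (Suc (Suc (Suc n))) = (s + ray_pair (int n + 2)) * Xdelta_qt - (s' + ray_pair (int n + 1))"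
    by (simp add: s_def s'_def)
  also have "\<dots> = s * Xdelta_qt + ray_pair (int n + 2) * ray_pair 1 + ray_pair (int n + 2) * r - s' - ray_pair (int n + 1)"
    by (simp add: z distrib_left distrib_right)
  also have "ray_pair (int n + 2) * ray_pair 1 = ray_pair (int n + 3) + ray_pair (int n + 1)"
    using ray_pair_mult[of "int n + 2"] by (simp add: add.commute)
  finally have "cheb_delta (Suc (Suc (Suc n))) - ray_pair (int n + 3) = s * Xdelta_qt + ray_pair (int n + 2) * r - s'"
    by simp
  moreover have "deg_le (2, 1) \<dots> (-1)"
    using deg_le_mult[OF s(1) vz] deg_le_mult[OF deg_le_ray_pair r] s(2)
    by (intro deg_le_add deg_le_diff) auto
  ultimately show ?case by (simp add: add.commute)
qed simp

lemma coef_cheb_delta: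
  assumes "n \<ge> 1" "wt (2, 1) e \<ge> 0"
  shows "coef (cheb_delta n) e = coef (ray_pair (int n)) e"
  using vleD[OF cheb_delta_leading[OF assms(1)], of e] assms(2) by simp

text \<open>The clusters \<open>(X_2, X_3)\<close> and \<open>(X_0, X_1)\<close> contain an initial
  variable, so no positive weight is negative on both members. There the weights
  \<open>(1, 0)\<close> and \<open>(0, 1)\<close> serve, with the exponent of the new variable
  nonzero. For a Chebyshev element only \<open>ray_pair\<close> could contribute, and its exponents
  have coordinates of opposite signs.\<close>

lemma coef_basis_set_quadrant:
  assumes "x \<in> basis_set" "0 \<le> i" "0 \<le> j" "x \<noteq> Xe (i, j)"
  shows "coef x (i, j) = 0"
  using assms(1)
proof (cases rule: basis_set_cases)
  case (mid a b)
  then show ?thesis using assms(4) by (auto simp: cluster_mon_1 coef_mon)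
next
  case (right m a b)
  show ?thesis
  proof (cases "m = 2")
    case True
    \<comment> \<open>\<open>X_1\<close> is a unit of the torus, so the exchange relation at 2 gives
      \<open>X_3\<close> explicitly.\<close>
    have "Xq 3 = Xe (-1, 0) * (Xq 1 * Xq 3)"
      by (simp add: Xq_1 Xe_mult lam_def one_mon[symmetric] zero_prod_def[symmetric] flip: mult.assoc)
    also have "\<dots> = Xe (-1, 0) * (tq 4 \<cdot> Xq 2 ^ 4 + 1)"
      using Xq_exch_even[of 2] by simp
    finally have X3: "Xq 3 = Xe (-1, 0) * (tq 4 \<cdot> Xq 2 ^ 4 + 1)" .
    have X2: "deg_le (1, 0) (Xq 2) 0" by (simp add: Xq_2 deg_le_Xe wt_def)
    have "deg_le (1, 0) (Xq 3) (- 1 + 0)"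
      unfolding X3
    proof (intro deg_le_mult deg_le_add deg_le_sm)
      show "deg_le (1, 0) (Xe (- 1, 0)) (- 1)" by (simp add: deg_le_Xe wt_def)
      show "deg_le (1, 0) (Xq 2 ^ 4) 0" using deg_le_power[OF X2, of 4] by simp
      show "deg_le (1, 0) 1 0" using deg_eq_1 by (simp add: deg_eq_def)
    qed
    then have "deg_le (1, 0) x (int a * 0 + int b * (-1))"
      using deg_le_cluster_mon[of "(1, 0)" 2 0 "-1" a b] X2 right(4) True by simp
    then show ?thesis
      by (rule vleD) (use assms right True in \<open>auto simp: wt_def\<close>)
  next
    case False
    then have "m \<ge> 3" using right by simp
    then obtain g where g: "fst g > 0" "snd g > 0" "deg_le g (Xq m) (-1)" "deg_le g (Xq (m + 1)) (-1)"
      by (rule deg_right)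
    have "deg_le g x (int a * (-1) + int b * (-1))"
      using deg_le_cluster_mon[OF g(3,4)] right by simp
    moreover have "wt g (i, j) \<ge> 0" using g assms by (simp add: wt_def)
    ultimately show ?thesis using right by (intro vleD) auto
  qed
next
  case (left m a b)
  show ?thesis
  proof (cases "m = 0")
    case True
    have "deg_le (0, 1) (Xq 0) (-1)"
      unfolding Xq_small ev_0 ev0_def by (intro deg_le_add deg_le_Xe) (simp_all add: wt_def)
    moreover have "deg_le (0, 1) (Xq 1) 0" by (simp add: Xq_1 deg_le_Xe wt_def)
    ultimately have "deg_le (0, 1) x (int a * (-1) + int b * 0)"
      using deg_le_cluster_mon[of "(0, 1)" 0 "-1" 0 a b] left(4) True by simp
    then show ?thesis
      by (rule vleD) (use assms left True in \<open>auto simp: wt_def\<close>)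
  next
    case False
    then have "m \<le> -1" using left by simp
    then obtain g where g: "fst g > 0" "snd g > 0" "deg_le g (Xq m) (-1)" "deg_le g (Xq (m + 1)) (-1)"
      by (rule deg_left)
    have "deg_le g x (int a * (-1) + int b * (-1))"
      using deg_le_cluster_mon[OF g(3,4)] left by simp
    moreover have "wt g (i, j) \<ge> 0" using g assms by (simp add: wt_def)
    ultimately show ?thesis using left by (intro vleD) auto
  qed
next
  case (cheb n)
  have "wt (2, 1) (i, j) \<ge> 0" using assms by (simp add: wt_def)
  then have "coef x (i, j) = coef (ray_pair (int n)) (i, j)" using coef_cheb_delta cheb by simp
  then show ?thesis using cheb assms by (simp add: ray_pair_def coef_mon)
qed

lemma cheb_delta_inj: "cheb_delta n = cheb_delta n' \<Longrightarrow> n = n'"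
proof -
  assume eq: "cheb_delta n = cheb_delta n'"
  have "(- int n, - 2 * int n) = (- int n', - 2 * int n')"
    by (rule pointed_unique[OF cheb_delta_pointed]) (unfold eq, rule cheb_delta_pointed)
  then show ?thesis by simp
qed

text \<open>The weight of the exponent is strictly positive, so the monomial 1 with
  \<open>a = b = 0\<close>, of degree 0, is covered as well.\<close>

lemma coef_cluster_mon_ray:
  assumes "m \<le> -1" "n \<ge> 1"
  shows "coef (cluster_mon m a b) (- int n, 2 * int n) = 0"
proof -
  obtain g where g: "fst g > 0" "2 * snd g > fst g" "deg_le g (Xq m) (-1)" "deg_le g (Xq (m + 1)) (-1)"
    using deg_left[OF assms(1)] by metis
  have "deg_le g (cluster_mon m a b) (int a * (-1) + int b * (-1))"
    by (rule deg_le_cluster_mon[OF g(3,4)])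
  moreover have "wt g (- int n, 2 * int n) = int n * (2 * snd g - fst g)"
    by (simp add: wt_def algebra_simps)
  then have "wt g (- int n, 2 * int n) > 0" using g assms by simp
  then have "int a * (-1) + int b * (-1) < wt g (- int n, 2 * int n)" by linarith
  ultimately show ?thesis by (rule vleD)
qed

lemma coef_cheb_delta_ray: "n \<ge> 1 \<Longrightarrow> n' \<ge> 1 \<Longrightarrow> coef (cheb_delta n') (- int n, 2 * int n) = (if n' = n then 1 else 0)"
  by (subst coef_cheb_delta) (auto simp: wt_def ray_pair_def coef_mon)

section \<open>Extracting the coefficients of a positive element\<close>

lemma rep_sum: "(\<Sum>a\<in>A. rep (f a)) = rep (\<Sum>a\<in>A. f a)"
  by (induction A rule: infinite_finite_induct) (simp_all add: zero_qt.rep_eq plus_qt.rep_eq)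

lemma laurent_exp_rep:
  "laurent_exp m c (rep y) \<Longrightarrow> \<exists>N. Xq m ^ N * y * Xq (m + 1) ^ N =
     (\<Sum>e\<in>Poly_Mapping.keys c. Poly_Mapping.lookup c e \<cdot>
        (Xq m ^ nat (fst e + int N) * Xq (m + 1) ^ nat (snd e + int N)))"
  by (auto simp: laurent_exp_def Xc_eq rep_simps rep_sum split_beta)

context reindexed
begin

lemma nonneg_coeffs_of_positive:
  assumes "positive (rep y)" "rel (Xe u) (Xq m)" "rel (Xe v) (Xq (m + 1))" "rel Z y"
  shows "nonneg_coeffs Z"
proof -
  obtain c where c: "laurent_exp m c (rep y)" "\<And>e. lpoly_nonneg (Poly_Mapping.lookup c e)"
    using assms(1) unfolding positive_def by blast
  from laurent_exp_rep[OF c(1)] obtain N where "Xq m ^ N * y * Xq (m + 1) ^ N =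
     (\<Sum>e\<in>Poly_Mapping.keys c. Poly_Mapping.lookup c e \<cdot>
        (Xq m ^ nat (fst e + int N) * Xq (m + 1) ^ nat (snd e + int N)))" by blast
  with assms c(2) show ?thesis by (intro nonneg_coeffs_of_laurent) auto
qed

text \<open>The basis is stable under the reindexing, so the expansion of each basis element is
  again a basis element, and the one of \<open>b0\<close> is an initial monomial. The separation
  property is thus needed in the initial cluster only.\<close>

lemma cluster_coefficient_nonneg:
  assumes pos: "positive (rep (\<Sum>b\<in>S. c b \<cdot> b))" and S: "finite S" "S \<subseteq> basis_set" "b0 \<in> S"
    and uv: "rel (Xe u) (Xq m)" "rel (Xe v) (Xq (m + 1))"
    and basis_set: "\<And>b. b \<in> basis_set \<Longrightarrow> \<exists>b'\<in>basis_set. rel b' b"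
    and b0: "rel (cluster_mon 1 i j) b0"
  shows "lpoly_nonneg (c b0)"
proof -
  obtain \<phi> where \<phi>: "\<And>b. b \<in> basis_set \<Longrightarrow> \<phi> b \<in> basis_set \<and> rel (\<phi> b) b"
    using basis_set by metis
  have \<phi>0: "\<phi> b0 = Xe (int i, int j)"
    using rel_functional[OF _ b0] \<phi> S by (auto simp: cluster_mon_1)
  show ?thesis
  proof (rule coefficient_nonneg[where \<phi> = \<phi> and e = "(int i, int j)", OF S(1)])
    show "rel (\<phi> b) b" if "b \<in> S" for b using that \<phi> S by blast
    show "nonneg_coeffs Z" if "rel Z (\<Sum>b\<in>S. c b \<cdot> b)" for Z
      using nonneg_coeffs_of_positive[OF pos uv that] .
    show "coef (\<phi> b0) (int i, int j) = 1" by (simp add: \<phi>0 coef_mon)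
    fix b assume b: "b \<in> S" "b \<noteq> b0"
    then have "\<phi> b \<noteq> \<phi> b0" using \<phi> S rel_injective by (metis subsetD)
    then show "coef (\<phi> b) (int i, int j) = 0"
      using coef_basis_set_quadrant[of "\<phi> b" "int i" "int j"] \<phi> b S \<phi>0 by auto
  qed (rule S)
qed

end

lemma shift_rel_cluster_mon:
  assumes "odd m"
  shows "reindexed.rel (\<lambda>k. Xq (k + m - 1)) 1 id (cluster_mon k a b) (cluster_mon (k + m - 1) a b)"
proof -
  interpret R: reindexed "\<lambda>k. Xq (k + m - 1)" 1 id using assms by (rule shift_reindexed)
  have "R.rel (cluster_mon k a b) (id (tq (- (int a * int b))) \<cdot> (Xq (k + m - 1) ^ a * Xq (k + 1 + m - 1) ^ b))"
    unfolding cluster_mon_def by (intro R.rel_sm R.rel_mult R.rel_power R.rel_Xq)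
  then show ?thesis by (simp add: cluster_mon_def algebra_simps)
qed

lemma cluster_mon_coefficient_nonneg:
  assumes "positive (rep (\<Sum>b\<in>S. c b \<cdot> b))" "finite S" "S \<subseteq> basis_set" "cluster_mon m i j \<in> S"
  shows "lpoly_nonneg (c (cluster_mon m i j))"
proof (cases "even m")
  case False
  interpret R: reindexed "\<lambda>k. Xq (k + m - 1)" 1 id using False by (rule shift_reindexed)
  note cluster_mon = shift_rel_cluster_mon[OF False]
  show ?thesis
  proof (rule R.cluster_coefficient_nonneg[OF assms])
    show "R.rel (Xe (1, 0)) (Xq m)" "R.rel (Xe (0, 1)) (Xq (m + 1))"
      using R.rel_Xq[of 1] R.rel_Xq[of 2] by (simp_all add: Xq_1 Xq_2 algebra_simps)
    show "R.rel (cluster_mon 1 i j) (cluster_mon m i j)" using cluster_mon[of 1 i j] by simp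
    fix b assume "b \<in> basis_set"
    then consider k a l where "b = cluster_mon k a l" | n where "n \<ge> 1" "b = cheb_delta n" by (auto simp: basis_set_def)
    then show "\<exists>b'\<in>basis_set. R.rel b' b"
    proof cases
      case 1
      then have "R.rel (cluster_mon (k - m + 1) a l) b" using cluster_mon[of "k - m + 1" a l] by simp
      then show ?thesis using cluster_mon_basis_set by blast
    next
      case 2
      then show ?thesis using R.rel_cheb_delta[of n] cheb_delta_basis_set by blast
    qed
  qed
next
  case True
  interpret R: reindexed "\<lambda>k. Xq (m + 2 - k)" "-1" tbar using True by (rule reflect_reindexed)
  have cluster_mon: "R.rel (cluster_mon (m + 1 - k) b a) (cluster_mon k a b)" for k a b
  proof -
    have "R.rel (cluster_mon (m + 1 - k) b a) (tbar (tq (- (int b * int a))) \<cdot>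
        (Xq (m + 2 - (m + 1 - k)) ^ b * Xq (m + 2 - (m + 1 - k + 1)) ^ a))"
      unfolding cluster_mon_def by (intro R.rel_sm R.rel_mult R.rel_power R.rel_Xq)
    also have "m + 2 - (m + 1 - k) = k + 1" by simp
    also have "m + 2 - (m + 1 - k + 1) = k" by simp
    also have "tbar (tq (- (int b * int a))) \<cdot> (Xq (k + 1) ^ b * Xq k ^ a) = cluster_mon k a b"
      using qcomm_power[OF Xq_comm, of k a b] by (simp add: R.tau_tq cluster_mon_def ac_simps flip: tq_add)
    finally show ?thesis .
  qed
  show ?thesis
  proof (rule R.cluster_coefficient_nonneg[OF assms])
    \<comment> \<open>The reflection makes \<open>X_m\<close> the second and \<open>X_(m+1)\<close>
      the first variable.\<close>
    show "R.rel (Xe (0, 1)) (Xq m)" "R.rel (Xe (1, 0)) (Xq (m + 1))"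
      using R.rel_Xq[of 1] R.rel_Xq[of 2] by (simp_all add: Xq_1 Xq_2 add.commute)
    show "R.rel (cluster_mon 1 j i) (cluster_mon m i j)" using cluster_mon[of m j i] by simp
    fix b assume "b \<in> basis_set"
    then consider k a l where "b = cluster_mon k a l" | n where "n \<ge> 1" "b = cheb_delta n" by (auto simp: basis_set_def)
    then show "\<exists>b'\<in>basis_set. R.rel b' b"
    proof cases
      case 1
      then have "R.rel (cluster_mon (m + 1 - k) l a) b" using cluster_mon by simp
      then show ?thesis using cluster_mon_basis_set by blast
    next
      case 2
      then show ?thesis using R.rel_cheb_delta[of n] cheb_delta_basis_set by blast
    qed
  qed
qed

text \<open>Seen from a cluster far to the right, every cluster monomial of the finite set
  \<open>S\<close> has a negative index and no term at \<open>(-n, 2n)\<close>, whereas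
  \<open>F_n(X_delta)\<close> is unchanged and has this term. Among the Chebyshev elements,
  \<open>n\<close> is the only index with it.\<close>

lemma cheb_delta_coefficient_nonneg:
  assumes pos: "positive (rep (\<Sum>b\<in>S. c b \<cdot> b))" and S: "finite S" "S \<subseteq> basis_set" and n: "cheb_delta n \<in> S" "n \<ge> 1"
  shows "lpoly_nonneg (c (cheb_delta n))"
proof -
  have "\<exists>K. \<forall>b\<in>S. (\<exists>n\<ge>1. b = cheb_delta n) \<or> (\<exists>k a l. k \<le> K \<and> b = cluster_mon k a l)"
    using S
  proof (induction S rule: finite_induct)
    case (insert x F)
    then obtain K where K: "\<forall>b\<in>F. (\<exists>n\<ge>1. b = cheb_delta n) \<or> (\<exists>k a l. k \<le> K \<and> b = cluster_mon k a l)" by auto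
    have "x \<in> basis_set" using insert by simp
    then consider k a l where "x = cluster_mon k a l" | n where "n \<ge> 1" "x = cheb_delta n" by (auto simp: basis_set_def)
    then show ?case
    proof cases
      case 1
      have "\<forall>b\<in>F. (\<exists>n\<ge>1. b = cheb_delta n) \<or> (\<exists>k' a l. k' \<le> max k K \<and> b = cluster_mon k' a l)"
        using K by (meson max.coboundedI2)
      moreover have "\<exists>k' a l. k' \<le> max k K \<and> x = cluster_mon k' a l" using 1 max.cobounded1 by blast
      ultimately show ?thesis by blast
    next
      case 2
      then show ?thesis using K by blast
    qed
  qed simp
  then obtain K where K: "\<And>b. b \<in> S \<Longrightarrow> (\<exists>n\<ge>1. b = cheb_delta n) \<or> (\<exists>k a l. k \<le> K \<and> b = cluster_mon k a l)" by blast
  \<comment> \<open>Odd, as a shift requires, and at least \<open>K + 2\<close>, so that all shifted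
    indices \<open>k - m + 1\<close> are at most -1.\<close>
  define m where "m = 2 * \<bar>K\<bar> + 3"
  have m: "odd m" "\<And>k. k \<le> K \<Longrightarrow> k - m + 1 \<le> -1" by (auto simp: m_def)
  interpret R: reindexed "\<lambda>k. Xq (k + m - 1)" 1 id using m(1) by (rule shift_reindexed)
  note cluster_mon = shift_rel_cluster_mon[OF m(1)]
  let ?e = "(- int n, 2 * int n)"
  have "\<exists>b'. R.rel b' b \<and> coef b' ?e = (if b = cheb_delta n then 1 else 0)" if b: "b \<in> S" for b
    using K[OF b]
  proof
    assume "\<exists>n\<ge>1. b = cheb_delta n"
    then obtain n' where n': "n' \<ge> 1" "b = cheb_delta n'" by blast
    have "b = cheb_delta n \<longleftrightarrow> n' = n" using cheb_delta_inj n'(2) by blast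
    then have "coef b ?e = (if b = cheb_delta n then 1 else 0)"
      using coef_cheb_delta_ray[OF n(2) n'(1)] n'(2) by simp
    then show ?thesis using R.rel_cheb_delta n'(2) by blast
  next
    assume "\<exists>k a l. k \<le> K \<and> b = cluster_mon k a l"
    then obtain k a l where k: "k \<le> K" "b = cluster_mon k a l" by blast
    have b': "R.rel (cluster_mon (k - m + 1) a l) b" using cluster_mon[of "k - m + 1" a l] k by simp
    have coef: "coef (cluster_mon (k - m + 1) a l) ?e = 0" using coef_cluster_mon_ray[OF m(2)[OF k(1)] n(2)] .
    have "b \<noteq> cheb_delta n"
    proof
      assume "b = cheb_delta n"
      then have "cluster_mon (k - m + 1) a l = cheb_delta n" using R.rel_functional b' R.rel_cheb_delta by blast
      then show False using coef coef_cheb_delta_ray[OF n(2) n(2)] by simp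
    qed
    then show ?thesis using b' coef by auto
  qed
  then obtain \<phi> where \<phi>: "\<And>b. b \<in> S \<Longrightarrow> R.rel (\<phi> b) b \<and> coef (\<phi> b) ?e = (if b = cheb_delta n then 1 else 0)"
    by metis
  have uv: "R.rel (Xe (1, 0)) (Xq m)" "R.rel (Xe (0, 1)) (Xq (m + 1))"
    using R.rel_Xq[of 1] R.rel_Xq[of 2] by (simp_all add: Xq_1 Xq_2 algebra_simps)
  show ?thesis
  proof (rule R.coefficient_nonneg[where \<phi> = \<phi> and e = ?e, OF S(1)])
    show "nonneg_coeffs Z" if "R.rel Z (\<Sum>b\<in>S. c b \<cdot> b)" for Z
      using R.nonneg_coeffs_of_positive[OF pos uv that] .
  qed (use \<phi> n in auto)
qed

section \<open>Transfer to the original representation of the torus\<close>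

interpretation T: module tsmul
proof
  fix a b x y
  show "tsmul a (x + y) = tsmul a x + tsmul a y" by (simp add: tsmul_def tmult_add_right)
  show "tsmul (a + b) x = tsmul a x + tsmul b x" by (simp add: tsmul_def single_add tmult_add_left)
  show "tsmul a (tsmul b x) = tsmul (a * b) x"
    using rep_sm[of b "mk x"] rep_sm[of a "b \<cdot> mk x"] rep_sm[of "a * b" "mk x"] by simp
  show "tsmul 1 x = x" using rep_sm[of 1 "mk x"] by simp
qed

interpretation rep: module_hom sm tsmul rep
  by unfold_locales (simp_all add: plus_qt.rep_eq rep_sm)

theorem theorem3p7:
  shows "Bset \<subseteq> Aq \<and> module.span tsmul Bset = Aq \<and> \<not> module.dependent tsmul Bset \<and>
         (\<forall>Y. positive Y \<longrightarrow>
            (\<exists>S c. finite S \<and> S \<subseteq> Bset \<and> (\<forall>b\<in>S. lpoly_nonneg (c b)) \<and>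
                   Y = (\<Sum>b\<in>S. tsmul (c b) b)))"
proof (intro conjI allI impI)
  show "Bset \<subseteq> Aq" by (auto simp: Bset_eq basis_set_Aq)
  show "T.span Bset = Aq"
  proof -
    have "T.span Bset = rep ` Q.span basis_set" unfolding Bset_eq by (rule rep.span_image)
    also have "\<dots> = Aq"
      using Aq_span_basis_set by (auto simp: image_iff) (metis rep_mk)
    finally show ?thesis .
  qed
  have inj: "inj rep" by (simp add: inj_def rep_inject)
  show "\<not> T.dependent Bset"
    unfolding Bset_eq using basis_set_independent inj by (intro rep.independent_inj_image)
  fix Y assume Y: "positive Y"
  then have "mk Y \<in> Q.span basis_set" by (simp add: positive_def flip: Aq_span_basis_set)
  then obtain S c where S: "finite S" "S \<subseteq> basis_set" "mk Y = (\<Sum>b\<in>S. c b \<cdot> b)"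
    by (auto simp: Q.span_explicit)
  have "Y = rep (\<Sum>b\<in>S. c b \<cdot> b)" by (simp flip: S(3))
  then have pos: "positive (rep (\<Sum>b\<in>S. c b \<cdot> b))" using Y by simp
  have "lpoly_nonneg (c b)" if "b \<in> S" for b
  proof -
    from that S(2) consider m i j where "b = cluster_mon m i j" | n where "n \<ge> 1" "b = cheb_delta n"
      by (auto simp: basis_set_def)
    then show ?thesis
      using cluster_mon_coefficient_nonneg[OF pos S(1,2)] cheb_delta_coefficient_nonneg[OF pos S(1,2)] that
      by cases auto
  qed
  moreover have "Y = (\<Sum>b\<in>rep ` S. tsmul (c (mk b)) b)"
    using \<open>Y = rep _\<close> inj by (simp add: sum.reindex inj_on_subset rep_inverse rep_sm rep_sum)
  ultimately show "\<exists>S c. finite S \<and> S \<subseteq> Bset \<and> (\<forall>b\<in>S. lpoly_nonneg (c b)) \<and> Y = (\<Sum>b\<in>S. tsmul (c b) b)"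
    using S(1,2) by (intro exI[of _ "rep ` S"] exI[of _ "\<lambda>b. c (mk b)"]) (auto simp: Bset_eq rep_inverse)
qed

end
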